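(* Let $p\ge2$ be an integer, $r_0,r_2,\varepsilon_0,\delta>0$ with $\delta$ sufficiently small, $D_1=D(0,r_0)$, $D_2=D(0,r_2)$, $\Sigma=S(-\delta,\delta,\varepsilon_0)$. Put $\alpha=-\frac{3\pi}{2p}+\frac{2\delta}p$, $\beta=\frac{3\pi}{2p}-\frac{2\delta}p$ and fix $r_1\in\left]0,r_0(\cos(2\delta))^{1/p}\right[$. Consider the equation $$\varepsilon y'=px^{p-1}y+\varepsilon P(x,y,\varepsilon),\qquad\varepsilon=\eta^p,$$ with $P$ analytic and bounded on $D_1\times D_2\times\Sigma$ and admitting a uniform asymptotic expansion (in powers of $\varepsilon$) as $\Sigma\ni\varepsilon\to0$. Then for every $\mu>0$ there exist $\eta_1>0$ and a solution $y(x,\eta)$ of the equation defined for $\eta\in S_1=S(-\frac\delta p,\frac\delta p,\eta_1)$ and $x\in V(\eta)=V(\alpha,\beta,r_1,\mu|\eta|)$. Moreover $y$ has a combined asymptotic expansion (DAC) as $S_1\ni\eta\to0$, $x\in V(\eta)$.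
   Context: $D(0,r)$ is the open disc; $S(\alpha,\beta,r)=\{x\in\mathbb C:0<|x|<r,\ \alpha<\arg x<\beta\}$; for $\mu>0$, $V(\alpha,\beta,r,\mu)=\{x:(|x|<r\text{ and }\alpha<\arg x<\beta)\text{ or }|x|<\mu\}$. "$\delta$ sufficiently small" means: smaller than some positive number depending only on $p$. $\mathcal H(r)$: bounded holomorphic functions on $D(0,r)$. $\mathcal G(V)$ (for an infinite quasi-sector $V$): bounded holomorphic functions on $V$ with a Poincaré asymptotic expansion without constant term $g(X)\sim\sum_{m\ge1}g_mX^{-m}$ as $V\ni X\to\infty$. DAC: let $V=V(\alpha',\beta',\infty,\mu)$, $S_2=S(\alpha_2,\beta_2,\eta_1)$ and $\alpha_1<\beta_1$ with $\alpha'\le\alpha_1-\beta_2<\beta_1-\alpha_2\le\beta'$ (so that $\eta\in S_2$, $x\in V(\alpha_1,\beta_1,r,\mu|\eta|)$ imply $x/\eta\in V$). A holomorphic function $y(x,\eta)$ defined for $\eta\in S_2$, $x\in V(\alpha_1,\beta_1,r,\mu|\eta|)$ has the DAC $\sum_{n\ge0}(a_n(x)+g_n(\frac x\eta))\eta^n$, where $a_n\in\mathcal H(r)$, $g_n\in\mathcal G(V)$, if for every $N$ there is $K_N$ with $|y(x,\eta)-\sum_{n=0}^{N-1}(a_n(x)+g_n(\frac x\eta))\eta^n|\le K_N|\eta|^N$ for all such $(x,\eta)$. *)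

theory Defs
  imports "HOL-Complex_Analysis.Complex_Analysis" "HOL-Library.Landau_Symbols"
begin

(* Some determination of the argument of x lies in the open interval; for
   -pi <= \<alpha> < \<beta> <= pi this says x \<noteq> 0 and \<alpha> < Arg x < \<beta>. *)
definition arg_between :: "real \<Rightarrow> real \<Rightarrow> complex \<Rightarrow> bool" where
  "arg_between \<alpha> \<beta> x \<longleftrightarrow> x \<noteq> 0 \<and> (\<exists>\<theta>. \<alpha> < \<theta> \<and> \<theta> < \<beta> \<and> is_Arg x \<theta>)"

definition sector :: "real \<Rightarrow> real \<Rightarrow> real \<Rightarrow> complex set" where
  "sector \<alpha> \<beta> r = {x. 0 < cmod x \<and> cmod x < r \<and> arg_between \<alpha> \<beta> x}"

(* The radius is an extended real because infinite quasi-sectors are needed too. *)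
definition quasi_sector :: "real \<Rightarrow> real \<Rightarrow> ereal \<Rightarrow> real \<Rightarrow> complex set" where
  "quasi_sector \<alpha> \<beta> r \<mu> =
     {x. (ereal (cmod x) < r \<and> arg_between \<alpha> \<beta> x) \<or> cmod x < \<mu>}"

(* Holomorphy in several variables: complex-linear total derivative at every point.
   Both predicates are used on open sets only. *)
definition holomorphic2_on :: "(complex \<times> complex \<Rightarrow> complex) \<Rightarrow> (complex \<times> complex) set \<Rightarrow> bool" where
  "holomorphic2_on f S \<longleftrightarrow>
     (\<forall>z\<in>S. \<exists>a b. (f has_derivative (\<lambda>(u, v). a * u + b * v)) (at z))"

definition holomorphic3_on ::
    "(complex \<times> complex \<times> complex \<Rightarrow> complex) \<Rightarrow> (complex \<times> complex \<times> complex) set \<Rightarrow> bool" where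
  "holomorphic3_on f S \<longleftrightarrow>
     (\<forall>z\<in>S. \<exists>a b c. (f has_derivative (\<lambda>(u, v, w). a * u + b * v + c * w)) (at z))"

definition bounded_holomorphic :: "real \<Rightarrow> (complex \<Rightarrow> complex) set" where
  "bounded_holomorphic r = {a. a holomorphic_on ball 0 r \<and> bounded (a ` ball 0 r)}"

definition bounded_asymptotic :: "complex set \<Rightarrow> (complex \<Rightarrow> complex) set" where
  "bounded_asymptotic V = {g. g holomorphic_on V \<and> bounded (g ` V) \<and>
     (\<exists>c :: nat \<Rightarrow> complex. \<forall>N.
        (\<lambda>X. g X - (\<Sum>m = 1..<N. c m / X ^ m)) \<in> O[inf at_infinity (principal V)](\<lambda>X. 1 / X ^ N))}"

definition has_uniform_expansion ::
    "(complex \<Rightarrow> complex \<Rightarrow> complex \<Rightarrow> complex) \<Rightarrow> complex set \<Rightarrow> complex set \<Rightarrow> complex set \<Rightarrow> bool" where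
  "has_uniform_expansion P D\<^sub>1 D\<^sub>2 \<Sigma> \<longleftrightarrow>
     (\<exists>c :: nat \<Rightarrow> complex \<Rightarrow> complex \<Rightarrow> complex. \<forall>N. \<exists>K. \<forall>\<^sub>F \<epsilon> in at 0 within \<Sigma>.
        \<forall>x\<in>D\<^sub>1. \<forall>y\<in>D\<^sub>2. cmod (P x y \<epsilon> - (\<Sum>n<N. c n x y * \<epsilon> ^ n)) \<le> K * cmod \<epsilon> ^ N)"

(* Combined asymptotic expansion of y x \<eta> for \<eta> in the sector S\<^sub>2 = sector \<alpha>\<^sub>2 \<beta>\<^sub>2 \<eta>\<^sub>1 and
   x in the quasi-sector of radii r and \<mu> |\<eta>|.  The inclusion in ball 0 r
   (that is, \<mu> |\<eta>| <= r) is implicit in the informal definition: a n x has to make sense. *)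
definition has_DAC ::
    "(complex \<Rightarrow> complex \<Rightarrow> complex) \<Rightarrow> real \<Rightarrow> real \<Rightarrow> real \<Rightarrow> real \<Rightarrow> real \<Rightarrow> real \<Rightarrow> real \<Rightarrow> bool" where
  "has_DAC y \<alpha>\<^sub>1 \<beta>\<^sub>1 r \<mu> \<alpha>\<^sub>2 \<beta>\<^sub>2 \<eta>\<^sub>1 \<longleftrightarrow>
     \<alpha>\<^sub>1 < \<beta>\<^sub>1 \<and>
     (\<forall>\<eta>\<in>sector \<alpha>\<^sub>2 \<beta>\<^sub>2 \<eta>\<^sub>1. quasi_sector \<alpha>\<^sub>1 \<beta>\<^sub>1 r (\<mu> * cmod \<eta>) \<subseteq> ball 0 r) \<and>
     holomorphic2_on (\<lambda>(x, \<eta>). y x \<eta>)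
       {(x, \<eta>). \<eta> \<in> sector \<alpha>\<^sub>2 \<beta>\<^sub>2 \<eta>\<^sub>1 \<and> x \<in> quasi_sector \<alpha>\<^sub>1 \<beta>\<^sub>1 r (\<mu> * cmod \<eta>)} \<and>
     (\<exists>\<alpha>' \<beta>'. \<exists>a g :: nat \<Rightarrow> complex \<Rightarrow> complex.
        \<alpha>' \<le> \<alpha>\<^sub>1 - \<beta>\<^sub>2 \<and> \<alpha>\<^sub>1 - \<beta>\<^sub>2 < \<beta>\<^sub>1 - \<alpha>\<^sub>2 \<and> \<beta>\<^sub>1 - \<alpha>\<^sub>2 \<le> \<beta>' \<and>
        (\<forall>n. a n \<in> bounded_holomorphic r) \<and>
        (\<forall>n. g n \<in> bounded_asymptotic (quasi_sector \<alpha>' \<beta>' \<infinity> \<mu>)) \<and>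
        (\<forall>N. \<exists>K. \<forall>\<eta>\<in>sector \<alpha>\<^sub>2 \<beta>\<^sub>2 \<eta>\<^sub>1. \<forall>x\<in>quasi_sector \<alpha>\<^sub>1 \<beta>\<^sub>1 r (\<mu> * cmod \<eta>).
           cmod (y x \<eta> - (\<Sum>n<N. (a n x + g n (x / \<eta>)) * \<eta> ^ n)) \<le> K * cmod \<eta> ^ N))"

(* u solves \<epsilon> u' = p x^(p-1) u + \<epsilon> P(x,u,\<epsilon>) on V; the graph has to stay in the domain
   D\<^sub>1 \<times> D\<^sub>2 \<times> \<Sigma> of P. *)
definition solves_on ::
    "nat \<Rightarrow> (complex \<Rightarrow> complex \<Rightarrow> complex \<Rightarrow> complex) \<Rightarrow> complex set \<Rightarrow> complex set \<Rightarrow> complex set \<Rightarrow>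
     complex \<Rightarrow> (complex \<Rightarrow> complex) \<Rightarrow> complex set \<Rightarrow> bool" where
  "solves_on p P D\<^sub>1 D\<^sub>2 \<Sigma> \<epsilon> u V \<longleftrightarrow>
     \<epsilon> \<in> \<Sigma> \<and> V \<subseteq> D\<^sub>1 \<and> u ` V \<subseteq> D\<^sub>2 \<and> u holomorphic_on V \<and>
     (\<forall>x\<in>V. \<epsilon> * deriv u x = of_nat p * x ^ (p - 1) * u x + \<epsilon> * P x (u x) \<epsilon>)"

end

theory Submission
  imports Defs "HOL-Real_Asymp.Real_Asymp"
begin

text \<open>
Put \<epsilon> = \<eta>^p and u = x^p, so that exp (u/\<epsilon>) solves the homogeneous equation. The opening of the
quasi-sector is such that each of its points can be joined to a fixed base point x0 > 0 by a path
along which Re (u/\<epsilon>) grows at a rate proportional to the arc length in the u-plane: a straight segment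
in the u-plane if |arg u| is at most 3 pi/4, and otherwise the radius down to the disc
|x| < \<mu> |\<eta>|, in which exp (u/\<epsilon>) is bounded above and below, followed by the positive real axis.
Hence variation of constants from x0 inverts the linear equation \<epsilon> z' = p x^(p-1) z + \<epsilon> f with norm
O(\<eta>) (front_bound, radial_bound, extend_bound, solution_bound), and Picard iteration
yields a solution y = O(\<eta>) of the nonlinear equation (picard_solution).

The expansion follows from the equation by induction on the order. Finite sums of terms
(a(x) + g(x/\<eta>)) \<eta>^n with a remainder of order \<eta>^N are closed under products (dac_mult) and hence, since
y/\<eta> is bounded, under insertion into the right hand side (dac_compose). The linear equation
preserves them as well (solution_dac): g(x/\<eta>) is the right hand side belonging to
\<eta> h(x/\<eta>), where h solves the inner equation h' = p X^(p-1) h + g and has an expansion in powers of 1/X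
(inner_solution); monomials x^j with j < p - 1 are treated in the same way; and x^(p-1) b(x) belongs to
- \<epsilon> b(x)/p up to an error of order \<epsilon>. What remains of the right hand side carries a factor \<eta>.
So an expansion of y/\<eta> to order N gives one of the right hand side, and therefore of y/\<eta>, to order N + 1.
The leading coefficients are determined by the function (dac_head_zero), which makes the coefficients for
different orders agree (dac_sequence).

The solution that vanishes at x0 has an exponential boundary layer there. In each step of the induction
the cone of admissible values u is therefore made slightly smaller (solution_small). The Picard iteration
cannot afford such a loss; there the vertex of the cone lies at distance |\<epsilon>| beyond x0^p, so that x0 is an
interior point of the domain and the exponential still changes by a bounded factor only.
\<close>

section \<open>Separately holomorphic functions of two variables\<close>

text \<open>Including joint continuity makes the class closed under uniform limits and under integration with respect to a parameter by one-variable theorems.\<close>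

definition sep_holomorphic :: "(complex \<times> complex) set \<Rightarrow> (complex \<Rightarrow> complex \<Rightarrow> complex) \<Rightarrow> bool" where
  "sep_holomorphic W f \<longleftrightarrow> continuous_on W (\<lambda>(x, \<eta>). f x \<eta>) \<and>
     (\<forall>\<eta>. (\<lambda>x. f x \<eta>) holomorphic_on {x. (x, \<eta>) \<in> W}) \<and>
     (\<forall>x. (\<lambda>\<eta>. f x \<eta>) holomorphic_on {\<eta>. (x, \<eta>) \<in> W})"

lemma sep_holomorphicD:
  assumes "sep_holomorphic W f"
  shows "continuous_on W (\<lambda>(x, \<eta>). f x \<eta>)" "(\<lambda>x. f x \<eta>) holomorphic_on {x. (x, \<eta>) \<in> W}"
    "(\<lambda>\<eta>. f x \<eta>) holomorphic_on {\<eta>. (x, \<eta>) \<in> W}"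
  using assms unfolding sep_holomorphic_def by blast+

lemma open_slice1: "open W \<Longrightarrow> open {x. (x, \<eta>) \<in> W}"
  using open_vimage[of W "\<lambda>x. (x, \<eta>)"] by (simp add: vimage_def continuous_on_Pair)

lemma open_slice2: "open W \<Longrightarrow> open {\<eta>. (x, \<eta>) \<in> W}"
  using open_vimage[of W "\<lambda>\<eta>. (x, \<eta>)"] by (simp add: vimage_def continuous_on_Pair)

lemma cball_box:
  assumes "open W" "(x0 :: complex, y0 :: complex) \<in> W"
  obtains \<rho> where "\<rho> > 0" "cball x0 \<rho> \<times> cball y0 \<rho> \<subseteq> W"
proof -
  obtain A B where AB: "open A" "open B" "x0 \<in> A" "y0 \<in> B" "A \<times> B \<subseteq> W"
    using open_prod_elim[OF assms] by (metis mem_Sigma_iff)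
  obtain a where a: "a > 0" "cball x0 a \<subseteq> A" using AB open_contains_cball by blast
  obtain b where b: "b > 0" "cball y0 b \<subseteq> B" using AB open_contains_cball by blast
  have "cball x0 (min a b) \<subseteq> A" "cball y0 (min a b) \<subseteq> B" using a(2) b(2) by auto
  then have "cball x0 (min a b) \<times> cball y0 (min a b) \<subseteq> W" using AB(5) by blast
  moreover have "min a b > 0" using a b by simp
  ultimately show ?thesis using that by blast
qed

text \<open>Cauchy's estimate, applied to the difference of two slices.\<close>

lemma continuous_on_deriv_slice:
  assumes W: "open W" and f: "sep_holomorphic W f"
  shows "continuous_on W (\<lambda>(x, \<eta>). deriv (f x) \<eta>)"
proof (rule continuous_at_imp_continuous_on, clarify)
  fix x0 y0 assume in_W: "(x0, y0) \<in> W"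
  obtain \<rho>' where \<rho>': "\<rho>' > 0" "cball x0 \<rho>' \<times> cball y0 \<rho>' \<subseteq> W" using cball_box[OF W in_W] by blast
  define \<rho> where "\<rho> = \<rho>' / 2"
  have \<rho>: "\<rho> > 0" "\<rho>' = 2 * \<rho>" using \<rho>' by (simp_all add: \<rho>_def)
  define K where "K = cball x0 \<rho>' \<times> cball y0 \<rho>'"
  have KW: "K \<subseteq> W" using \<rho>' by (simp add: K_def)
  have uc: "uniformly_continuous_on K (\<lambda>(x, \<eta>). f x \<eta>)"
  proof (rule compact_uniformly_continuous)
    show "continuous_on K (\<lambda>(x, \<eta>). f x \<eta>)"
      by (rule continuous_on_subset[OF sep_holomorphicD(1)[OF f] KW])
    show "compact K" unfolding K_def by (intro compact_Times compact_cball)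
  qed
  have sl: "cball y0 \<rho>' \<subseteq> {\<eta>. (x, \<eta>) \<in> W}" if "x \<in> cball x0 \<rho>'" for x
    using that \<rho>'(2) by blast
  show "isCont (\<lambda>(x, \<eta>). deriv (f x) \<eta>) (x0, y0)"
    unfolding continuous_at_eps_delta
  proof (intro allI impI)
    fix e :: real assume e: "e > 0"
    define e1 where "e1 = e * \<rho> / 4"
    have e1: "e1 > 0" using e \<rho> by (simp add: e1_def)
    obtain d1 where d1: "d1 > 0" "\<And>u u'. u \<in> K \<Longrightarrow> u' \<in> K \<Longrightarrow> dist u' u < d1 \<Longrightarrow>
        dist ((\<lambda>(x, \<eta>). f x \<eta>) u') ((\<lambda>(x, \<eta>). f x \<eta>) u) < e1"
      using uc e1 unfolding uniformly_continuous_on_def by metis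
    have "deriv (f x0) holomorphic_on {\<eta>. (x0, \<eta>) \<in> W}"
      by (rule holomorphic_deriv[OF sep_holomorphicD(3)[OF f] open_slice2[OF W]])
    then have "isCont (deriv (f x0)) y0"
      using holomorphic_on_imp_continuous_on open_slice2[OF W] in_W continuous_on_eq_continuous_at by blast
    then obtain d2 where d2: "d2 > 0" "\<And>y. dist y y0 < d2 \<Longrightarrow> dist (deriv (f x0) y) (deriv (f x0) y0) < e / 2"
      unfolding continuous_at_eps_delta using e by (metis half_gt_zero)
    define d where "d = min (min d1 d2) \<rho>"
    have "dist (deriv (f x) y) (deriv (f x0) y0) < e" if xy: "dist (x, y) (x0, y0) < d" for x y
    proof -
      have dx: "dist x x0 < d" and dy: "dist y y0 < d"
        using xy dist_fst_le[of "(x, y)" "(x0, y0)"] dist_snd_le[of "(x, y)" "(x0, y0)"] by auto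
      have x: "x \<in> cball x0 \<rho>'" "x0 \<in> cball x0 \<rho>'" using dx \<rho> by (auto simp: d_def dist_commute)
      have y: "cball y \<rho> \<subseteq> cball y0 \<rho>'"
      proof
        fix w assume "w \<in> cball y \<rho>"
        then have "dist y0 w \<le> dist y0 y + \<rho>" using dist_triangle[of y0 w y] by (simp add: dist_commute)
        then show "w \<in> cball y0 \<rho>'" using dy \<rho> by (simp add: d_def dist_commute)
      qed
      have hol: "f t holomorphic_on cball y \<rho>" if "t \<in> cball x0 \<rho>'" for t
        using holomorphic_on_subset[OF sep_holomorphicD(3)[OF f]] sl[OF that] y by blast
      have "norm ((deriv ^^ 1) (\<lambda>w. f x w - f x0 w) y) \<le> fact 1 * e1 / \<rho> ^ 1"
      proof (rule Cauchy_inequality)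
        show "(\<lambda>w. f x w - f x0 w) holomorphic_on ball y \<rho>"
          using hol[OF x(1)] hol[OF x(2)] by (intro holomorphic_on_diff) (auto intro: holomorphic_on_subset)
        show "continuous_on (cball y \<rho>) (\<lambda>w. f x w - f x0 w)"
          using hol[OF x(1)] hol[OF x(2)] by (intro continuous_on_diff holomorphic_on_imp_continuous_on)
        fix w assume "norm (y - w) = \<rho>"
        then have w: "w \<in> cball y0 \<rho>'" using y by (auto simp: dist_norm)
        have "dist ((\<lambda>(x, \<eta>). f x \<eta>) (x, w)) ((\<lambda>(x, \<eta>). f x \<eta>) (x0, w)) < e1"
        proof (rule d1(2))
          show "(x0, w) \<in> K" "(x, w) \<in> K" unfolding K_def using x w by blast+
          show "dist (x, w) (x0, w) < d1" using dx by (simp add: dist_Pair_Pair d_def)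
        qed
        then show "norm (f x w - f x0 w) \<le> e1" by (simp add: dist_norm)
      qed (rule \<rho>(1))
      moreover have "deriv (\<lambda>w. f x w - f x0 w) y = deriv (f x) y - deriv (f x0) y"
      proof (rule deriv_diff)
        have "y \<in> ball y \<rho>" using \<rho> by simp
        then show "f x field_differentiable at y" "f x0 field_differentiable at y"
          using hol[OF x(1)] hol[OF x(2)] holomorphic_on_imp_differentiable_at[OF holomorphic_on_subset[OF _ ball_subset_cball] open_ball]
          by blast+
      qed
      ultimately have "norm (deriv (f x) y - deriv (f x0) y) \<le> e1 / \<rho>" by simp
      also have "e1 / \<rho> = e / 4" using \<rho> by (simp add: e1_def)
      finally have 1: "dist (deriv (f x) y) (deriv (f x0) y) \<le> e / 4" by (simp add: dist_norm)
      have 2: "dist (deriv (f x0) y) (deriv (f x0) y0) < e / 2" using dy by (intro d2) (simp add: d_def)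
      have "dist (deriv (f x) y) (deriv (f x0) y0) \<le> dist (deriv (f x) y) (deriv (f x0) y) + dist (deriv (f x0) y) (deriv (f x0) y0)"
        by (rule dist_triangle)
      also have "\<dots> < e" using 1 2 e by linarith
      finally show ?thesis .
    qed
    moreover have "d > 0" using d1 d2 \<rho> by (simp add: d_def)
    ultimately show "\<exists>d>0. \<forall>u'. dist u' (x0, y0) < d \<longrightarrow>
        dist ((\<lambda>(x, \<eta>). deriv (f x) \<eta>) u') ((\<lambda>(x, \<eta>). deriv (f x) \<eta>) (x0, y0)) < e"
      by (intro exI[of _ d]) auto
  qed
qed

text \<open>Osgood's lemma: joint continuity of one of the partial derivatives suffices for total differentiability.\<close>

lemma sep_holomorphic_imp_holomorphic2:
  assumes W: "open W" and f: "sep_holomorphic W f"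
  shows "holomorphic2_on (\<lambda>(x, \<eta>). f x \<eta>) W"
  unfolding holomorphic2_on_def
proof clarify
  fix x0 y0 assume in_W: "(x0, y0) \<in> W"
  obtain \<rho> where \<rho>: "\<rho> > 0" "cball x0 \<rho> \<times> cball y0 \<rho> \<subseteq> W" using cball_box[OF W in_W] by blast
  define X where "X = ball x0 \<rho>"
  define Y where "Y = ball y0 \<rho>"
  have XY: "X \<times> Y \<subseteq> W" using \<rho>(2) unfolding X_def Y_def by fastforce
  have "((\<lambda>(x, y). f x y) has_derivative (\<lambda>(tx, ty). deriv (\<lambda>x. f x y0) x0 * tx + blinfun_mult_right (deriv (f x0) y0) ty))
      (at (x0, y0) within X \<times> Y)"
  proof (rule has_derivative_partialsI)
    show "((\<lambda>x. f x y0) has_derivative (*) (deriv (\<lambda>x. f x y0) x0)) (at x0 within X)"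
      unfolding has_field_derivative_def[symmetric]
      by (rule has_field_derivative_at_within, rule holomorphic_derivI[OF sep_holomorphicD(2)[OF f] open_slice1[OF W]])
         (use in_W in simp)
    show "(f x has_derivative blinfun_apply (blinfun_mult_right (deriv (f x) y))) (at y within Y)" if "x \<in> X" "y \<in> Y" for x y
      unfolding blinfun_mult_right.rep_eq has_field_derivative_def[symmetric]
      by (rule has_field_derivative_at_within, rule holomorphic_derivI[OF sep_holomorphicD(3)[OF f] open_slice2[OF W]])
         (use that XY in blast)
    have "continuous_on W (\<lambda>u. blinfun_mult_right ((\<lambda>(x, \<eta>). deriv (f x) \<eta>) u))"
      by (rule bounded_linear.continuous_on[OF bounded_linear_blinfun_mult_right continuous_on_deriv_slice[OF W f]])
    then have "continuous_on W (\<lambda>(x, y). blinfun_mult_right (deriv (f x) y))"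
      by (simp add: split_beta')
    then have "isCont (\<lambda>(x, y). blinfun_mult_right (deriv (f x) y)) (x0, y0)"
      using in_W W continuous_on_eq_continuous_at by blast
    then show "continuous (at (x0, y0) within X \<times> Y) (\<lambda>(x, y). blinfun_mult_right (deriv (f x) y))"
      by (rule continuous_at_imp_continuous_within)
    show "y0 \<in> Y" "convex Y" using \<rho> by (auto simp: Y_def)
  qed
  moreover have "at (x0, y0) within X \<times> Y = at (x0, y0)"
    by (rule at_within_open) (use \<rho> in \<open>auto simp: X_def Y_def intro: open_Times\<close>)
  ultimately have "((\<lambda>(x, y). f x y) has_derivative (\<lambda>(tx, ty). deriv (\<lambda>x. f x y0) x0 * tx + deriv (f x0) y0 * ty)) (at (x0, y0))"
    by simp
  then show "\<exists>a b. ((\<lambda>(x, \<eta>). f x \<eta>) has_derivative (\<lambda>(u, v). a * u + b * v)) (at (x0, y0))" by blast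
qed

lemma sep_holomorphic_uniform_limit:
  assumes W: "open W" and f: "\<And>n. sep_holomorphic W (f n)"
    and lim: "uniform_limit W (\<lambda>n (x, \<eta>). f n x \<eta>) (\<lambda>(x, \<eta>). g x \<eta>) sequentially"
  shows "sep_holomorphic W g"
  unfolding sep_holomorphic_def
proof (intro conjI allI)
  show "continuous_on W (\<lambda>(x, \<eta>). g x \<eta>)"
    by (rule uniform_limit_theorem[OF _ lim]) (use sep_holomorphicD(1)[OF f] in auto)
  fix \<eta> :: complex
  show "(\<lambda>x. g x \<eta>) holomorphic_on {x. (x, \<eta>) \<in> W}"
  proof (rule holomorphic_uniform_sequence[OF open_slice1[OF W] sep_holomorphicD(2)[OF f]])
    fix x assume "x \<in> {x. (x, \<eta>) \<in> W}"
    then obtain d where d: "d > 0" "cball x d \<subseteq> {x. (x, \<eta>) \<in> W}"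
      using open_slice1[OF W] open_contains_cball by blast
    have "uniform_limit (cball x d) (\<lambda>n x. (\<lambda>(x, \<eta>). f n x \<eta>) (x, \<eta>)) (\<lambda>x. (\<lambda>(x, \<eta>). g x \<eta>) (x, \<eta>)) sequentially"
      by (rule uniform_limit_compose'[OF lim]) (use d in auto)
    then show "\<exists>d>0. cball x d \<subseteq> {x. (x, \<eta>) \<in> W} \<and>
        uniform_limit (cball x d) (\<lambda>n x. f n x \<eta>) (\<lambda>x. g x \<eta>) sequentially"
      using d by auto
  qed
next
  fix x :: complex
  show "(\<lambda>\<eta>. g x \<eta>) holomorphic_on {\<eta>. (x, \<eta>) \<in> W}"
  proof (rule holomorphic_uniform_sequence[OF open_slice2[OF W] sep_holomorphicD(3)[OF f]])
    fix \<eta> assume "\<eta> \<in> {\<eta>. (x, \<eta>) \<in> W}"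
    then obtain d where d: "d > 0" "cball \<eta> d \<subseteq> {\<eta>. (x, \<eta>) \<in> W}"
      using open_slice2[OF W] open_contains_cball by blast
    have "uniform_limit (cball \<eta> d) (\<lambda>n \<eta>. (\<lambda>(x, \<eta>). f n x \<eta>) (x, \<eta>)) (\<lambda>\<eta>. (\<lambda>(x, \<eta>). g x \<eta>) (x, \<eta>)) sequentially"
      by (rule uniform_limit_compose'[OF lim]) (use d in auto)
    then show "\<exists>d>0. cball \<eta> d \<subseteq> {\<eta>. (x, \<eta>) \<in> W} \<and>
        uniform_limit (cball \<eta> d) (\<lambda>n \<eta>. f n x \<eta>) (\<lambda>\<eta>. g x \<eta>) sequentially"
      using d by auto
  qed
qed

lemma sep_holomorphic_mult:
  assumes "sep_holomorphic W f" "sep_holomorphic W g"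
  shows "sep_holomorphic W (\<lambda>x \<eta>. f x \<eta> * g x \<eta>)"
  using assms unfolding sep_holomorphic_def split_beta'
  by (auto intro!: continuous_on_mult holomorphic_on_mult)

lemma sep_holomorphic_diff:
  assumes "sep_holomorphic W f" "sep_holomorphic W g"
  shows "sep_holomorphic W (\<lambda>x \<eta>. f x \<eta> - g x \<eta>)"
  using assms unfolding sep_holomorphic_def split_beta'
  by (auto intro!: continuous_on_diff holomorphic_on_diff)

lemma sep_holomorphic_exp_power:
  assumes "\<And>x \<eta>. (x, \<eta>) \<in> W \<Longrightarrow> \<eta> \<noteq> 0"
  shows "sep_holomorphic W (\<lambda>x \<eta>. exp (c * (x ^ p / \<eta> ^ p)))"
  unfolding sep_holomorphic_def split_beta'
  using assms by (auto intro!: continuous_intros holomorphic_intros)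

lemma sep_holomorphic_at:
  assumes f: "sep_holomorphic W f" and x0: "\<And>x \<eta>. (x, \<eta>) \<in> W \<Longrightarrow> (x0, \<eta>) \<in> W"
  shows "sep_holomorphic W (\<lambda>x \<eta>. f x0 \<eta>)"
  unfolding sep_holomorphic_def
proof (intro conjI allI)
  have "continuous_on W (\<lambda>u. (\<lambda>(x, \<eta>). f x \<eta>) (x0, snd u))"
    by (rule continuous_on_compose2[OF sep_holomorphicD(1)[OF f]])
       (use x0 in \<open>auto intro!: continuous_intros\<close>)
  then show "continuous_on W (\<lambda>(x, \<eta>). f x0 \<eta>)" by (simp add: split_beta')
  show "(\<lambda>\<eta>. f x0 \<eta>) holomorphic_on {\<eta>. (x, \<eta>) \<in> W}" for x
    by (rule holomorphic_on_subset[OF sep_holomorphicD(3)[OF f]]) (use x0 in auto)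
qed simp

text \<open>The contour integral along the segment from 0 to x, over a fixed interval so that it can be differentiated with respect to the parameter.\<close>

definition primitive0 :: "(complex \<Rightarrow> complex \<Rightarrow> complex) \<Rightarrow> complex \<Rightarrow> complex \<Rightarrow> complex" where
  "primitive0 k x \<eta> = x * integral (cbox 0 1) (\<lambda>s::real. k (of_real s * x) \<eta>)"

lemma primitive0_deriv:
  assumes W: "open W" and star: "\<And>x \<eta> s. (x, \<eta>) \<in> W \<Longrightarrow> 0 \<le> s \<Longrightarrow> s \<le> 1 \<Longrightarrow> (of_real s * x, \<eta>) \<in> W"
    and k: "sep_holomorphic W k" and x: "(x, \<eta>) \<in> W"
  shows "((\<lambda>x. primitive0 k x \<eta>) has_field_derivative k x \<eta>) (at x)"
proof -
  define U where "U = {x. (x, \<eta>) \<in> W}"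
  have U: "open U" unfolding U_def by (rule open_slice1[OF W])
  have hol: "(\<lambda>x. k x \<eta>) holomorphic_on U" unfolding U_def by (rule sep_holomorphicD(2)[OF k])
  have seg: "closed_segment 0 y \<subseteq> U" if "y \<in> U" for y
  proof
    fix t assume "t \<in> closed_segment 0 y"
    then obtain s where "t = of_real s * y" "0 \<le> s" "s \<le> 1"
      by (auto simp: closed_segment_def scaleR_conv_of_real)
    then show "t \<in> U" using star[of y \<eta> s] that by (simp add: U_def)
  qed
  have "0 \<in> U" using star[OF x, of 0] by (simp add: U_def)
  then have star': "starlike U" unfolding starlike_def using seg by blast
  obtain G where G: "\<And>y. y \<in> U \<Longrightarrow> (G has_field_derivative k y \<eta>) (at y)"
    using holomorphic_starlike_primitive[OF holomorphic_on_imp_continuous_on[OF hol] star' U finite.emptyI]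
      holomorphic_on_imp_differentiable_at[OF hol U] by auto
  have eq: "primitive0 k y \<eta> = G y - G 0" if "y \<in> U" for y
  proof -
    have "((\<lambda>x. k x \<eta>) has_contour_integral (G (pathfinish (linepath 0 y)) - G (pathstart (linepath 0 y)))) (linepath 0 y)"
    proof (rule contour_integral_primitive[of U])
      show "(G has_field_derivative k t \<eta>) (at t within U)" if "t \<in> U" for t
        by (rule has_field_derivative_at_within[OF G[OF that]])
      show "path_image (linepath 0 y) \<subseteq> U" unfolding path_image_linepath by (rule seg[OF that])
    qed (rule valid_path_linepath)
    then have "((\<lambda>s. k (linepath 0 y s) \<eta> * (y - 0)) has_integral (G y - G 0)) {0..1}"
      by (simp add: has_contour_integral_linepath)
    then have "((\<lambda>s. k (of_real s * y) \<eta> * y) has_integral (G y - G 0)) {0..1}"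
      by (simp add: linepath_def scaleR_conv_of_real)
    then have "integral {0..1} (\<lambda>s. k (of_real s * y) \<eta> * y) = G y - G 0" by (rule integral_unique)
    then show ?thesis by (simp add: primitive0_def mult.commute)
  qed
  have "((\<lambda>y. G y - G 0) has_field_derivative k x \<eta>) (at x)"
    using G[of x] x by (auto intro!: derivative_eq_intros simp: U_def)
  then show ?thesis
    by (rule has_field_derivative_transform_within_open[OF _ U]) (use x eq in \<open>auto simp: U_def\<close>)
qed

lemma sep_holomorphic_primitive0:
  assumes W: "open W" and star: "\<And>x \<eta> s. (x, \<eta>) \<in> W \<Longrightarrow> 0 \<le> s \<Longrightarrow> s \<le> 1 \<Longrightarrow> (of_real s * x, \<eta>) \<in> W"
    and k: "sep_holomorphic W k"
  shows "sep_holomorphic W (primitive0 k)"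
  unfolding sep_holomorphic_def
proof (intro conjI allI)
  have "continuous_on (W \<times> cbox 0 1) (\<lambda>v. (\<lambda>(x, \<eta>). k x \<eta>) (of_real (snd v) * fst (fst v), snd (fst v)))"
    by (rule continuous_on_compose2[OF sep_holomorphicD(1)[OF k]])
       (use star in \<open>auto intro!: continuous_intros\<close>)
  then have "continuous_on (W \<times> cbox 0 1) (\<lambda>(u, s). k (of_real s * fst u) (snd u))"
    by (simp add: split_beta')
  then have "continuous_on W (\<lambda>u. integral (cbox 0 1) (\<lambda>s. k (of_real s * fst u) (snd u)))"
    by (rule integral_continuous_on_param)
  then show "continuous_on W (\<lambda>(x, \<eta>). primitive0 k x \<eta>)"
    unfolding primitive0_def split_beta' by (intro continuous_intros)
next
  fix \<eta> :: complex
  show "(\<lambda>x. primitive0 k x \<eta>) holomorphic_on {x. (x, \<eta>) \<in> W}"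
    unfolding holomorphic_on_open[OF open_slice1[OF W]]
    using primitive0_deriv[OF W star k] by blast
next
  fix x :: complex
  define U where "U = {\<eta>. (x, \<eta>) \<in> W}"
  have U: "open U" unfolding U_def by (rule open_slice2[OF W])
  have "(\<lambda>\<eta>. integral (cbox 0 1) (\<lambda>s::real. k (of_real s * x) \<eta>)) holomorphic_on U"
  proof (subst analytic_on_open[OF U, symmetric], unfold analytic_on_def, intro ballI)
    fix \<eta>0 assume "\<eta>0 \<in> U"
    then obtain d where d: "d > 0" "ball \<eta>0 d \<subseteq> U" using U open_contains_ball by blast
    have inW: "(of_real s * x, \<eta>) \<in> W" if "\<eta> \<in> ball \<eta>0 d" "s \<in> cbox 0 1" for s \<eta>
      using d(2) that star by (auto simp: U_def)
    have "(\<lambda>\<eta>. integral (cbox 0 1) (\<lambda>s::real. k (of_real s * x) \<eta>)) holomorphic_on ball \<eta>0 d"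
    proof (rule leibniz_rule_holomorphic[where fx = "\<lambda>\<eta> s. deriv (k (of_real s * x)) \<eta>"])
      fix \<eta> and s :: real assume *: "\<eta> \<in> ball \<eta>0 d" "s \<in> cbox 0 1"
      show "(k (of_real s * x) has_field_derivative deriv (k (of_real s * x)) \<eta>) (at \<eta> within ball \<eta>0 d)"
        by (rule has_field_derivative_at_within, rule holomorphic_derivI[OF sep_holomorphicD(3)[OF k] open_slice2[OF W]])
           (use inW[OF *] in simp)
    next
      fix \<eta> assume *: "\<eta> \<in> ball \<eta>0 d"
      have "continuous_on (cbox 0 1) (\<lambda>s. (\<lambda>(x, \<eta>). k x \<eta>) (of_real s * x, \<eta>))"
        by (rule continuous_on_compose2[OF sep_holomorphicD(1)[OF k]])
           (use inW[OF *] in \<open>auto intro!: continuous_intros\<close>)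
      then show "(\<lambda>s. k (of_real s * x) \<eta>) integrable_on cbox 0 1"
        by (intro integrable_continuous) simp
    next
      have "continuous_on (ball \<eta>0 d \<times> cbox 0 1) (\<lambda>v. (\<lambda>(x, \<eta>). deriv (k x) \<eta>) (of_real (snd v) * x, fst v))"
        by (rule continuous_on_compose2[OF continuous_on_deriv_slice[OF W k]])
           (use inW in \<open>auto intro!: continuous_intros\<close>)
      then show "continuous_on (ball \<eta>0 d \<times> cbox 0 1) (\<lambda>(\<eta>, s). deriv (k (of_real s * x)) \<eta>)"
        by (simp add: split_beta')
    qed simp
    then show "\<exists>\<epsilon>>0. (\<lambda>\<eta>. integral (cbox 0 1) (\<lambda>s::real. k (of_real s * x) \<eta>)) holomorphic_on ball \<eta>0 \<epsilon>"
      using d(1) by blast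
  qed
  then show "primitive0 k x holomorphic_on {\<eta>. (x, \<eta>) \<in> W}"
    unfolding primitive0_def U_def by (intro holomorphic_on_mult holomorphic_on_const)
qed

lemma holomorphic3_chain:
  assumes P: "holomorphic3_on (\<lambda>(x, y, \<epsilon>). P x y \<epsilon>) D" and D: "(a t, b t, c t) \<in> D"
    and a: "(a has_field_derivative a') (at t)" and b: "(b has_field_derivative b') (at t)"
    and c: "(c has_field_derivative c') (at t)"
  shows "\<exists>f'. ((\<lambda>t. P (a t) (b t) (c t)) has_field_derivative f') (at t)"
proof -
  obtain d1 d2 d3 where d: "((\<lambda>(x, y, \<epsilon>). P x y \<epsilon>) has_derivative (\<lambda>(u, v, w). d1 * u + d2 * v + d3 * w)) (at (a t, b t, c t))"
    using P D unfolding holomorphic3_on_def by blast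
  have "((\<lambda>t. (a t, b t, c t)) has_derivative (\<lambda>h. (a' * h, b' * h, c' * h))) (at t)"
    using a b c unfolding has_field_derivative_def by (intro has_derivative_Pair)
  from has_derivative_compose[OF this d]
  have "((\<lambda>t. P (a t) (b t) (c t)) has_derivative (\<lambda>h. d1 * (a' * h) + d2 * (b' * h) + d3 * (c' * h))) (at t)"
    by simp
  then have "((\<lambda>t. P (a t) (b t) (c t)) has_field_derivative d1 * a' + d2 * b' + d3 * c') (at t)"
    unfolding has_field_derivative_def by (rule has_derivative_eq_rhs) (auto simp: algebra_simps)
  then show ?thesis by blast
qed

lemma sep_holomorphic_compose3:
  assumes P: "holomorphic3_on (\<lambda>(x, y, \<epsilon>). P x y \<epsilon>) D" and y: "sep_holomorphic W y" and W: "open W"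
    and D: "\<And>x \<eta>. (x, \<eta>) \<in> W \<Longrightarrow> (x, y x \<eta>, \<eta> ^ p) \<in> D"
  shows "sep_holomorphic W (\<lambda>x \<eta>. P x (y x \<eta>) (\<eta> ^ p))"
  unfolding sep_holomorphic_def
proof (intro conjI allI)
  have "continuous_on D (\<lambda>(x, y, \<epsilon>). P x y \<epsilon>)"
    by (rule continuous_at_imp_continuous_on)
       (use P in \<open>unfold holomorphic3_on_def, blast intro: has_derivative_continuous\<close>)
  then have "continuous_on W (\<lambda>u. (\<lambda>(x, y, \<epsilon>). P x y \<epsilon>) (fst u, (\<lambda>(x, \<eta>). y x \<eta>) u, snd u ^ p))"
    by (rule continuous_on_compose2)
       (use D in \<open>auto intro!: continuous_intros sep_holomorphicD(1)[OF y]\<close>)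
  then show "continuous_on W (\<lambda>(x, \<eta>). P x (y x \<eta>) (\<eta> ^ p))" by (simp add: split_beta')
  fix \<eta> :: complex
  show "(\<lambda>x. P x (y x \<eta>) (\<eta> ^ p)) holomorphic_on {x. (x, \<eta>) \<in> W}"
    unfolding holomorphic_on_open[OF open_slice1[OF W]]
  proof
    fix x assume x: "x \<in> {x. (x, \<eta>) \<in> W}"
    show "\<exists>f'. ((\<lambda>x. P x (y x \<eta>) (\<eta> ^ p)) has_field_derivative f') (at x)"
      by (rule holomorphic3_chain[OF P, where a = "\<lambda>x. x" and b = "\<lambda>x. y x \<eta>" and c = "\<lambda>x. \<eta> ^ p", OF _ DERIV_ident
            holomorphic_derivI[OF sep_holomorphicD(2)[OF y] open_slice1[OF W] x] DERIV_const])
         (use x D in simp)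
  qed
next
  fix x :: complex
  show "(\<lambda>\<eta>. P x (y x \<eta>) (\<eta> ^ p)) holomorphic_on {\<eta>. (x, \<eta>) \<in> W}"
    unfolding holomorphic_on_open[OF open_slice2[OF W]]
  proof
    fix \<eta> assume x: "\<eta> \<in> {\<eta>. (x, \<eta>) \<in> W}"
    show "\<exists>f'. ((\<lambda>\<eta>. P x (y x \<eta>) (\<eta> ^ p)) has_field_derivative f') (at \<eta>)"
      by (rule holomorphic3_chain[OF P, where a = "\<lambda>\<eta>. x" and b = "\<lambda>\<eta>. y x \<eta>" and c = "\<lambda>\<eta>. \<eta> ^ p", OF _ DERIV_const
            holomorphic_derivI[OF sep_holomorphicD(3)[OF y] open_slice2[OF W] x] DERIV_power[OF DERIV_ident]])
         (use x D in simp)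
  qed
qed

section \<open>The linear equation along paths of descent\<close>

text \<open>The principal branch; it inverts the p-th power on the sector |arg x| < pi/p.\<close>

definition croot :: "nat \<Rightarrow> complex \<Rightarrow> complex" where
  "croot p u = u powr (1 / of_nat p)"

lemma Re_of_real_mult: "Re (of_real s * w) = s * Re w"
  by simp

lemma croot_power: "p > 0 \<Longrightarrow> croot p u ^ p = u"
  by (cases "u = 0") (auto simp: croot_def powr_def exp_of_nat_mult [symmetric])

lemma croot_nonzero: "u \<noteq> 0 \<Longrightarrow> croot p u \<noteq> 0"
  by (simp add: croot_def)

lemma norm_croot_power: "p > 0 \<Longrightarrow> norm (croot p u) ^ p = norm u"
  by (metis croot_power norm_power)

lemma croot_of_real: "p > 0 \<Longrightarrow> u \<ge> 0 \<Longrightarrow> croot p (of_real u) = of_real (root p u)"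
proof (cases "u = 0")
  case False
  assume "p > 0" "u \<ge> 0"
  then show ?thesis
    using False powr_of_real[of u "1 / real p"] by (simp add: croot_def root_powr_inverse)
qed (simp add: croot_def)

lemma has_field_derivative_croot:
  assumes "p > 0" "u \<notin> \<real>\<^sub>\<le>\<^sub>0"
  shows "(croot p has_field_derivative 1 / (of_nat p * croot p u ^ (p - 1))) (at u)"
proof -
  have u: "u \<noteq> 0" using assms by auto
  have nz: "croot p u \<noteq> 0" using u by (rule croot_nonzero)
  have 1: "u powr (1 / of_nat p - 1) = croot p u / u"
    using u by (simp add: powr_diff croot_def)
  have 2: "u = croot p u * croot p u ^ (p - 1)"
    using croot_power[OF assms(1), of u] assms(1) by (metis power_eq_if not_gr_zero)
  have "croot p u / u = croot p u / (croot p u * croot p u ^ (p - 1))"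
    by (subst (2) 2) (rule refl)
  with 1 have "u powr (1 / of_nat p - 1) = 1 / croot p u ^ (p - 1)"
    using nz by simp
  moreover have "(croot p has_field_derivative (1 / of_nat p) * u powr (1 / of_nat p - 1)) (at u)"
    unfolding croot_def[abs_def] using has_field_derivative_powr[OF assms(2)] .
  ultimately show ?thesis by simp
qed

text \<open>The equation \<epsilon> z' = p x^(p-1) z + \<epsilon> f, divided by \<epsilon>.\<close>

definition lin_sol :: "nat \<Rightarrow> complex \<Rightarrow> (complex \<Rightarrow> complex) \<Rightarrow> (complex \<Rightarrow> complex) \<Rightarrow> complex set \<Rightarrow> bool" where
  "lin_sol p \<epsilon> f z D \<longleftrightarrow>
     (\<forall>x\<in>D. (z has_field_derivative of_nat p * x ^ (p - 1) / \<epsilon> * z x + f x) (at x))"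

lemma lin_solD: "lin_sol p \<epsilon> f z D \<Longrightarrow> x \<in> D \<Longrightarrow>
    (z has_field_derivative of_nat p * x ^ (p - 1) / \<epsilon> * z x + f x) (at x)"
  by (simp add: lin_sol_def)

lemma lin_sol_subset: "lin_sol p \<epsilon> f z D \<Longrightarrow> D' \<subseteq> D \<Longrightarrow> lin_sol p \<epsilon> f z D'"
  by (auto simp: lin_sol_def)

lemma lin_sol_add:
  "lin_sol p \<epsilon> f z D \<Longrightarrow> lin_sol p \<epsilon> g w D \<Longrightarrow> lin_sol p \<epsilon> (\<lambda>x. f x + g x) (\<lambda>x. z x + w x) D"
  unfolding lin_sol_def
  by (auto intro!: derivative_eq_intros simp: algebra_simps add_divide_distrib diff_divide_distrib)

lemma lin_sol_cmult:
  "lin_sol p \<epsilon> f z D \<Longrightarrow> lin_sol p \<epsilon> (\<lambda>x. k * f x) (\<lambda>x. k * z x) D"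
  unfolding lin_sol_def
  by (auto intro!: derivative_eq_intros simp: algebra_simps add_divide_distrib diff_divide_distrib)

lemma lin_sol_diff:
  "lin_sol p \<epsilon> f z D \<Longrightarrow> lin_sol p \<epsilon> g w D \<Longrightarrow> lin_sol p \<epsilon> (\<lambda>x. f x - g x) (\<lambda>x. z x - w x) D"
  unfolding lin_sol_def
  by (auto intro!: derivative_eq_intros simp: algebra_simps add_divide_distrib diff_divide_distrib)

lemma lin_sol_sum:
  "finite J \<Longrightarrow> (\<And>j. j \<in> J \<Longrightarrow> lin_sol p \<epsilon> (f j) (z j) D) \<Longrightarrow>
     lin_sol p \<epsilon> (\<lambda>x. \<Sum>j\<in>J. f j x) (\<lambda>x. \<Sum>j\<in>J. z j x) D"
proof (induction J rule: finite_induct)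
  case empty
  then show ?case by (simp add: lin_sol_def)
next
  case (insert j J)
  then show ?case using lin_sol_add[of p \<epsilon> "f j" "z j" D] by simp
qed

lemma lin_sol_exp_deriv:
  assumes "p > 0" "(z has_field_derivative of_nat p * x ^ (p - 1) / \<epsilon> * z x + f x) (at x)"
  shows "((\<lambda>x. exp (- (x ^ p / \<epsilon>)) * z x) has_field_derivative exp (- (x ^ p / \<epsilon>)) * f x) (at x)"
proof -
  have "((\<lambda>x. exp (- (x ^ p / \<epsilon>))) has_field_derivative
          exp (- (x ^ p / \<epsilon>)) * - (of_nat p * x ^ (p - 1) / \<epsilon>)) (at x)"
  proof -
    have "((\<lambda>x. - (x ^ p / \<epsilon>)) has_field_derivative - (of_nat p * x ^ (p - 1) / \<epsilon>)) (at x)"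
      using DERIV_minus[OF DERIV_cdivide[OF DERIV_power[OF DERIV_ident, of p x UNIV], of \<epsilon>]] by simp
    from DERIV_chain2[OF DERIV_exp this] show ?thesis .
  qed
  from DERIV_mult[OF this assms(2)] show ?thesis
    by (simp add: algebra_simps)
qed

text \<open>Along a path x(s) the derivative of exp (- x^p/\<epsilon>) z is exp (- x^p/\<epsilon>) f x', and x' is the derivative of u = x^p
divided by p x^(p-1). If u is affine in s and Re (u/\<epsilon>) increases at rate at least c, this is
dominated by the derivative of a multiple of - exp (- Re u/\<epsilon>), and the mean value inequality applies. The factor
y0 admits paths on which arg u leaves the principal range.\<close>

lemma path_bound:
  fixes q0 q1 y0 \<epsilon> :: complex
  assumes p: "p > 0" and \<epsilon>: "\<epsilon> \<noteq> 0" and c: "c > 0" and y0: "y0 \<noteq> 0"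
    and slit: "\<And>s. 0 \<le> s \<Longrightarrow> s \<le> 1 \<Longrightarrow> q0 + of_real s * (q1 - q0) \<notin> \<real>\<^sub>\<le>\<^sub>0"
    and D: "\<And>s. 0 \<le> s \<Longrightarrow> s \<le> 1 \<Longrightarrow> y0 * croot p (q0 + of_real s * (q1 - q0)) \<in> D"
    and z: "lin_sol p \<epsilon> f z D"
    and f: "\<And>s. 0 \<le> s \<Longrightarrow> s \<le> 1 \<Longrightarrow>
        norm (f (y0 * croot p (q0 + of_real s * (q1 - q0))))
          \<le> M * norm (y0 * croot p (q0 + of_real s * (q1 - q0))) ^ (p - 1)"
    and dir: "Re (y0 ^ p * (q1 - q0) / \<epsilon>) \<ge> c * norm (y0 ^ p * (q1 - q0)) / norm \<epsilon>"
  shows "norm (exp (- (y0 ^ p * q1 / \<epsilon>)) * z (y0 * croot p q1)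
             - exp (- (y0 ^ p * q0 / \<epsilon>)) * z (y0 * croot p q0))
         \<le> M * norm \<epsilon> / (of_nat p * c) * exp (- Re (y0 ^ p * q0 / \<epsilon>))"
proof -
  define Q where "Q = (\<lambda>s::real. q0 + of_real s * (q1 - q0))"
  define X where "X = (\<lambda>s. y0 * croot p (Q s))"
  define K where "K = M * norm \<epsilon> / (of_nat p * c)"
  define \<psi> where "\<psi> = (\<lambda>s. exp (- (X s ^ p / \<epsilon>)) * z (X s))"
  define \<phi> where "\<phi> = (\<lambda>s. - K * exp (- Re (y0 ^ p * Q s / \<epsilon>)))"
  define \<psi>' where "\<psi>' = (\<lambda>s. (q1 - q0) * (y0 / (of_nat p * croot p (Q s) ^ (p - 1))
        * (exp (- (X s ^ p / \<epsilon>)) * f (X s))))"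
  define \<phi>' where "\<phi>' = (\<lambda>s. K * Re (y0 ^ p * (q1 - q0) / \<epsilon>) * exp (- Re (y0 ^ p * Q s / \<epsilon>)))"
  have Xp: "X s ^ p = y0 ^ p * Q s" for s
    using p by (simp add: X_def power_mult_distrib croot_power)
  have M: "M \<ge> 0"
  proof -
    have "0 < norm (X 0) ^ (p - 1)"
    proof -
      have "X 0 \<noteq> 0" using slit[of 0] y0 croot_nonzero[of q0 p] by (cases "q0 = 0") (auto simp: X_def Q_def)
      then show ?thesis by simp
    qed
    moreover have "0 \<le> M * norm (X 0) ^ (p - 1)"
      using f[of 0] by (auto simp: X_def Q_def intro: order_trans[OF norm_ge_zero])
    ultimately show ?thesis by (simp add: zero_le_mult_iff)
  qed
  have K: "K \<ge> 0" using M c p by (auto simp: K_def)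
  have d\<psi>: "(\<psi> has_vector_derivative \<psi>' s) (at s)" if s: "0 \<le> s" "s \<le> 1" for s
  proof -
    have "(X has_vector_derivative (q1 - q0) * (y0 / (of_nat p * croot p (Q s) ^ (p - 1)))) (at s)"
    proof -
      have 1: "((\<lambda>u. y0 * croot p u) has_field_derivative y0 / (of_nat p * croot p (Q s) ^ (p - 1))) (at (Q s))"
        using has_field_derivative_croot[OF p slit[OF s]] by (auto intro!: derivative_eq_intros simp: Q_def)
      have 2: "(Q has_vector_derivative (q1 - q0)) (at s)"
        unfolding Q_def by (auto intro!: derivative_eq_intros simp: has_vector_derivative_def scaleR_conv_of_real)
      show ?thesis
        using field_vector_diff_chain_at[OF 2 1] by (simp add: X_def[abs_def] o_def)
    qed
    moreover have "((\<lambda>x. exp (- (x ^ p / \<epsilon>)) * z x) has_field_derivative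
                       exp (- (X s ^ p / \<epsilon>)) * f (X s)) (at (X s))"
      by (rule lin_sol_exp_deriv[OF p lin_solD[OF z]]) (use D[OF s] in \<open>simp add: X_def Q_def\<close>)
    ultimately show ?thesis
      using field_vector_diff_chain_at[of X "(q1 - q0) * (y0 / (of_nat p * croot p (Q s) ^ (p - 1)))" s
          "\<lambda>x. exp (- (x ^ p / \<epsilon>)) * z x" "exp (- (X s ^ p / \<epsilon>)) * f (X s)"]
      by (simp add: \<psi>_def[abs_def] \<psi>'_def o_def mult.assoc)
  qed
  have d\<phi>: "(\<phi> has_vector_derivative \<phi>' s) (at s)" for s
  proof -
    have eq: "Re (y0 ^ p * Q s / \<epsilon>) = Re (y0 ^ p * q0 / \<epsilon>) + s * Re (y0 ^ p * (q1 - q0) / \<epsilon>)" for s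
    proof -
      have "y0 ^ p * Q s / \<epsilon> = y0 ^ p * q0 / \<epsilon> + of_real s * (y0 ^ p * (q1 - q0) / \<epsilon>)"
        by (simp add: Q_def algebra_simps add_divide_distrib diff_divide_distrib)
      then show ?thesis by (simp only: plus_complex.sel Re_of_real_mult)
    qed
    have "(\<phi> has_real_derivative \<phi>' s) (at s)"
      unfolding \<phi>_def \<phi>'_def eq by (rule derivative_eq_intros refl)+ simp
    then show ?thesis by (simp only: has_real_derivative_iff_has_vector_derivative)
  qed
  have bnd: "norm (\<psi>' s) \<le> \<phi>' s" if s: "0 \<le> s" "s \<le> 1" for s
  proof -
    have nz: "croot p (Q s) \<noteq> 0" using slit[OF s] by (auto intro!: croot_nonzero simp: Q_def)
    have nX: "norm (X s) = norm y0 * norm (croot p (Q s))" by (simp add: X_def norm_mult)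
    have "norm (\<psi>' s) = norm (q1 - q0) * (norm y0 / (real p * norm (croot p (Q s)) ^ (p - 1)))
              * (exp (- Re (y0 ^ p * Q s / \<epsilon>)) * norm (f (X s)))"
      by (simp add: \<psi>'_def norm_mult norm_divide norm_power Xp)
    also have "\<dots> \<le> norm (q1 - q0) * (norm y0 / (real p * norm (croot p (Q s)) ^ (p - 1)))
              * (exp (- Re (y0 ^ p * Q s / \<epsilon>)) * (M * norm (X s) ^ (p - 1)))"
      using f[OF s] by (intro mult_left_mono) (auto simp: X_def Q_def)
    also have "\<dots> = M / p * norm (y0 ^ p * (q1 - q0)) * exp (- Re (y0 ^ p * Q s / \<epsilon>))"
    proof -
      have "norm y0 * norm y0 ^ (p - 1) = norm y0 ^ p" using p by (metis power_eq_if not_gr_zero)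
      then show ?thesis
        using nz unfolding nX power_mult_distrib norm_mult norm_power
        by (simp add: field_simps)
    qed
    also have "\<dots> = K * (c * norm (y0 ^ p * (q1 - q0)) / norm \<epsilon>) * exp (- Re (y0 ^ p * Q s / \<epsilon>))"
      using \<epsilon> c p by (simp add: K_def)
    also have "\<dots> \<le> \<phi>' s"
      unfolding \<phi>'_def using K dir by (intro mult_right_mono mult_left_mono) auto
    finally show ?thesis .
  qed
  have "norm (\<psi> 1 - \<psi> 0) \<le> \<phi> 1 - \<phi> 0"
  proof (rule differentiable_bound_general[OF zero_less_one, where f' = \<psi>' and \<phi>' = \<phi>'])
    show "continuous_on {0..1} \<psi>"
      using d\<psi> by (intro continuous_at_imp_continuous_on ballI) (auto intro: has_vector_derivative_continuous)
    show "continuous_on {0..1} \<phi>"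
      using d\<phi> by (intro continuous_at_imp_continuous_on ballI) (auto intro: has_vector_derivative_continuous)
  qed (use d\<psi> d\<phi> bnd in auto)
  also have "\<dots> \<le> K * exp (- Re (y0 ^ p * q0 / \<epsilon>))"
    using K by (simp add: \<phi>_def Q_def)
  finally show ?thesis
    by (simp add: \<psi>_def Xp K_def) (simp add: Q_def X_def)
qed

text \<open>The constant 3/4 lies between cos (pi/4) and 1: all points with p |arg x| up to 3 pi/4 are included, and
segments in the u-plane from x^p to the positive axis still stay away from 0.\<close>

definition front :: "nat \<Rightarrow> complex \<Rightarrow> bool" where
  "front p x \<longleftrightarrow> x = croot p (x ^ p) \<and> Re (x ^ p) \<ge> - (3/4) * norm x ^ p"

lemma front_of_real: "p > 0 \<Longrightarrow> t \<ge> 0 \<Longrightarrow> front p (of_real t)"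
proof -
  assume "p > 0" "t \<ge> 0"
  then have "croot p (of_real t ^ p) = of_real t"
    using croot_of_real[of p "t ^ p"] by (simp add: real_root_power_cancel)
  moreover have "Re (of_real t ^ p :: complex) = t ^ p"
    by (simp flip: of_real_power)
  moreover have "t ^ p \<ge> 0" using \<open>t \<ge> 0\<close> by simp
  moreover have "- (3/4) * t ^ p \<le> t ^ p" using calculation(3) by linarith
  ultimately show ?thesis using \<open>t \<ge> 0\<close> by (simp add: front_def)
qed

text \<open>The angle at 0 between u and the positive axis is bounded away from pi.\<close>

lemma norm_segment_ge:
  assumes "Re u \<ge> - (3/4) * norm u" "b > 0" "0 \<le> s" "s \<le> 1"
  shows "norm (u + of_real s * (of_real b - u)) \<ge> min (norm u) b / 4"
proof -
  define A where "A = (1 - s) * norm u"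
  define B where "B = s * b"
  have AB: "A \<ge> 0" "B \<ge> 0" using assms by (auto simp: A_def B_def)
  have quad: "((A + B) / 4)\<^sup>2 \<le> A\<^sup>2 + B\<^sup>2 - 3/2 * A * B"
  proof -
    have e: "A\<^sup>2 + B\<^sup>2 - 3/2 * A * B = ((A + B) / 4)\<^sup>2 + (13 * (A - B)\<^sup>2 + 2 * A\<^sup>2 + 2 * B\<^sup>2) / 16"
      by (simp add: power2_eq_square field_simps)
    have "0 \<le> (13 * (A - B)\<^sup>2 + 2 * A\<^sup>2 + 2 * B\<^sup>2) / 16" by simp
    then show ?thesis unfolding e by (simp only: le_add_same_cancel1)
  qed
  have "(norm (u + of_real s * (of_real b - u)))\<^sup>2 = ((1 - s) * Re u + s * b)\<^sup>2 + ((1 - s) * Im u)\<^sup>2"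
    by (simp add: cmod_power2 algebra_simps)
  also have "\<dots> = (1 - s)\<^sup>2 * ((Re u)\<^sup>2 + (Im u)\<^sup>2) + B\<^sup>2 + 2 * ((1 - s) * B) * Re u"
    by (simp add: B_def power2_eq_square algebra_simps)
  also have "\<dots> = A\<^sup>2 + B\<^sup>2 + 2 * ((1 - s) * B) * Re u"
    by (simp add: A_def cmod_power2 power_mult_distrib)
  also have "\<dots> \<ge> A\<^sup>2 + B\<^sup>2 + 2 * ((1 - s) * B) * (- (3/4) * norm u)"
    using assms AB by (intro add_left_mono mult_left_mono) auto
  also have "A\<^sup>2 + B\<^sup>2 + 2 * ((1 - s) * B) * (- (3/4) * norm u) = A\<^sup>2 + B\<^sup>2 - 3/2 * A * B"
    by (simp add: A_def)
  finally have "(norm (u + of_real s * (of_real b - u)))\<^sup>2 \<ge> A\<^sup>2 + B\<^sup>2 - 3/2 * A * B" .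
  with quad have "((A + B) / 4)\<^sup>2 \<le> (norm (u + of_real s * (of_real b - u)))\<^sup>2"
    by (rule order_trans)
  then have "(A + B) / 4 \<le> norm (u + of_real s * (of_real b - u))"
    by (rule power2_le_imp_le) simp
  moreover have "A + B \<ge> min (norm u) b"
  proof -
    have "A + B \<ge> (1 - s) * min (norm u) b + s * min (norm u) b"
      unfolding A_def B_def using assms by (intro add_mono mult_left_mono) auto
    then show ?thesis by (simp add: algebra_simps)
  qed
  then have "min (norm u) b / 4 \<le> (A + B) / 4"
    by (rule divide_right_mono) simp
  ultimately show ?thesis by (rule order_trans[rotated])
qed

lemma segment_slit:
  assumes "Re u \<ge> - (3/4) * norm u" "u \<noteq> 0" "b > 0" "0 \<le> s" "s \<le> 1"
  shows "u + of_real s * (of_real b - u) \<notin> \<real>\<^sub>\<le>\<^sub>0"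
proof
  assume "u + of_real s * (of_real b - u) \<in> \<real>\<^sub>\<le>\<^sub>0"
  then have 1: "(1 - s) * Im u = 0" and 2: "(1 - s) * Re u + s * b \<le> 0"
    by (auto simp: complex_nonpos_Reals_iff algebra_simps)
  show False
  proof (cases "s = 1")
    case True then show False using 2 assms by simp
  next
    case False
    then have "Im u = 0" using 1 by simp
    then have "Re u > 0" using assms(1,2) by (auto simp: cmod_eq_Re complex_eq_iff abs_if split: if_splits)
    then have "(1 - s) * Re u > 0" using False assms by simp
    moreover have "s * b \<ge> 0" using assms by simp
    ultimately show False using 2 by simp
  qed
qed

lemma front_bound:
  assumes p: "p > 0" and \<epsilon>: "\<epsilon> \<noteq> 0" and c: "c > 0"
    and x: "front p x" "x \<noteq> 0" and b: "b > 0"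
    and D: "\<And>s. 0 \<le> s \<Longrightarrow> s \<le> 1 \<Longrightarrow> croot p (x ^ p + of_real s * (of_real b - x ^ p)) \<in> D"
    and z: "lin_sol p \<epsilon> f z D"
    and f: "\<And>t. t \<in> D \<Longrightarrow> norm t ^ p \<ge> min (norm x ^ p) b / 4 \<Longrightarrow> norm (f t) \<le> M * norm t ^ (p - 1)"
    and dir: "Re ((of_real b - x ^ p) / \<epsilon>) \<ge> c * norm (of_real b - x ^ p) / norm \<epsilon>"
  shows "norm (exp (- (of_real b / \<epsilon>)) * z (of_real (root p b)) - exp (- (x ^ p / \<epsilon>)) * z x)
         \<le> M * norm \<epsilon> / (of_nat p * c) * exp (- Re (x ^ p / \<epsilon>))"
proof -
  have xp: "Re (x ^ p) \<ge> - (3/4) * norm (x ^ p)" "x ^ p \<noteq> 0" "croot p (x ^ p) = x"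
    using x by (auto simp: front_def norm_power)
  have "norm (exp (- (1 ^ p * of_real b / \<epsilon>)) * z (1 * croot p (of_real b))
             - exp (- (1 ^ p * x ^ p / \<epsilon>)) * z (1 * croot p (x ^ p)))
         \<le> M * norm \<epsilon> / (of_nat p * c) * exp (- Re (1 ^ p * x ^ p / \<epsilon>))"
  proof (rule path_bound[OF p \<epsilon> c _ _ _ z])
    fix s :: real assume s: "0 \<le> s" "s \<le> 1"
    show "x ^ p + of_real s * (of_real b - x ^ p) \<notin> \<real>\<^sub>\<le>\<^sub>0"
      by (rule segment_slit) (use xp b s in auto)
    show inD: "1 * croot p (x ^ p + of_real s * (of_real b - x ^ p)) \<in> D" using D[OF s] by simp
    show "cmod (f (1 * croot p (x ^ p + of_real s * (of_real b - x ^ p))))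
          \<le> M * cmod (1 * croot p (x ^ p + of_real s * (of_real b - x ^ p))) ^ (p - 1)"
      using f[OF inD] norm_segment_ge[OF xp(1) b s] by (simp add: norm_croot_power[OF p] norm_power)
  qed (use dir in auto)
  then show ?thesis using b p by (simp add: xp croot_of_real)
qed

lemma radial_bound:
  assumes p: "p > 0" and \<epsilon>: "\<epsilon> \<noteq> 0" and c: "c > 0"
    and x: "x \<noteq> 0" and t: "0 < t" "t \<le> 1"
    and D: "\<And>r. t \<le> r \<Longrightarrow> r \<le> 1 \<Longrightarrow> of_real r * x \<in> D"
    and z: "lin_sol p \<epsilon> f z D"
    and f: "\<And>r. t \<le> r \<Longrightarrow> r \<le> 1 \<Longrightarrow> norm (f (of_real r * x)) \<le> M * norm (of_real r * x) ^ (p - 1)"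
    and dir: "Re (x ^ p / \<epsilon>) \<le> - c * norm x ^ p / norm \<epsilon>"
  shows "norm (exp (- ((of_real t * x) ^ p / \<epsilon>)) * z (of_real t * x) - exp (- (x ^ p / \<epsilon>)) * z x)
         \<le> M * norm \<epsilon> / (of_nat p * c) * exp (- Re (x ^ p / \<epsilon>))"
proof -
  define k where "k = t ^ p"
  have k: "0 < k" "k \<le> 1" using t by (auto simp: k_def power_le_one)
  have Q: "1 + of_real s * (of_real k - 1) = complex_of_real (1 + s * (k - 1))" for s
    by simp
  have Qk: "k \<le> 1 + s * (k - 1)" "1 + s * (k - 1) \<le> 1" if "0 \<le> s" "s \<le> 1" for s
  proof -
    have "(1 - s) * (1 - k) \<ge> 0" using that k by auto
    then show "k \<le> 1 + s * (k - 1)" by (simp add: algebra_simps)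
    have "s * (1 - k) \<ge> 0" using that k by auto
    then show "1 + s * (k - 1) \<le> 1" by (simp add: algebra_simps)
  qed
  have C: "x * croot p (1 + of_real s * (of_real k - 1)) = of_real (root p (1 + s * (k - 1))) * x"
    if "0 \<le> s" "s \<le> 1" for s
    using Qk[OF that] k p unfolding Q by (subst croot_of_real) auto
  have R: "t \<le> root p (1 + s * (k - 1))" "root p (1 + s * (k - 1)) \<le> 1" if "0 \<le> s" "s \<le> 1" for s
  proof -
    have "t = root p k" using t p by (simp add: k_def real_root_power_cancel)
    then show "t \<le> root p (1 + s * (k - 1))" using Qk[OF that] p by simp
    show "root p (1 + s * (k - 1)) \<le> 1" using Qk[OF that] p by simp
  qed
  have "norm (exp (- (x ^ p * of_real k / \<epsilon>)) * z (x * croot p (of_real k))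
             - exp (- (x ^ p * 1 / \<epsilon>)) * z (x * croot p 1))
         \<le> M * norm \<epsilon> / (of_nat p * c) * exp (- Re (x ^ p * 1 / \<epsilon>))"
  proof (rule path_bound[OF p \<epsilon> c x _ _ z])
    fix s :: real assume s: "0 \<le> s" "s \<le> 1"
    show "1 + complex_of_real s * (of_real k - 1) \<notin> \<real>\<^sub>\<le>\<^sub>0"
    proof -
      have "Re (complex_of_real (1 + s * (k - 1))) > 0" using Qk[OF s] k by simp
      then show ?thesis unfolding Q by (auto simp: complex_nonpos_Reals_iff)
    qed
    show "x * croot p (1 + of_real s * (of_real k - 1)) \<in> D"
      unfolding C[OF s] by (rule D) (use R[OF s] in auto)
    show "norm (f (x * croot p (1 + of_real s * (of_real k - 1))))
        \<le> M * norm (x * croot p (1 + of_real s * (of_real k - 1))) ^ (p - 1)"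
      unfolding C[OF s] by (rule f) (use R[OF s] in auto)
  next
    have "x ^ p * (of_real k - 1) / \<epsilon> = of_real (k - 1) * (x ^ p / \<epsilon>)" by simp
    then have "Re (x ^ p * (of_real k - 1) / \<epsilon>) = (k - 1) * Re (x ^ p / \<epsilon>)"
      by (simp only: Re_of_real_mult)
    then have 1: "Re (x ^ p * (of_real k - 1) / \<epsilon>) = (1 - k) * (- Re (x ^ p / \<epsilon>))"
      by (simp add: algebra_simps)
    have "norm (of_real k - 1 :: complex) = 1 - k"
      using k by (metis abs_of_nonpos diff_le_0_iff_le minus_diff_eq norm_of_real of_real_1 of_real_diff)
    then have 2: "norm (x ^ p * (of_real k - 1)) = (1 - k) * norm x ^ p"
      by (simp add: norm_mult norm_power)
    have "(1 - k) * (c * norm x ^ p / norm \<epsilon>) \<le> (1 - k) * (- Re (x ^ p / \<epsilon>))"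
      using dir k by (intro mult_left_mono) auto
    then show "c * norm (x ^ p * (of_real k - 1)) / norm \<epsilon> \<le> Re (x ^ p * (of_real k - 1) / \<epsilon>)"
      unfolding 1 2 by (simp add: mult_ac)
  qed
  moreover have "croot p (of_real k) = of_real t"
    using t p k by (simp add: croot_of_real k_def real_root_power_cancel del: of_real_power)
  moreover have "croot p 1 = 1" using croot_of_real[of p 1] p by simp
  ultimately show ?thesis by (simp add: k_def power_mult_distrib mult.commute)
qed

lemma norm_le_of_diff: "norm (b - a) \<le> d \<Longrightarrow> norm a \<le> norm b + d"
  using norm_triangle_ineq2[of a b] by (simp add: norm_minus_commute)

text \<open>The weight ((|t| + h)/h)^n with h = |\<eta>| is what a bounded function of x and a function of X = x/\<eta> of growth |X|^n
have in common; away from the disc of radius \<mu> h it is comparable to (|t|/h)^n.\<close>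

lemma weight_le:
  assumes "h > 0" "\<mu> > 0" "\<mu> * h / 4 \<le> norm (t::complex)" "M \<ge> 0"
    and "norm w \<le> M * ((norm t + h) / h) ^ n"
  shows "norm (w::complex) \<le> M * ((1 + 4 / \<mu>) / h) ^ n * norm t ^ n"
proof -
  have "h \<le> 4 / \<mu> * norm t" using assms by (simp add: field_simps)
  then have "norm t + h \<le> (1 + 4 / \<mu>) * norm t"
    by (simp add: distrib_right)
  then have "(norm t + h) / h \<le> (1 + 4 / \<mu>) * norm t / h"
    using assms(1) by (intro divide_right_mono) auto
  then have "(norm t + h) / h \<le> (1 + 4 / \<mu>) / h * norm t"
    by simp
  then have "((norm t + h) / h) ^ n \<le> ((1 + 4 / \<mu>) / h * norm t) ^ n"
    using assms(1) by (intro power_mono) auto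
  then have "M * ((norm t + h) / h) ^ n \<le> M * ((1 + 4 / \<mu>) / h * norm t) ^ n"
    using assms(4) by (rule mult_left_mono)
  then show ?thesis using assms(5) by (simp only: power_mult_distrib mult.assoc order_trans)
qed

definition step_const :: "nat \<Rightarrow> real \<Rightarrow> real \<Rightarrow> real" where
  "step_const p \<mu> c = (1 + 4 / \<mu>) ^ (p - 1) / (real p * c)"

lemma step_const_pos: "p > 0 \<Longrightarrow> \<mu> > 0 \<Longrightarrow> c > 0 \<Longrightarrow> step_const p \<mu> c > 0"
  unfolding step_const_def by (intro divide_pos_pos zero_less_power) (auto intro: add_pos_pos)

lemma step_const_eq:
  assumes "p > 0" "h > 0"
  shows "M * ((1 + 4 / \<mu>) / h) ^ (p - 1) * h ^ p / (real p * c) = step_const p \<mu> c * (M * h)"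
proof -
  have "h ^ p = h ^ (p - 1) * h" using assms(1) by (metis power_minus_mult)
  then show ?thesis using assms(2) by (simp add: step_const_def power_divide)
qed

text \<open>The scale h = |\<eta>| is the width of the turning point: since |x| is at least a multiple of h on the path, the factor
|\<epsilon>| = h^p of the general estimate improves the weight h^(1-p) to h.\<close>

lemma front_bound_scaled:
  assumes p: "p > 0" and h: "h > 0" and \<epsilon>: "norm \<epsilon> = h ^ p" and c: "c > 0" and \<mu>: "\<mu> > 0"
    and x: "front p x" "norm x \<ge> \<mu> * h" and b: "b \<ge> (\<mu> * h) ^ p"
    and D: "\<And>s. 0 \<le> s \<Longrightarrow> s \<le> 1 \<Longrightarrow> croot p (x ^ p + of_real s * (of_real b - x ^ p)) \<in> D"
    and z: "lin_sol p \<epsilon> f z D"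
    and M: "M \<ge> 0" and f: "\<And>t. t \<in> D \<Longrightarrow> norm (f t) \<le> M * ((norm t + h) / h) ^ (p - 1)"
    and dir: "Re ((of_real b - x ^ p) / \<epsilon>) \<ge> c * norm (of_real b - x ^ p) / norm \<epsilon>"
  shows "norm (exp (- (of_real b / \<epsilon>)) * z (of_real (root p b)) - exp (- (x ^ p / \<epsilon>)) * z x)
         \<le> step_const p \<mu> c * (M * h) * exp (- Re (x ^ p / \<epsilon>))"
proof -
  have \<mu>h: "\<mu> * h > 0" using h \<mu> by simp
  have 1: "norm (f t) \<le> M * ((1 + 4 / \<mu>) / h) ^ (p - 1) * norm t ^ (p - 1)"
    if t: "t \<in> D" "norm t ^ p \<ge> min (norm x ^ p) b / 4" for t
  proof (rule weight_le[OF h \<mu> _ M f[OF t(1)]])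
    have "(\<mu> * h) ^ p \<le> min (norm x ^ p) b"
      using b x(2) \<mu>h by (auto intro: power_mono)
    then have "(\<mu> * h) ^ p / 4 \<le> norm t ^ p" using t(2) by (smt (verit) divide_right_mono)
    moreover have "(\<mu> * h / 4) ^ p \<le> (\<mu> * h) ^ p / 4"
    proof -
      have "(4::real) \<le> 4 ^ p" using p by (cases p) auto
      then show ?thesis using \<mu>h unfolding power_divide by (intro divide_left_mono) auto
    qed
    ultimately have "(\<mu> * h / 4) ^ p \<le> norm t ^ p" by (rule order_trans[rotated])
    then show "\<mu> * h / 4 \<le> norm t" using p by (meson norm_ge_zero power_mono_iff not_le power_strict_mono)
  qed
  have "norm (exp (- (of_real b / \<epsilon>)) * z (of_real (root p b)) - exp (- (x ^ p / \<epsilon>)) * z x)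
         \<le> M * ((1 + 4 / \<mu>) / h) ^ (p - 1) * norm \<epsilon> / (real p * c) * exp (- Re (x ^ p / \<epsilon>))"
  proof (rule front_bound[OF p _ c x(1) _ _ D z 1 dir])
    show "\<epsilon> \<noteq> 0" using \<epsilon> h by auto
    show "x \<noteq> 0" using x(2) \<mu>h by auto
    show "b > 0" using b \<mu>h by (meson order_less_le_trans zero_less_power)
  qed
  then show ?thesis unfolding \<epsilon> step_const_eq[OF p h] .
qed

definition ext_const :: "nat \<Rightarrow> real \<Rightarrow> real \<Rightarrow> real" where
  "ext_const p \<mu> c = exp (2 * \<mu> ^ p) * (1 + 2 * \<mu> * (\<mu> + 1) ^ (p - 1)) + step_const p \<mu> c"

lemma ext_const_ge_1: "p > 0 \<Longrightarrow> \<mu> > 0 \<Longrightarrow> c > 0 \<Longrightarrow> ext_const p \<mu> c \<ge> 1"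
proof -
  assume a: "p > 0" "\<mu> > 0" "c > 0"
  have "1 * 1 \<le> exp (2 * \<mu> ^ p) * (1 + 2 * \<mu> * (\<mu> + 1) ^ (p - 1))"
    using a by (intro mult_mono) auto
  then show ?thesis using step_const_pos[OF a] by (simp add: ext_const_def)
qed

text \<open>For |x| <= \<mu> h the exponential exp (x^p/\<epsilon>) lies between exp (- \<mu>^p) and exp (\<mu>^p), and the path to \<mu> h has length at most 2 \<mu> h.\<close>

lemma disc_bound:
  assumes p: "p > 0" and h: "h > 0" and \<epsilon>: "norm \<epsilon> = h ^ p" and \<mu>: "\<mu> > 0"
    and disc: "ball 0 (\<mu> * h) \<subseteq> D" "of_real (\<mu> * h) \<in> D"
    and z: "lin_sol p \<epsilon> f z D"
    and M: "M \<ge> 0" and f: "\<And>t. t \<in> D \<Longrightarrow> norm (f t) \<le> M * ((norm t + h) / h) ^ (p - 1)"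
    and Q: "norm (z (of_real (\<mu> * h))) \<le> Q"
    and x: "norm x < \<mu> * h"
  shows "norm (z x) \<le> exp (2 * \<mu> ^ p) * (1 + 2 * \<mu> * (\<mu> + 1) ^ (p - 1)) * (Q + M * h)"
proof -
  define E where "E = exp (\<mu> ^ p)"
  define x1 where "x1 = complex_of_real (\<mu> * h)"
  define \<psi> where "\<psi> = (\<lambda>x. exp (- (x ^ p / \<epsilon>)) * z x)"
  have Q0: "Q \<ge> 0" using Q norm_ge_zero order_trans by blast
  have nx1: "norm x1 = \<mu> * h" using h \<mu> by (simp add: x1_def norm_mult)
  have E: "norm (exp (w * (t ^ p / \<epsilon>))) \<le> E" if "norm t \<le> \<mu> * h" "norm w = 1" for t w
  proof -
    have "norm t / h \<le> \<mu>" using that(1) h by (simp add: pos_divide_le_eq)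
    then have "(norm t / h) ^ p \<le> \<mu> ^ p" by (rule power_mono) (use h in simp)
    moreover have "norm (w * (t ^ p / \<epsilon>)) = (norm t / h) ^ p"
      by (simp only: norm_mult that(2) mult_1_left norm_divide norm_power \<epsilon> power_divide)
    ultimately have "norm (w * (t ^ p / \<epsilon>)) \<le> \<mu> ^ p" by (simp only:)
    with norm_exp[of "w * (t ^ p / \<epsilon>)"] show ?thesis
      unfolding E_def by (meson exp_le_cancel_iff order_trans)
  qed
  have seg: "t \<in> D \<and> norm t \<le> \<mu> * h" if t: "t \<in> closed_segment x x1" for t
  proof (cases "t = x1")
    case True then show ?thesis using disc(2) nx1 by (simp add: x1_def)
  next
    case False
    obtain u where u: "t = (1 - u) *\<^sub>R x + u *\<^sub>R x1" "0 \<le> u" "u \<le> 1"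
      using t unfolding closed_segment_def by blast
    have "u \<noteq> 1" using False unfolding u(1) by (rule contrapos_nn) simp
    have "norm t \<le> norm ((1 - u) *\<^sub>R x) + norm (u *\<^sub>R x1)"
      unfolding u(1) by (rule norm_triangle_ineq)
    also have "\<dots> = (1 - u) * norm x + u * (\<mu> * h)"
      using u(2,3) by (simp add: nx1)
    also have "\<dots> < (1 - u) * (\<mu> * h) + u * (\<mu> * h)"
      by (rule add_strict_right_mono, rule mult_strict_left_mono[OF x])
         (use u(3) \<open>u \<noteq> 1\<close> in simp)
    also have "\<dots> = \<mu> * h" by (simp add: algebra_simps)
    finally have lt: "norm t < \<mu> * h" .
    then have "t \<in> ball 0 (\<mu> * h)" by simp
    with disc(1) lt show ?thesis by (meson less_imp_le subsetD)
  qed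
  have "norm (\<psi> x1 - \<psi> x) \<le> (E * (M * (\<mu> + 1) ^ (p - 1))) * norm (x1 - x)"
  proof (rule field_differentiable_bound[of "closed_segment x x1"])
    fix t assume t: "t \<in> closed_segment x x1"
    show "(\<psi> has_field_derivative exp (- (t ^ p / \<epsilon>)) * f t) (at t within closed_segment x x1)"
      unfolding \<psi>_def
      by (rule has_field_derivative_at_within, rule lin_sol_exp_deriv[OF p], rule lin_solD[OF z])
         (use seg[OF t] in simp)
    have "norm (f t) \<le> M * ((norm t + h) / h) ^ (p - 1)" using f seg[OF t] by auto
    also have "\<dots> \<le> M * (\<mu> + 1) ^ (p - 1)"
      using M h seg[OF t] by (intro mult_left_mono power_mono) (auto simp: field_simps)
    finally have "norm (f t) \<le> M * (\<mu> + 1) ^ (p - 1)" .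
    moreover have "norm (exp (- (t ^ p / \<epsilon>))) \<le> E"
      using E[of t "-1"] seg[OF t] by simp
    ultimately show "norm (exp (- (t ^ p / \<epsilon>)) * f t) \<le> E * (M * (\<mu> + 1) ^ (p - 1))"
      unfolding norm_mult by (intro mult_mono) (auto simp: E_def)
  qed auto
  also have "\<dots> \<le> (E * (M * (\<mu> + 1) ^ (p - 1))) * (2 * \<mu> * h)"
  proof (rule mult_left_mono)
    show "norm (x1 - x) \<le> 2 * \<mu> * h"
      using norm_triangle_ineq4[of x1 x] x nx1 by simp
  qed (use M \<mu> in \<open>auto simp: E_def\<close>)
  finally have 1: "norm (\<psi> x1 - \<psi> x) \<le> E * (2 * \<mu> * (\<mu> + 1) ^ (p - 1) * (M * h))"
    by (simp add: algebra_simps)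
  have 2: "norm (\<psi> x1) \<le> E * Q"
    using E[of x1 "-1"] Q nx1 unfolding \<psi>_def norm_mult
    by (intro mult_mono) (auto simp: E_def x1_def)
  have "norm (\<psi> x) \<le> norm (\<psi> x1) + norm (\<psi> x1 - \<psi> x)"
    using norm_triangle_ineq4[of "\<psi> x1" "\<psi> x1 - \<psi> x"] by simp
  also have "\<dots> \<le> E * Q + E * (2 * \<mu> * (\<mu> + 1) ^ (p - 1) * (M * h))"
    using 1 2 by (rule add_mono[rotated])
  finally have 3: "norm (\<psi> x) \<le> E * (Q + 2 * \<mu> * (\<mu> + 1) ^ (p - 1) * (M * h))"
    by (simp add: algebra_simps)
  have "z x = exp (x ^ p / \<epsilon>) * \<psi> x"
    by (simp add: \<psi>_def exp_minus)
  then have "norm (z x) = norm (exp (x ^ p / \<epsilon>)) * norm (\<psi> x)" by (simp only: norm_mult)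
  also have "\<dots> \<le> E * (E * (Q + 2 * \<mu> * (\<mu> + 1) ^ (p - 1) * (M * h)))"
    using E[of x 1] 3 x by (intro mult_mono) (auto simp: E_def)
  also have "\<dots> = exp (2 * \<mu> ^ p) * (Q + 2 * \<mu> * (\<mu> + 1) ^ (p - 1) * (M * h))"
    by (simp add: E_def flip: exp_add mult.assoc)
  also have "\<dots> \<le> exp (2 * \<mu> ^ p) * ((1 + 2 * \<mu> * (\<mu> + 1) ^ (p - 1)) * (Q + M * h))"
  proof (rule mult_left_mono)
    have "0 \<le> 2 * \<mu> * (\<mu> + 1) ^ (p - 1) * Q" "0 \<le> M * h" using \<mu> Q0 M h by auto
    then show "Q + 2 * \<mu> * (\<mu> + 1) ^ (p - 1) * (M * h) \<le> (1 + 2 * \<mu> * (\<mu> + 1) ^ (p - 1)) * (Q + M * h)"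
      by (simp add: distrib_left distrib_right)
  qed auto
  finally show ?thesis by (simp only: mult.assoc)
qed

text \<open>Points behind the turning point are reached from the front through the disc of radius \<mu> h and then along a radius,
on which Re (x^p/\<epsilon>) decreases.\<close>

lemma extend_bound:
  assumes p: "p > 0" and h: "h > 0" and \<epsilon>: "norm \<epsilon> = h ^ p" and c: "c > 0" and \<mu>: "\<mu> > 0"
    and disc: "ball 0 (\<mu> * h) \<subseteq> D" "of_real (\<mu> * h) \<in> D"
    and star: "\<And>x r. x \<in> D \<Longrightarrow> 0 \<le> r \<Longrightarrow> r \<le> 1 \<Longrightarrow> of_real r * x \<in> D"
    and dich: "\<And>x. x \<in> D \<Longrightarrow> norm x \<ge> \<mu> * h \<Longrightarrow> front p x \<or> Re (x ^ p / \<epsilon>) \<le> - c * norm x ^ p / norm \<epsilon>"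
    and z: "lin_sol p \<epsilon> f z D"
    and f: "\<And>t. t \<in> D \<Longrightarrow> norm (f t) \<le> M * ((norm t + h) / h) ^ (p - 1)"
    and Q: "\<And>x. x \<in> D \<Longrightarrow> norm x \<ge> \<mu> * h \<Longrightarrow> front p x \<Longrightarrow> norm (z x) \<le> Q"
    and x: "x \<in> D"
  shows "norm (z x) \<le> ext_const p \<mu> c * (Q + M * h)"
proof -
  have \<mu>h: "\<mu> * h > 0" using h \<mu> by simp
  have "0 \<in> D" using disc(1) \<mu>h by auto
  from f[OF this] have M: "M \<ge> 0" using h by (auto intro: order_trans[OF norm_ge_zero])
  have Q1: "norm (z (of_real (\<mu> * h))) \<le> Q"
    by (rule Q[OF disc(2)]) (use \<mu> h front_of_real[OF p, of "\<mu> * h"] in \<open>auto simp: norm_mult\<close>)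
  have Q0: "Q \<ge> 0" using Q1 norm_ge_zero order_trans by blast
  have QM: "Q + M * h \<ge> 0" using Q0 M h by simp
  define d where "d = exp (2 * \<mu> ^ p) * (1 + 2 * \<mu> * (\<mu> + 1) ^ (p - 1))"
  have d: "ext_const p \<mu> c = d + step_const p \<mu> c" by (simp add: ext_const_def d_def)
  have db: "norm (z t) \<le> d * (Q + M * h)" if "norm t < \<mu> * h" for t
    unfolding d_def by (rule disc_bound[OF p h \<epsilon> \<mu> disc z M f Q1 that])
  have sc: "0 \<le> step_const p \<mu> c * (Q + M * h)" using step_const_pos[OF p \<mu> c] QM by simp
  show ?thesis
  proof (cases "norm x < \<mu> * h")
    case True
    from db[OF this] show ?thesis unfolding d using sc by (simp add: distrib_right)
  next
    case False
    then have nx: "norm x \<ge> \<mu> * h" by simp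
    from dich[OF x nx] show ?thesis
    proof
      assume "front p x"
      from Q[OF x nx this] have "norm (z x) \<le> 1 * (Q + M * h)"
        using mult_nonneg_nonneg[OF M less_imp_le[OF h]] by simp
      also have "\<dots> \<le> ext_const p \<mu> c * (Q + M * h)"
        using ext_const_ge_1[OF p \<mu> c] QM by (rule mult_right_mono)
      finally show ?thesis .
    next
      assume bk: "Re (x ^ p / \<epsilon>) \<le> - c * norm x ^ p / norm \<epsilon>"
      define t where "t = \<mu> * h / (2 * norm x)"
      have nx0: "norm x > 0" using nx \<mu>h by linarith
      have t: "0 < t" "t \<le> 1/2" using nx nx0 \<mu>h by (auto simp: t_def field_simps)
      have tx: "norm (of_real t * x) = \<mu> * h / 2" 
      proof -
        have "norm (of_real t * x) = t * norm x" using t(1) by (simp add: norm_mult)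
        then show ?thesis using nx0 by (simp add: t_def)
      qed
      have "norm (exp (- ((of_real t * x) ^ p / \<epsilon>)) * z (of_real t * x) - exp (- (x ^ p / \<epsilon>)) * z x)
         \<le> M * ((1 + 4 / \<mu>) / h) ^ (p - 1) * norm \<epsilon> / (of_nat p * c) * exp (- Re (x ^ p / \<epsilon>))"
      proof (rule radial_bound[OF p _ c _ t(1) _ _ z _ bk])
        fix r assume r: "t \<le> r" "r \<le> 1"
        show rx: "of_real r * x \<in> D" using star[OF x, of r] r t by simp
        show "norm (f (of_real r * x)) \<le> M * ((1 + 4 / \<mu>) / h) ^ (p - 1) * norm (of_real r * x) ^ (p - 1)"
        proof (rule weight_le[OF h \<mu> _ M f[OF rx]])
          have "\<mu> * h / 4 \<le> t * norm x" using tx t \<mu>h by (simp add: norm_mult)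
          also have "\<dots> \<le> r * norm x" using r by (simp add: mult_right_mono)
          finally show "\<mu> * h / 4 \<le> norm (of_real r * x)" using r t by (simp add: norm_mult)
        qed
      qed (use nx0 \<epsilon> h t in auto)
      also have "M * ((1 + 4 / \<mu>) / h) ^ (p - 1) * norm \<epsilon> / (of_nat p * c) = step_const p \<mu> c * (M * h)"
        unfolding \<epsilon> by (rule step_const_eq[OF p h])
      finally have 1: "norm (exp (- ((of_real t * x) ^ p / \<epsilon>)) * z (of_real t * x) - exp (- (x ^ p / \<epsilon>)) * z x)
         \<le> step_const p \<mu> c * (M * h) * exp (- Re (x ^ p / \<epsilon>))" .
      have Ret: "Re ((of_real t * x) ^ p / \<epsilon>) = t ^ p * Re (x ^ p / \<epsilon>)"
        unfolding power_mult_distrib times_divide_eq_right[symmetric] of_real_power[symmetric]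
        by (rule Re_of_real_mult)
      have neg: "Re (x ^ p / \<epsilon>) \<le> 0"
        using bk c \<epsilon> h by (smt (verit) divide_nonneg_nonneg mult_nonneg_nonneg norm_ge_zero
            zero_le_power divide_minus_left mult_minus_left)
      have le: "Re (x ^ p / \<epsilon>) \<le> t ^ p * Re (x ^ p / \<epsilon>)"
        using neg t power_le_one[of t p] by (simp add: mult_le_cancel_right1)
      have "norm (exp (- (x ^ p / \<epsilon>)) * z x)
             \<le> norm (exp (- ((of_real t * x) ^ p / \<epsilon>)) * z (of_real t * x))
               + step_const p \<mu> c * (M * h) * exp (- Re (x ^ p / \<epsilon>))"
        using 1 by (rule norm_le_of_diff)
      also have "\<dots> \<le> exp (- Re (x ^ p / \<epsilon>)) * (d * (Q + M * h))
               + step_const p \<mu> c * (M * h) * exp (- Re (x ^ p / \<epsilon>))"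
      proof (rule add_right_mono)
        have "norm (exp (- ((of_real t * x) ^ p / \<epsilon>))) \<le> exp (- Re (x ^ p / \<epsilon>))"
          using le by (simp only: norm_exp_eq_Re uminus_complex.sel Ret) simp
        then show "norm (exp (- ((of_real t * x) ^ p / \<epsilon>)) * z (of_real t * x))
           \<le> exp (- Re (x ^ p / \<epsilon>)) * (d * (Q + M * h))"
          unfolding norm_mult using db[of "of_real t * x"] tx \<mu>h
          by (intro mult_mono) (auto simp: norm_mult)
      qed
      finally have "exp (- Re (x ^ p / \<epsilon>)) * norm (z x)
          \<le> exp (- Re (x ^ p / \<epsilon>)) * (d * (Q + M * h) + step_const p \<mu> c * (M * h))"
        by (simp add: norm_mult distrib_left mult.commute)
      then have "norm (z x) \<le> d * (Q + M * h) + step_const p \<mu> c * (M * h)"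
        by (simp only: mult_le_cancel_left_pos exp_gt_zero)
      also have "\<dots> \<le> ext_const p \<mu> c * (Q + M * h)"
        unfolding d distrib_right using step_const_pos[OF p \<mu> c] Q0
        by (intro add_left_mono mult_left_mono) auto
      finally show ?thesis .
    qed
  qed
qed

section \<open>Expansions in inverse powers\<close>

text \<open>For bounded functions it makes no difference whether the estimate is required near infinity or for |X| >= 1; the
common threshold lets constants be combined without choosing radii.\<close>

definition inv_expansion :: "complex set \<Rightarrow> (nat \<Rightarrow> complex) \<Rightarrow> (complex \<Rightarrow> complex) \<Rightarrow> bool" where
  "inv_expansion V c g \<longleftrightarrow> (\<forall>N. \<exists>K. \<forall>X\<in>V. norm X \<ge> 1 \<longrightarrow> norm (g X - (\<Sum>m<N. c m / X ^ m)) \<le> K / norm X ^ N)"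

text \<open>The coefficient class of the functions g n, with an expansion of the above form (see inner_fun_imp_bounded_asymptotic).\<close>

definition inner_fun :: "complex set \<Rightarrow> (complex \<Rightarrow> complex) set" where
  "inner_fun V = {g. g holomorphic_on V \<and> bounded (g ` V) \<and> (\<exists>c. c 0 = 0 \<and> inv_expansion V c g)}"

lemma inv_expansionE:
  assumes "inv_expansion V c g"
  obtains K where "K \<ge> 0" "\<And>X. X \<in> V \<Longrightarrow> norm X \<ge> 1 \<Longrightarrow> norm (g X - (\<Sum>m<N. c m / X ^ m)) \<le> K / norm X ^ N"
proof -
  obtain K where K: "\<And>X. X \<in> V \<Longrightarrow> norm X \<ge> 1 \<Longrightarrow> norm (g X - (\<Sum>m<N. c m / X ^ m)) \<le> K / norm X ^ N"
    using assms unfolding inv_expansion_def by blast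
  show ?thesis
  proof (rule that[of "max K 0"])
    fix X :: complex assume X: "X \<in> V" "norm X \<ge> 1"
    have "K / norm X ^ N \<le> max K 0 / norm X ^ N" by (rule divide_right_mono) auto
    with K[OF X] show "norm (g X - (\<Sum>m<N. c m / X ^ m)) \<le> max K 0 / norm X ^ N" by (rule order_trans)
  qed simp
qed

lemma inv_expansionI:
  assumes "\<And>N. \<exists>K. \<forall>X\<in>V. norm X \<ge> 1 \<longrightarrow> norm (g X - (\<Sum>m<N. c m / X ^ m)) \<le> K / norm X ^ N"
  shows "inv_expansion V c g"
  using assms by (auto simp: inv_expansion_def)

lemma inv_expansion_add:
  assumes "inv_expansion V c g" "inv_expansion V d h"
  shows "inv_expansion V (\<lambda>m. c m + d m) (\<lambda>X. g X + h X)"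
proof (rule inv_expansionI)
  fix N
  obtain K where K: "\<And>X. X \<in> V \<Longrightarrow> norm X \<ge> 1 \<Longrightarrow> norm (g X - (\<Sum>m<N. c m / X ^ m)) \<le> K / norm X ^ N"
    using inv_expansionE[OF assms(1)] by metis
  obtain L where L: "\<And>X. X \<in> V \<Longrightarrow> norm X \<ge> 1 \<Longrightarrow> norm (h X - (\<Sum>m<N. d m / X ^ m)) \<le> L / norm X ^ N"
    using inv_expansionE[OF assms(2)] by metis
  have "norm (g X + h X - (\<Sum>m<N. (c m + d m) / X ^ m)) \<le> (K + L) / norm X ^ N"
    if X: "X \<in> V" "norm X \<ge> 1" for X
  proof -
    have "g X + h X - (\<Sum>m<N. (c m + d m) / X ^ m)
        = (g X - (\<Sum>m<N. c m / X ^ m)) + (h X - (\<Sum>m<N. d m / X ^ m))"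
      by (simp add: add_divide_distrib sum.distrib)
    then show ?thesis
      using norm_triangle_mono[OF K[OF X] L[OF X]] by (simp only: add_divide_distrib)
  qed
  then show "\<exists>K. \<forall>X\<in>V. norm X \<ge> 1 \<longrightarrow> norm (g X + h X - (\<Sum>m<N. (c m + d m) / X ^ m)) \<le> K / norm X ^ N"
    by blast
qed

lemma inv_expansion_cmult:
  assumes "inv_expansion V c g"
  shows "inv_expansion V (\<lambda>m. k * c m) (\<lambda>X. k * g X)"
proof (rule inv_expansionI)
  fix N
  obtain K where K: "\<And>X. X \<in> V \<Longrightarrow> norm X \<ge> 1 \<Longrightarrow> norm (g X - (\<Sum>m<N. c m / X ^ m)) \<le> K / norm X ^ N"
    using inv_expansionE[OF assms(1)] by metis
  have "norm (k * g X - (\<Sum>m<N. k * c m / X ^ m)) \<le> (norm k * K) / norm X ^ N"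
    if X: "X \<in> V" "norm X \<ge> 1" for X
  proof -
    have "k * g X - (\<Sum>m<N. k * c m / X ^ m) = k * (g X - (\<Sum>m<N. c m / X ^ m))"
      by (simp add: sum_distrib_left right_diff_distrib)
    then show ?thesis
      using mult_left_mono[OF K[OF X], of "norm k"] by (simp add: norm_mult)
  qed
  then show "\<exists>K. \<forall>X\<in>V. norm X \<ge> 1 \<longrightarrow> norm (k * g X - (\<Sum>m<N. k * c m / X ^ m)) \<le> K / norm X ^ N"
    by blast
qed

text \<open>In the Cauchy product exactly the pairs with i + j >= N are left over.\<close>

lemma power_sum_product_tail:
  fixes c d :: "nat \<Rightarrow> complex"
  assumes "norm X \<ge> 1"
  shows "norm ((\<Sum>m<N. c m / X ^ m) * (\<Sum>m<N. d m / X ^ m) - (\<Sum>k<N. (\<Sum>i\<le>k. c i * d (k - i)) / X ^ k))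
     \<le> (\<Sum>i<N. \<Sum>j<N. norm (c i) * norm (d j)) / norm X ^ N"
proof -
  let ?T = "{(i, j). i + j < N}" and ?S = "{..<N} \<times> {..<N}"
  define t where "t = (\<lambda>(i, j). c i * d j / X ^ (i + j))"
  have TS: "?T \<subseteq> ?S" by auto
  have 1: "(\<Sum>m<N. c m / X ^ m) * (\<Sum>m<N. d m / X ^ m) = sum t ?S"
    by (simp add: sum_product sum.cartesian_product t_def power_add)
  have "(\<Sum>k<N. (\<Sum>i\<le>k. c i * d (k - i)) / X ^ k) = (\<Sum>k<N. \<Sum>i\<le>k. c i * d (k - i) / X ^ (i + (k - i)))"
    by (simp add: sum_divide_distrib)
  also have "\<dots> = (\<Sum>(i, j)\<in>?T. c i * d j / X ^ (i + j))"
    by (rule sum.triangle_reindex[symmetric])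
  finally have "(\<Sum>k<N. (\<Sum>i\<le>k. c i * d (k - i)) / X ^ k) = sum t ?T" by (simp only: t_def)
  with 1 have "(\<Sum>m<N. c m / X ^ m) * (\<Sum>m<N. d m / X ^ m) - (\<Sum>k<N. (\<Sum>i\<le>k. c i * d (k - i)) / X ^ k)
      = sum t (?S - ?T)"
    using TS by (simp add: sum_diff)
  also have "norm \<dots> \<le> (\<Sum>ij\<in>?S - ?T. norm (c (fst ij)) * norm (d (snd ij)) / norm X ^ N)"
  proof (rule sum_norm_le)
    fix ij assume ij: "ij \<in> ?S - ?T"
    have "norm X > 0" using assms by linarith
    have "norm X ^ N \<le> norm X ^ (fst ij + snd ij)"
      using ij assms by (intro power_increasing) auto
    then show "norm (t ij) \<le> norm (c (fst ij)) * norm (d (snd ij)) / norm X ^ N"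
      using \<open>norm X > 0\<close>
      by (auto simp: t_def norm_mult norm_divide norm_power split_beta intro!: divide_left_mono)
  qed
  also have "\<dots> \<le> (\<Sum>ij\<in>?S. norm (c (fst ij)) * norm (d (snd ij)) / norm X ^ N)"
    by (rule sum_mono2) auto
  also have "\<dots> = (\<Sum>i<N. \<Sum>j<N. norm (c i) * norm (d j)) / norm X ^ N"
    by (simp add: sum.cartesian_product sum_divide_distrib split_beta)
  finally show ?thesis .
qed

lemma inv_expansion_mult:
  assumes "inv_expansion V c g" "inv_expansion V d h"
  shows "inv_expansion V (\<lambda>k. \<Sum>i\<le>k. c i * d (k - i)) (\<lambda>X. g X * h X)"
proof (rule inv_expansionI)
  fix N
  obtain K where K: "K \<ge> 0" "\<And>X. X \<in> V \<Longrightarrow> norm X \<ge> 1 \<Longrightarrow> norm (g X - (\<Sum>m<N. c m / X ^ m)) \<le> K / norm X ^ N"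
    using inv_expansionE[OF assms(1)] by metis
  obtain L where L: "L \<ge> 0" "\<And>X. X \<in> V \<Longrightarrow> norm X \<ge> 1 \<Longrightarrow> norm (h X - (\<Sum>m<N. d m / X ^ m)) \<le> L / norm X ^ N"
    using inv_expansionE[OF assms(2)] by metis
  obtain B where B: "B \<ge> 0" "\<And>X. X \<in> V \<Longrightarrow> norm X \<ge> 1 \<Longrightarrow> norm (h X - (\<Sum>m<0. d m / X ^ m)) \<le> B / norm X ^ 0"
    using inv_expansionE[OF assms(2)] by metis
  define A where "A = (\<Sum>m<N. norm (c m))"
  define E where "E = (\<Sum>i<N. \<Sum>j<N. norm (c i) * norm (d j))"
  have "norm (g X * h X - (\<Sum>k<N. (\<Sum>i\<le>k. c i * d (k - i)) / X ^ k)) \<le> (K * B + A * L + E) / norm X ^ N"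
    if X: "X \<in> V" "norm X \<ge> 1" for X
  proof -
    define s where "s = (\<Sum>m<N. c m / X ^ m)"
    define t where "t = (\<Sum>m<N. d m / X ^ m)"
    define e where "e = (\<Sum>k<N. (\<Sum>i\<le>k. c i * d (k - i)) / X ^ k)"
    have s: "norm s \<le> A"
      unfolding s_def A_def
    proof (rule sum_norm_le)
      fix m
      have "norm (c m) / norm X ^ m \<le> norm (c m) / 1"
        using one_le_power[OF X(2), of m] by (intro divide_left_mono) auto
      then show "norm (c m / X ^ m) \<le> norm (c m)" by (simp add: norm_divide norm_power)
    qed
    have 1: "norm ((g X - s) * h X) \<le> (K / norm X ^ N) * B"
      unfolding norm_mult using K(2)[OF X] B(2)[OF X] K(1) by (intro mult_mono) (auto simp: s_def)
    have 2: "norm (s * (h X - t)) \<le> A * (L / norm X ^ N)"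
      unfolding norm_mult using s L(2)[OF X] A_def by (intro mult_mono) (auto simp: t_def sum_nonneg)
    have 3: "norm (s * t - e) \<le> E / norm X ^ N"
      unfolding s_def t_def e_def E_def by (rule power_sum_product_tail[OF X(2)])
    have eq: "g X * h X - e = (g X - s) * h X + s * (h X - t) + (s * t - e)"
      by (simp add: algebra_simps)
    have "norm (g X * h X - e) \<le> (K / norm X ^ N) * B + A * (L / norm X ^ N) + E / norm X ^ N"
      unfolding eq by (rule norm_triangle_mono[OF norm_triangle_mono[OF 1 2] 3])
    then show ?thesis by (simp add: e_def add_divide_distrib mult.commute)
  qed
  then show "\<exists>K. \<forall>X\<in>V. norm X \<ge> 1 \<longrightarrow>
      norm (g X * h X - (\<Sum>k<N. (\<Sum>i\<le>k. c i * d (k - i)) / X ^ k)) \<le> K / norm X ^ N"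
    by blast
qed

lemma inv_expansion_shift:
  assumes "inv_expansion V c g" "c 0 = 0"
  shows "inv_expansion V (\<lambda>m. c (Suc m)) (\<lambda>X. X * g X)"
proof (rule inv_expansionI)
  fix N
  obtain K where K: "\<And>X. X \<in> V \<Longrightarrow> norm X \<ge> 1 \<Longrightarrow> norm (g X - (\<Sum>m<Suc N. c m / X ^ m)) \<le> K / norm X ^ Suc N"
    using inv_expansionE[OF assms(1)] by metis
  have "norm (X * g X - (\<Sum>m<N. c (Suc m) / X ^ m)) \<le> K / norm X ^ N"
    if X: "X \<in> V" "norm X \<ge> 1" for X
  proof -
    have nz: "X \<noteq> 0" using X by auto
    have "(\<Sum>m<Suc N. c m / X ^ m) = (\<Sum>m<N. c (Suc m) / X ^ Suc m)"
      unfolding sum.lessThan_Suc_shift using assms(2) by simp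
    then have "X * (g X - (\<Sum>m<Suc N. c m / X ^ m)) = X * g X - (\<Sum>m<N. c (Suc m) / X ^ m)"
      using nz by (simp add: right_diff_distrib sum_distrib_left)
    then have "norm (X * g X - (\<Sum>m<N. c (Suc m) / X ^ m)) = norm X * norm (g X - (\<Sum>m<Suc N. c m / X ^ m))"
      by (metis norm_mult)
    also have "\<dots> \<le> norm X * (K / norm X ^ Suc N)"
      using K[OF X] by (rule mult_left_mono) simp
    also have "\<dots> = K / norm X ^ N" using nz by simp
    finally show ?thesis .
  qed
  then show "\<exists>K. \<forall>X\<in>V. norm X \<ge> 1 \<longrightarrow> norm (X * g X - (\<Sum>m<N. c (Suc m) / X ^ m)) \<le> K / norm X ^ N"
    by blast
qed

lemma inv_expansion_const: "inv_expansion V (\<lambda>m. if m = 0 then k else 0) (\<lambda>X. k)"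
proof (rule inv_expansionI)
  fix N
  have eq: "(\<Sum>m<N. (if m = 0 then k else 0) / X ^ m) = (if N = 0 then 0 else k)" for X :: complex
  proof -
    have "(\<Sum>m<N. (if m = 0 then k else 0) / X ^ m) = (\<Sum>m<N. if m = 0 then k else 0)"
      by (rule sum.cong) auto
    then show ?thesis by (simp add: sum.delta')
  qed
  show "\<exists>K. \<forall>X\<in>V. norm X \<ge> 1 \<longrightarrow> norm (k - (\<Sum>m<N. (if m = 0 then k else 0) / X ^ m)) \<le> K / norm X ^ N"
    unfolding eq by (rule exI[of _ "norm k"]) auto
qed

lemma inner_funD:
  assumes "g \<in> inner_fun V"
  shows "g holomorphic_on V" "\<exists>K. \<forall>X\<in>V. norm (g X) \<le> K" "\<exists>c. c 0 = 0 \<and> inv_expansion V c g"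
  using assms unfolding inner_fun_def bounded_iff by auto

lemma inner_funI:
  assumes "g holomorphic_on V" "\<And>X. X \<in> V \<Longrightarrow> norm (g X) \<le> K" "c 0 = 0" "inv_expansion V c g"
  shows "g \<in> inner_fun V"
  using assms unfolding inner_fun_def bounded_iff by auto

lemma inner_fun_zero: "(\<lambda>X. 0) \<in> inner_fun V"
  by (rule inner_funI[OF holomorphic_on_const _ _ inv_expansion_const[of V 0], where K = 0]) simp_all

lemma inner_fun_cmult:
  assumes "g \<in> inner_fun V" shows "(\<lambda>X. k * g X) \<in> inner_fun V"
proof -
  obtain K c where K: "\<And>X. X \<in> V \<Longrightarrow> norm (g X) \<le> K" "c 0 = 0" "inv_expansion V c g"
    using inner_funD[OF assms] by metis
  show ?thesis
  proof (rule inner_funI)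
    show "(\<lambda>X. k * g X) holomorphic_on V"
      using inner_funD(1)[OF assms] by (intro holomorphic_intros)
    show "norm (k * g X) \<le> norm k * K" if "X \<in> V" for X
      unfolding norm_mult using K(1)[OF that] by (rule mult_left_mono) simp
    show "k * c 0 = 0" using K by simp
    show "inv_expansion V (\<lambda>m. k * c m) (\<lambda>X. k * g X)" by (rule inv_expansion_cmult[OF K(3)])
  qed
qed

lemma inner_fun_add:
  assumes "g \<in> inner_fun V" "h \<in> inner_fun V" shows "(\<lambda>X. g X + h X) \<in> inner_fun V"
proof -
  obtain K c where 1: "\<And>X. X \<in> V \<Longrightarrow> norm (g X) \<le> K" "c 0 = 0" "inv_expansion V c g"
    using inner_funD[OF assms(1)] by metis
  obtain L d where 2: "\<And>X. X \<in> V \<Longrightarrow> norm (h X) \<le> L" "d 0 = 0" "inv_expansion V d h"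
    using inner_funD[OF assms(2)] by metis
  show ?thesis
  proof (rule inner_funI)
    show "(\<lambda>X. g X + h X) holomorphic_on V"
      using inner_funD(1)[OF assms(1)] inner_funD(1)[OF assms(2)] by (rule holomorphic_on_add)
    show "norm (g X + h X) \<le> K + L" if "X \<in> V" for X
      using 1(1)[OF that] 2(1)[OF that] by (rule norm_triangle_mono)
    show "c 0 + d 0 = 0" using 1 2 by simp
    show "inv_expansion V (\<lambda>m. c m + d m) (\<lambda>X. g X + h X)" by (rule inv_expansion_add[OF 1(3) 2(3)])
  qed
qed

lemma inner_fun_mult:
  assumes "g \<in> inner_fun V" "h \<in> inner_fun V" shows "(\<lambda>X. g X * h X) \<in> inner_fun V"
proof -
  obtain K c where 1: "\<And>X. X \<in> V \<Longrightarrow> norm (g X) \<le> K" "c 0 = 0" "inv_expansion V c g"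
    using inner_funD[OF assms(1)] by metis
  obtain L d where 2: "\<And>X. X \<in> V \<Longrightarrow> norm (h X) \<le> L" "d 0 = 0" "inv_expansion V d h"
    using inner_funD[OF assms(2)] by metis
  show ?thesis
  proof (rule inner_funI)
    show "(\<lambda>X. g X * h X) holomorphic_on V"
      using inner_funD(1)[OF assms(1)] inner_funD(1)[OF assms(2)] by (rule holomorphic_on_mult)
    show "norm (g X * h X) \<le> K * L" if "X \<in> V" for X
      unfolding norm_mult using 1(1)[OF that] 2(1)[OF that] order_trans[OF norm_ge_zero 1(1)[OF that]]
      by (rule mult_mono) simp
    show "(\<Sum>i\<le>0. c i * d (0 - i)) = 0" by (simp add: 1(2))
    show "inv_expansion V (\<lambda>k. \<Sum>i\<le>k. c i * d (k - i)) (\<lambda>X. g X * h X)" by (rule inv_expansion_mult[OF 1(3) 2(3)])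
  qed
qed

lemma inner_fun_decay:
  assumes "g \<in> inner_fun V"
  obtains K where "K \<ge> 0" "\<And>X. X \<in> V \<Longrightarrow> norm (g X) \<le> K" "\<And>X. X \<in> V \<Longrightarrow> norm (X * g X) \<le> K"
proof -
  obtain B c where B: "\<And>X. X \<in> V \<Longrightarrow> norm (g X) \<le> B" and c: "c 0 = 0" "inv_expansion V c g"
    using inner_funD[OF assms] by metis
  obtain L where L: "L \<ge> 0" "\<And>X. X \<in> V \<Longrightarrow> norm X \<ge> 1 \<Longrightarrow> norm (g X - (\<Sum>m<1. c m / X ^ m)) \<le> L / norm X ^ 1"
    using inv_expansionE[OF c(2)] by metis
  have "norm (X * g X) \<le> max B L" if X: "X \<in> V" for X
  proof (cases "norm X \<ge> 1")
    case True
    have "norm (g X) \<le> L / norm X" using L(2)[OF X True] c(1) by simp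
    moreover have "norm X > 0" using True by linarith
    ultimately show ?thesis by (simp add: norm_mult pos_le_divide_eq mult.commute)
  next
    case False
    have "norm X * norm (g X) \<le> 1 * B" using False B[OF X]
      by (intro mult_mono) auto
    then show ?thesis by (simp add: norm_mult)
  qed
  moreover have "norm (g X) \<le> max B L" if X: "X \<in> V" for X using B[OF X] by simp
  ultimately show ?thesis using L(1) by (intro that[of "max B L"]) auto
qed

text \<open>The constant k is the coefficient of 1/X, that is, the limit of X g(X) at infinity.\<close>

lemma inner_fun_shift:
  assumes "g \<in> inner_fun V"
  obtains k where "(\<lambda>X. X * g X - k) \<in> inner_fun V"
proof -
  obtain c where c: "c 0 = 0" "inv_expansion V c g" using inner_funD[OF assms] by metis
  obtain K where K: "\<And>X. X \<in> V \<Longrightarrow> norm (X * g X) \<le> K" using inner_fun_decay[OF assms] by metis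
  have inv_expansion: "inv_expansion V (\<lambda>m. c (Suc m) + (if m = 0 then - c 1 else 0)) (\<lambda>X. X * g X + - c 1)"
    by (rule inv_expansion_add[OF inv_expansion_shift[OF c(2,1)] inv_expansion_const])
  have "(\<lambda>X. X * g X + - c 1) \<in> inner_fun V"
  proof (rule inner_funI[OF _ _ _ inv_expansion])
    show "(\<lambda>X. X * g X + - c 1) holomorphic_on V"
      using inner_funD(1)[OF assms] by (intro holomorphic_intros)
    show "norm (X * g X + - c 1) \<le> K + norm (- c 1)" if "X \<in> V" for X
      using K[OF that] order_refl by (rule norm_triangle_mono)
  qed simp
  then show ?thesis by (intro that[of "c 1"]) simp
qed

lemma inner_fun_imp_bounded_asymptotic:
  assumes "g \<in> inner_fun V"
  shows "g \<in> bounded_asymptotic V"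
proof -
  obtain c where c: "c 0 = 0" "inv_expansion V c g" using inner_funD[OF assms] by metis
  have "(\<lambda>X. g X - (\<Sum>m = 1..<N. c m / X ^ m)) \<in> O[inf at_infinity (principal V)](\<lambda>X. 1 / X ^ N)" for N
  proof -
    obtain K where K: "\<And>X. X \<in> V \<Longrightarrow> norm X \<ge> 1 \<Longrightarrow> norm (g X - (\<Sum>m<N. c m / X ^ m)) \<le> K / norm X ^ N"
      using inv_expansionE[OF c(2)] by metis
    have eq: "(\<Sum>m = 1..<N. c m / X ^ m) = (\<Sum>m<N. c m / X ^ m)" for X
      by (rule sum.mono_neutral_left) (auto simp: c(1) not_less_eq_eq Suc_le_eq)
    show ?thesis
    proof (rule bigoI[where c=K])
      have "eventually (\<lambda>X. norm X \<ge> 1) (at_infinity :: complex filter)"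
        by (auto simp: eventually_at_infinity)
      then show "\<forall>\<^sub>F X in inf at_infinity (principal V).
          norm (g X - (\<Sum>m = 1..<N. c m / X ^ m)) \<le> K * norm (1 / X ^ N)"
        unfolding eventually_inf_principal
        by (rule eventually_mono) (use K in \<open>simp add: eq norm_divide norm_power del: One_nat_def\<close>)
    qed
  qed
  then show ?thesis
    using assms unfolding bounded_asymptotic_def inner_fun_def by blast
qed

section \<open>Composite expansions to finite order\<close>

text \<open>An expansion to order N in recursive form: the remainder after the leading term, divided by \<eta>, has an expansion
to order N - 1. Closure properties become inductions on N in which only leading terms are multiplied.\<close>

primrec dac :: "real \<Rightarrow> complex set \<Rightarrow> (complex \<times> complex) set \<Rightarrow> nat \<Rightarrow> (complex \<Rightarrow> complex \<Rightarrow> complex) \<Rightarrow> bool" where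
  "dac r V \<Omega> 0 f \<longleftrightarrow> (\<exists>K. \<forall>x \<eta>. (x, \<eta>) \<in> \<Omega> \<longrightarrow> norm (f x \<eta>) \<le> K)"
| "dac r V \<Omega> (Suc N) f \<longleftrightarrow> (\<exists>a g f1. a holomorphic_on ball 0 r \<and> g \<in> inner_fun V \<and> dac r V \<Omega> N f1 \<and>
      (\<forall>x \<eta>. (x, \<eta>) \<in> \<Omega> \<longrightarrow> f x \<eta> = a x + g (x / \<eta>) + \<eta> * f1 x \<eta>))"

lemma dac_SucI:
  assumes "a holomorphic_on ball 0 r" "g \<in> inner_fun V" "dac r V \<Omega> N f1"
    and "\<And>x \<eta>. (x, \<eta>) \<in> \<Omega> \<Longrightarrow> f x \<eta> = a x + g (x / \<eta>) + \<eta> * f1 x \<eta>"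
  shows "dac r V \<Omega> (Suc N) f"
  unfolding dac.simps using assms by blast

lemma dac_SucE:
  assumes "dac r V \<Omega> (Suc N) f"
  obtains a g f1 where "a holomorphic_on ball 0 r" "g \<in> inner_fun V" "dac r V \<Omega> N f1"
    "\<And>x \<eta>. (x, \<eta>) \<in> \<Omega> \<Longrightarrow> f x \<eta> = a x + g (x / \<eta>) + \<eta> * f1 x \<eta>"
  using assms unfolding dac.simps by blast

lemma dac_0I: "(\<And>x \<eta>. (x, \<eta>) \<in> \<Omega> \<Longrightarrow> norm (f x \<eta>) \<le> K) \<Longrightarrow> dac r V \<Omega> 0 f"
  by auto

lemma dac_cong:
  assumes "dac r V \<Omega> N f" "\<And>x \<eta>. (x, \<eta>) \<in> \<Omega> \<Longrightarrow> f' x \<eta> = f x \<eta>"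
  shows "dac r V \<Omega> N f'"
proof (cases N)
  case 0
  then show ?thesis using assms by auto
next
  case (Suc M)
  obtain a g f1 where "a holomorphic_on ball 0 r" "g \<in> inner_fun V" "dac r V \<Omega> M f1"
    "\<And>x \<eta>. (x, \<eta>) \<in> \<Omega> \<Longrightarrow> f x \<eta> = a x + g (x / \<eta>) + \<eta> * f1 x \<eta>"
    using dac_SucE[OF assms(1)[unfolded Suc]] by metis
  then show ?thesis unfolding Suc using assms(2) by (intro dac_SucI) auto
qed

lemma dac_subset: "dac r V \<Omega> N f \<Longrightarrow> \<Omega>' \<subseteq> \<Omega> \<Longrightarrow> dac r V \<Omega>' N f"
proof (induction N arbitrary: f)
  case 0
  then show ?case unfolding dac.simps by blast
next
  case (Suc N)
  obtain a g f1 where 1: "a holomorphic_on ball 0 r" "g \<in> inner_fun V" "dac r V \<Omega> N f1"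
    "\<And>x \<eta>. (x, \<eta>) \<in> \<Omega> \<Longrightarrow> f x \<eta> = a x + g (x / \<eta>) + \<eta> * f1 x \<eta>"
    using dac_SucE[OF Suc.prems(1)] by metis
  show ?case
    by (rule dac_SucI[OF 1(1,2) Suc.IH[OF 1(3) Suc.prems(2)]]) (use 1(4) Suc.prems(2) in auto)
qed

lemma dac_add: "dac r V \<Omega> N f \<Longrightarrow> dac r V \<Omega> N f' \<Longrightarrow> dac r V \<Omega> N (\<lambda>x \<eta>. f x \<eta> + f' x \<eta>)"
proof (induction N arbitrary: f f')
  case 0
  then obtain K K' where "\<And>x \<eta>. (x, \<eta>) \<in> \<Omega> \<Longrightarrow> norm (f x \<eta>) \<le> K" "\<And>x \<eta>. (x, \<eta>) \<in> \<Omega> \<Longrightarrow> norm (f' x \<eta>) \<le> K'"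
    by auto
  then show ?case by (intro dac_0I[where K="K + K'"] norm_triangle_mono) auto
next
  case (Suc N)
  obtain a g f1 where 1: "a holomorphic_on ball 0 r" "g \<in> inner_fun V" "dac r V \<Omega> N f1"
    "\<And>x \<eta>. (x, \<eta>) \<in> \<Omega> \<Longrightarrow> f x \<eta> = a x + g (x / \<eta>) + \<eta> * f1 x \<eta>"
    using dac_SucE[OF Suc.prems(1)] by metis
  obtain a' g' f1' where 2: "a' holomorphic_on ball 0 r" "g' \<in> inner_fun V" "dac r V \<Omega> N f1'"
    "\<And>x \<eta>. (x, \<eta>) \<in> \<Omega> \<Longrightarrow> f' x \<eta> = a' x + g' (x / \<eta>) + \<eta> * f1' x \<eta>"
    using dac_SucE[OF Suc.prems(2)] by metis
  show ?case
    by (rule dac_SucI[OF holomorphic_on_add[OF 1(1) 2(1)] inner_fun_add[OF 1(2) 2(2)] Suc.IH[OF 1(3) 2(3)]])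
       (simp add: 1(4) 2(4) algebra_simps)
qed

lemma dac_eta: "dac r V \<Omega> N f \<Longrightarrow> dac r V \<Omega> (Suc N) (\<lambda>x \<eta>. \<eta> * f x \<eta>)"
  by (rule dac_SucI[OF holomorphic_on_const[of 0] inner_fun_zero]) auto

lemma holomorphic_factor:
  assumes "a holomorphic_on ball 0 r"
  obtains b where "b holomorphic_on ball 0 r" "\<And>x. (a x :: complex) = a 0 + x * b x"
proof
  show "(\<lambda>z. if z = 0 then deriv a 0 else (a z - a 0) / (z - 0)) holomorphic_on ball 0 r"
    using assms by (rule pole_lemma_open) simp
qed auto

text \<open>The radius R < r keeps x away from the boundary of the disc on which the outer coefficients are holomorphic, so they are bounded.\<close>

locale dac_domain =
  fixes r R :: real and V :: "complex set" and \<Omega> :: "(complex \<times> complex) set"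
  assumes Rr: "R < r"
    and dom: "\<And>x \<eta>. (x, \<eta>) \<in> \<Omega> \<Longrightarrow> norm x \<le> R \<and> x / \<eta> \<in> V \<and> \<eta> \<noteq> 0 \<and> norm \<eta> \<le> 1"
begin

lemma outer_bounded:
  assumes "a holomorphic_on ball 0 r"
  obtains K where "K \<ge> 0" "\<And>x \<eta>. (x, \<eta>) \<in> \<Omega> \<Longrightarrow> norm (a x) \<le> K"
proof -
  have "compact (a ` cball 0 R)"
    using Rr by (intro compact_continuous_image holomorphic_on_imp_continuous_on holomorphic_on_subset[OF assms]) auto
  then obtain K where "\<forall>y\<in>a ` cball 0 R. norm y \<le> K"
    using compact_imp_bounded bounded_iff by metis
  then show ?thesis using dom by (intro that[of "max K 0"]) (auto simp: le_max_iff_disj)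
qed

lemma inner_bounded:
  assumes "g \<in> inner_fun V"
  obtains K where "K \<ge> 0" "\<And>x \<eta>. (x, \<eta>) \<in> \<Omega> \<Longrightarrow> norm (g (x / \<eta>)) \<le> K"
  using inner_fun_decay[OF assms] dom by metis

lemma dac_bounded_iff: "dac r V \<Omega> 0 f \<longleftrightarrow> (\<exists>K\<ge>0. \<forall>x \<eta>. (x, \<eta>) \<in> \<Omega> \<longrightarrow> norm (f x \<eta>) \<le> K)"
proof
  assume "dac r V \<Omega> 0 f"
  then obtain K where "\<And>x \<eta>. (x, \<eta>) \<in> \<Omega> \<Longrightarrow> norm (f x \<eta>) \<le> K" by auto
  then have "\<forall>x \<eta>. (x, \<eta>) \<in> \<Omega> \<longrightarrow> norm (f x \<eta>) \<le> max K 0" by (simp add: le_max_iff_disj)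
  then show "\<exists>K\<ge>0. \<forall>x \<eta>. (x, \<eta>) \<in> \<Omega> \<longrightarrow> norm (f x \<eta>) \<le> K"
    by (metis max.cobounded2)
qed auto

lemma dac_mult_0:
  assumes "dac r V \<Omega> 0 f" "dac r V \<Omega> 0 f'"
  shows "dac r V \<Omega> 0 (\<lambda>x \<eta>. f x \<eta> * f' x \<eta>)"
proof -
  obtain K where K: "K \<ge> 0" "\<And>x \<eta>. (x, \<eta>) \<in> \<Omega> \<Longrightarrow> norm (f x \<eta>) \<le> K"
    using assms(1) unfolding dac_bounded_iff by blast
  obtain L where L: "L \<ge> 0" "\<And>x \<eta>. (x, \<eta>) \<in> \<Omega> \<Longrightarrow> norm (f' x \<eta>) \<le> L"
    using assms(2) unfolding dac_bounded_iff by blast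
  show ?thesis
    by (rule dac_0I[where K="K * L"]) (simp add: norm_mult mult_mono K L)
qed

lemma dac_outer: "a holomorphic_on ball 0 r \<Longrightarrow> dac r V \<Omega> N (\<lambda>x \<eta>. a x)"
proof (induction N arbitrary: a)
  case 0
  then show ?case using outer_bounded[of a] by (metis dac_0I)
next
  case (Suc N)
  show ?case
    by (rule dac_SucI[OF Suc.prems inner_fun_zero Suc.IH[OF holomorphic_on_const[of 0]]]) simp
qed

lemma dac_inner: "g \<in> inner_fun V \<Longrightarrow> dac r V \<Omega> N (\<lambda>x \<eta>. g (x / \<eta>))"
proof (induction N)
  case 0
  then show ?case using inner_bounded[of g] by (metis dac_0I)
next
  case (Suc N)
  show ?case
    by (rule dac_SucI[OF holomorphic_on_const[of 0] Suc.prems dac_outer[OF holomorphic_on_const[of 0]]]) simp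
qed

lemma dac_Suc_imp: "dac r V \<Omega> (Suc N) f \<Longrightarrow> dac r V \<Omega> N f"
proof (induction N arbitrary: f)
  case 0
  obtain a g f1 where 1: "a holomorphic_on ball 0 r" "g \<in> inner_fun V" "dac r V \<Omega> 0 f1"
    "\<And>x \<eta>. (x, \<eta>) \<in> \<Omega> \<Longrightarrow> f x \<eta> = a x + g (x / \<eta>) + \<eta> * f1 x \<eta>"
    using dac_SucE[OF 0] by metis
  have "dac r V \<Omega> 0 (\<lambda>x \<eta>. \<eta> * f1 x \<eta>)"
    by (rule dac_mult_0[OF _ 1(3)]) (use dom in \<open>auto intro!: exI[of _ 1]\<close>)
  then have "dac r V \<Omega> 0 (\<lambda>x \<eta>. a x + g (x / \<eta>) + \<eta> * f1 x \<eta>)"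
    by (intro dac_add dac_outer dac_inner 1)
  then show ?case by (rule dac_cong) (rule 1(4))
next
  case (Suc N)
  obtain a g f1 where 1: "a holomorphic_on ball 0 r" "g \<in> inner_fun V" "dac r V \<Omega> (Suc N) f1"
    "\<And>x \<eta>. (x, \<eta>) \<in> \<Omega> \<Longrightarrow> f x \<eta> = a x + g (x / \<eta>) + \<eta> * f1 x \<eta>"
    using dac_SucE[OF Suc.prems] by metis
  show ?case by (rule dac_SucI[OF 1(1,2) Suc.IH[OF 1(3)] 1(4)])
qed

lemma dac_le: "dac r V \<Omega> N f \<Longrightarrow> M \<le> N \<Longrightarrow> dac r V \<Omega> M f"
  by (induction N) (auto simp: le_Suc_eq simp del: dac.simps intro: dac_Suc_imp)

lemma dac_eta': "dac r V \<Omega> N f \<Longrightarrow> dac r V \<Omega> N (\<lambda>x \<eta>. \<eta> * f x \<eta>)"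
  by (rule dac_Suc_imp[OF dac_eta])

lemma dac_eta_power: "dac r V \<Omega> N f \<Longrightarrow> dac r V \<Omega> N (\<lambda>x \<eta>. \<eta> ^ k * f x \<eta>)"
proof (induction k)
  case (Suc k)
  then show ?case using dac_eta'[OF Suc.IH[OF Suc.prems]] by (simp add: mult.assoc)
qed simp

lemma dac_of_bound: "(\<And>x \<eta>. (x, \<eta>) \<in> \<Omega> \<Longrightarrow> norm (f x \<eta>) \<le> K * norm \<eta> ^ N) \<Longrightarrow> dac r V \<Omega> N f"
proof (induction N arbitrary: f)
  case 0
  then show ?case by (intro dac_0I[where K=K]) auto
next
  case (Suc N)
  have "dac r V \<Omega> N (\<lambda>x \<eta>. f x \<eta> / \<eta>)"
  proof (rule Suc.IH)
    fix x \<eta> assume x: "(x, \<eta>) \<in> \<Omega>"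
    then have "\<eta> \<noteq> 0" using dom by blast
    then show "norm (f x \<eta> / \<eta>) \<le> K * norm \<eta> ^ N"
      using Suc.prems[OF x] by (simp add: norm_divide pos_divide_le_eq mult_ac)
  qed
  then show ?case
    by (rule dac_SucI[OF holomorphic_on_const[of 0] inner_fun_zero]) (use dom in auto)
qed

lemma dac_sum: "finite J \<Longrightarrow> (\<And>j. j \<in> J \<Longrightarrow> dac r V \<Omega> N (f j)) \<Longrightarrow> dac r V \<Omega> N (\<lambda>x \<eta>. \<Sum>j\<in>J. f j x \<eta>)"
proof (induction J rule: finite_induct)
  case empty
  then show ?case using dac_outer[OF holomorphic_on_const[of 0]] by simp
next
  case (insert j J)
  then show ?case using dac_add[of r V \<Omega> N "f j"] by simp
qed

text \<open>With a(x) = a(0) + x b(x) and X = x/\<eta>, the product is a(0) g(X) + \<eta> b(x) X g(X). As X g(X) = k + (X g(X) - k) with X g(X) - k in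
the inner class, the second term is of the same kind, with a factor \<eta>.\<close>

lemma dac_outer_inner:
  "a holomorphic_on ball 0 r \<Longrightarrow> g \<in> inner_fun V \<Longrightarrow> dac r V \<Omega> N (\<lambda>x \<eta>. a x * g (x / \<eta>))"
proof (induction N arbitrary: a g)
  case 0
  show ?case by (rule dac_mult_0[OF dac_outer[OF 0(1)] dac_inner[OF 0(2)]])
next
  case (Suc N)
  obtain b where b: "b holomorphic_on ball 0 r" "\<And>x. a x = a 0 + x * b x"
    using holomorphic_factor[OF Suc.prems(1)] by metis
  obtain k where k: "(\<lambda>X. X * g X - k) \<in> inner_fun V"
    using inner_fun_shift[OF Suc.prems(2)] by metis
  have "dac r V \<Omega> N (\<lambda>x \<eta>. k * b x + b x * (x / \<eta> * g (x / \<eta>) - k))"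
    using Suc.IH[OF b(1) k] by (intro dac_add dac_outer holomorphic_intros b) auto
  then show ?case
  proof (rule dac_SucI[OF holomorphic_on_const[of 0] inner_fun_cmult[OF Suc.prems(2)]])
    fix x \<eta> assume "(x, \<eta>) \<in> \<Omega>"
    then have "\<eta> \<noteq> 0" using dom by blast
    have "a x * g (x / \<eta>) = a 0 * g (x / \<eta>) + x * b x * g (x / \<eta>)"
      by (subst b(2)) (simp add: algebra_simps)
    then show "a x * g (x / \<eta>) = 0 + a 0 * g (x / \<eta>) + \<eta> * (k * b x + b x * (x / \<eta> * g (x / \<eta>) - k))"
      using \<open>\<eta> \<noteq> 0\<close> by (simp add: field_simps)
  qed
qed

lemma dac_mult: "dac r V \<Omega> N f \<Longrightarrow> dac r V \<Omega> N f' \<Longrightarrow> dac r V \<Omega> N (\<lambda>x \<eta>. f x \<eta> * f' x \<eta>)"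
proof (induction N arbitrary: f f')
  case 0
  then show ?case by (rule dac_mult_0)
next
  case (Suc N)
  obtain a g f1 where 1: "a holomorphic_on ball 0 r" "g \<in> inner_fun V" "dac r V \<Omega> N f1"
    "\<And>x \<eta>. (x, \<eta>) \<in> \<Omega> \<Longrightarrow> f x \<eta> = a x + g (x / \<eta>) + \<eta> * f1 x \<eta>"
    using dac_SucE[OF Suc.prems(1)] by metis
  obtain a' g' f1' where 2: "a' holomorphic_on ball 0 r" "g' \<in> inner_fun V" "dac r V \<Omega> N f1'"
    "\<And>x \<eta>. (x, \<eta>) \<in> \<Omega> \<Longrightarrow> f' x \<eta> = a' x + g' (x / \<eta>) + \<eta> * f1' x \<eta>"
    using dac_SucE[OF Suc.prems(2)] by metis
  have m: "dac r V \<Omega> (Suc N) (\<lambda>x \<eta>. a x * a' x)" "dac r V \<Omega> (Suc N) (\<lambda>x \<eta>. g (x / \<eta>) * g' (x / \<eta>))"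
     "dac r V \<Omega> (Suc N) (\<lambda>x \<eta>. a x * g' (x / \<eta>))" "dac r V \<Omega> (Suc N) (\<lambda>x \<eta>. a' x * g (x / \<eta>))"
    using 1 2 by (auto simp del: dac.simps intro!: dac_outer dac_outer_inner holomorphic_on_mult
        dac_inner[where g="\<lambda>X. g X * g' X"] inner_fun_mult)
  have ag: "dac r V \<Omega> N (\<lambda>x \<eta>. a x + g (x / \<eta>))" "dac r V \<Omega> N (\<lambda>x \<eta>. a' x + g' (x / \<eta>))"
    by (intro dac_add dac_outer dac_inner 1 2)+
  have "dac r V \<Omega> N (\<lambda>x \<eta>. (a x + g (x / \<eta>)) * f1' x \<eta> + f1 x \<eta> * (a' x + g' (x / \<eta>)) + \<eta> * (f1 x \<eta> * f1' x \<eta>))"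
    by (intro dac_add dac_eta' Suc.IH ag 1 2)
  from dac_add[OF dac_add[OF dac_add[OF m(1,2)] dac_add[OF m(3,4)]] dac_eta[OF this]]
  show ?case by (rule dac_cong) (simp add: 1(4) 2(4) algebra_simps)
qed

end

section \<open>Composition and uniqueness\<close>

text \<open>Bounded and separately holomorphic coefficients of the nonlinearity; this class is stable under difference quotients in y.\<close>

definition sep_hol :: "real \<Rightarrow> real \<Rightarrow> (complex \<Rightarrow> complex \<Rightarrow> complex) \<Rightarrow> bool" where
  "sep_hol r \<rho> c \<longleftrightarrow> (\<exists>B. \<forall>x\<in>ball 0 r. \<forall>y\<in>ball 0 \<rho>. norm (c x y) \<le> B) \<and>
     (\<forall>y\<in>ball 0 \<rho>. (\<lambda>x. c x y) holomorphic_on ball 0 r) \<and> (\<forall>x\<in>ball 0 r. c x holomorphic_on ball 0 \<rho>)"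

definition diff_quot :: "(complex \<Rightarrow> complex) \<Rightarrow> complex \<Rightarrow> complex" where
  "diff_quot h y = (if y = 0 then deriv h 0 else (h y - h 0) / y)"

lemma diff_quot_eq: "h y = h 0 + y * diff_quot h y"
  by (simp add: diff_quot_def)

lemma diff_quot_holomorphic: "h holomorphic_on ball 0 \<rho> \<Longrightarrow> diff_quot h holomorphic_on ball 0 \<rho>"
  using pole_lemma_open[of h "ball 0 \<rho>" 0] unfolding diff_quot_def[abs_def] by (simp cong: if_cong)

text \<open>Schwarz's lemma for h(\<rho> z) - h(0), divided by a strict bound of its modulus.\<close>

lemma diff_quot_bound:
  assumes h: "h holomorphic_on ball 0 \<rho>" and \<rho>: "\<rho> > 0" and B: "\<And>y. y \<in> ball 0 \<rho> \<Longrightarrow> norm (h y) \<le> B"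
    and y: "y \<in> ball 0 \<rho>"
  shows "norm (diff_quot h y) \<le> (2 * B + 1) / \<rho>"
proof -
  have B0: "B \<ge> 0" using order_trans[OF norm_ge_zero B[of 0]] \<rho> by simp
  define f where "f = (\<lambda>z. (h (of_real \<rho> * z) - h 0) / of_real (2 * B + 1))"
  have in_ball: "of_real \<rho> * z \<in> ball 0 \<rho>" if "norm z < 1" for z :: complex
    using that \<rho> by (simp add: norm_mult)
  have hol: "f holomorphic_on ball 0 1"
  proof -
    have "(\<lambda>z. h (of_real \<rho> * z)) holomorphic_on ball 0 1"
      by (rule holomorphic_on_compose_gen[OF _ h, unfolded o_def])
         (use in_ball in \<open>auto intro!: holomorphic_intros\<close>)
    moreover have "complex_of_real (2 * B + 1) \<noteq> 0"
      using B0 by (metis add_nonneg_eq_0_iff mult_nonneg_nonneg of_real_eq_0_iff zero_le_numeral zero_le_one zero_neq_one)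
    ultimately show ?thesis unfolding f_def by (intro holomorphic_intros) auto
  qed
  have no: "norm (f z) < 1" if "norm z < 1" for z
  proof -
    have "norm (h (of_real \<rho> * z) - h 0) \<le> B + B"
      using B[OF in_ball[OF that]] B[of 0] \<rho> by (intro order_trans[OF norm_triangle_ineq4] add_mono) auto
    then have "norm (h (of_real \<rho> * z) - h 0) / (2 * B + 1) < 1" using B0 by (simp add: pos_divide_less_eq)
    moreover have "norm (complex_of_real (2 * B + 1)) = 2 * B + 1" unfolding norm_of_real using B0 by simp
    ultimately show ?thesis by (simp only: f_def norm_divide)
  qed
  have ne0: "norm (diff_quot h y) \<le> (2 * B + 1) / \<rho>" if "y \<in> ball 0 \<rho>" "y \<noteq> 0" for y
  proof -
    have y1: "norm (y / of_real \<rho>) < 1" using that \<rho> by (simp add: norm_divide)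
    have "norm (f (y / of_real \<rho>)) \<le> norm (y / of_real \<rho>)"
      by (rule Schwarz_Lemma(1)[OF hol _ no y1]) (simp_all add: f_def)
    then have "norm (h y - h 0) / (2 * B + 1) \<le> norm y / \<rho>"
      using \<rho> B0 unfolding f_def norm_divide norm_of_real by simp
    then have "norm (h y - h 0) \<le> norm y / \<rho> * (2 * B + 1)"
      using B0 by (subst (asm) pos_divide_le_eq) auto
    then show ?thesis using that(2) \<rho> by (simp add: diff_quot_def norm_divide field_simps)
  qed
  show ?thesis
  proof (cases "y = 0")
    case True
    have "continuous_on (ball 0 \<rho>) (diff_quot h)"
      by (rule holomorphic_on_imp_continuous_on[OF diff_quot_holomorphic[OF h]])
    then have "isCont (diff_quot h) 0" using \<rho> by (simp add: continuous_on_eq_continuous_at)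
    then have "((\<lambda>y. norm (diff_quot h y)) \<longlongrightarrow> norm (diff_quot h 0)) (at 0)"
      by (intro tendsto_norm) (simp add: isCont_def)
    moreover have "\<forall>\<^sub>F y in at 0. norm (diff_quot h y) \<le> (2 * B + 1) / \<rho>"
      unfolding eventually_at using ne0 \<rho> by (intro exI[of _ \<rho>]) auto
    ultimately show ?thesis unfolding True by (rule tendsto_upperbound) simp
  next
    case False
    then show ?thesis using ne0 y by blast
  qed
qed

lemma sep_hol_diff_quot:
  assumes c: "sep_hol r \<rho> c" and \<rho>: "\<rho> > 0"
  shows "sep_hol r \<rho> (\<lambda>x. diff_quot (c x))"
proof -
  obtain B where B: "\<And>x y. x \<in> ball 0 r \<Longrightarrow> y \<in> ball 0 \<rho> \<Longrightarrow> norm (c x y) \<le> B"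
    using c unfolding sep_hol_def by blast
  have cx: "c x holomorphic_on ball 0 \<rho>" if "x \<in> ball 0 r" for x using c that unfolding sep_hol_def by blast
  have cy: "(\<lambda>x. c x y) holomorphic_on ball 0 r" if "y \<in> ball 0 \<rho>" for y using c that unfolding sep_hol_def by blast
  define q where "q = (\<lambda>x. diff_quot (c x))"
  have q: "q x holomorphic_on ball 0 \<rho>" if "x \<in> ball 0 r" for x
    unfolding q_def by (rule diff_quot_holomorphic[OF cx[OF that]])
  have qB: "norm (q x y) \<le> (2 * B + 1) / \<rho>" if "x \<in> ball 0 r" "y \<in> ball 0 \<rho>" for x y
    unfolding q_def by (rule diff_quot_bound[OF cx[OF that(1)] \<rho> B[OF that(1)] that(2)])
  have hol_ne: "(\<lambda>x. q x y) holomorphic_on ball 0 r" if "y \<in> ball 0 \<rho>" "y \<noteq> 0" for y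
  proof -
    have "(\<lambda>x. (c x y - c x 0) / y) holomorphic_on ball 0 r"
      using cy[OF that(1)] cy[of 0] \<rho> that by (intro holomorphic_intros) auto
    then show ?thesis using that(2) by (simp add: q_def diff_quot_def)
  qed
  \<comment> \<open>The value at 0 is a derivative in y; it is a uniform limit of difference quotients.\<close>
  have hol_0: "(\<lambda>x. q x 0) holomorphic_on ball 0 r"
  proof (rule holomorphic_uniform_sequence[of _ "\<lambda>n x. q x (of_real (\<rho> / (real n + 2)))"])
    fix n
    have "norm (complex_of_real (\<rho> / (real n + 2))) < \<rho>" unfolding norm_of_real
      using \<rho> by (simp add: pos_divide_less_eq)
    then show "(\<lambda>x. q x (of_real (\<rho> / (real n + 2)))) holomorphic_on ball 0 r"
      using \<rho> of_nat_eq_0_iff[of "n + 2", where 'a = complex] by (intro hol_ne) (auto simp: add.commute)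
  next
    fix x :: complex assume "x \<in> ball 0 r"
    then obtain d where d: "d > 0" "cball x d \<subseteq> ball 0 r"
      by (meson open_ball open_contains_cball)
    define K where "K = (2 * ((2 * B + 1) / \<rho>) + 1) / \<rho>"
    have "uniform_limit (ball 0 r) (\<lambda>n x. q x (of_real (\<rho> / (real n + 2)))) (\<lambda>x. q x 0) sequentially"
    proof (rule uniform_limitI)
      fix e :: real assume e: "e > 0"
      have "(\<lambda>n. \<rho> / (real n + 2) * K) \<longlonglongrightarrow> 0" by real_asymp
      then have "\<forall>\<^sub>F n in sequentially. \<rho> / (real n + 2) * K < e"
        using e by (rule order_tendstoD)
      then show "\<forall>\<^sub>F n in sequentially. \<forall>x\<in>ball 0 r. dist (q x (of_real (\<rho> / (real n + 2)))) (q x 0) < e"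
      proof (rule eventually_mono, intro ballI)
        fix n :: nat and x :: complex assume n: "\<rho> / (real n + 2) * K < e" and x: "x \<in> ball 0 r"
        define y where "y = complex_of_real (\<rho> / (real n + 2))"
        have ny: "norm y = \<rho> / (real n + 2)" unfolding y_def norm_of_real using \<rho> by simp
        then have y: "y \<in> ball 0 \<rho>" using \<rho> by (simp add: pos_divide_less_eq)
        have "dist (q x y) (q x 0) = norm y * norm (diff_quot (q x) y)"
          unfolding dist_norm by (subst diff_quot_eq) (simp add: norm_mult)
        also have "\<dots> \<le> norm y * K"
          unfolding K_def by (intro mult_left_mono diff_quot_bound[OF q[OF x] \<rho> qB[OF x] y]) auto
        finally have le: "dist (q x y) (q x 0) \<le> norm y * K" .
        from le_less_trans[OF le[unfolded ny] n]
        show "dist (q x (of_real (\<rho> / (real n + 2)))) (q x 0) < e" unfolding y_def .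
      qed
    qed
    then show "\<exists>d>0. cball x d \<subseteq> ball 0 r \<and>
        uniform_limit (cball x d) (\<lambda>n x. q x (of_real (\<rho> / (real n + 2)))) (\<lambda>x. q x 0) sequentially"
      using d uniform_limit_on_subset by blast
  qed simp
  have "(\<lambda>x. q x y) holomorphic_on ball 0 r" if "y \<in> ball 0 \<rho>" for y
    using hol_0 hol_ne[OF that] by (cases "y = 0") auto
  then show ?thesis
    using q qB unfolding sep_hol_def q_def by blast
qed

context dac_domain
begin

text \<open>From c(x, y) = c(x, 0) + y q(x, y) with y = \<eta> y1 the order rises by one: the difference quotient q(x, y) has to be expanded to
one order less only.\<close>

lemma dac_compose:
  assumes \<rho>: "\<rho> > 0" and r: "r > 0" and small: "\<And>x \<eta>. (x, \<eta>) \<in> \<Omega> \<Longrightarrow> norm (\<eta> * y1 x \<eta>) < \<rho>"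
  shows "dac r V \<Omega> N y1 \<Longrightarrow> sep_hol r \<rho> c \<Longrightarrow> dac r V \<Omega> (Suc N) (\<lambda>x \<eta>. c x (\<eta> * y1 x \<eta>))"
proof (induction N arbitrary: c)
  case (0 c)
  have q: "sep_hol r \<rho> (\<lambda>x. diff_quot (c x))" by (rule sep_hol_diff_quot[OF 0(2) \<rho>])
  have c0: "(\<lambda>x. c x 0) holomorphic_on ball 0 r" using 0(2) \<rho> unfolding sep_hol_def by auto
  obtain B where B: "\<And>x y. x \<in> ball 0 r \<Longrightarrow> y \<in> ball 0 \<rho> \<Longrightarrow> norm (diff_quot (c x) y) \<le> B"
    using q unfolding sep_hol_def by blast
  have "dac r V \<Omega> 0 (\<lambda>x \<eta>. diff_quot (c x) (\<eta> * y1 x \<eta>))"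
    by (rule dac_0I[where K=B]) (use small dom Rr in \<open>force intro!: B\<close>)
  from dac_mult[OF 0(1) this] show ?case
    by (rule dac_SucI[OF c0 inner_fun_zero]) (subst diff_quot_eq, simp add: mult.assoc)
next
  case (Suc N c)
  have q: "sep_hol r \<rho> (\<lambda>x. diff_quot (c x))" by (rule sep_hol_diff_quot[OF Suc(3) \<rho>])
  have c0: "(\<lambda>x. c x 0) holomorphic_on ball 0 r" using Suc(3) \<rho> unfolding sep_hol_def by auto
  from dac_mult[OF Suc(2) Suc.IH[OF dac_Suc_imp[OF Suc(2)] q]] show ?case
    by (rule dac_SucI[OF c0 inner_fun_zero]) (subst diff_quot_eq, simp add: mult.assoc)
qed

end

lemma le_zero_if_le_scale:
  fixes x C :: real
  assumes "\<And>s. 0 < s \<Longrightarrow> s \<le> 1 \<Longrightarrow> x \<le> s * C"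
  shows "x \<le> 0"
proof (rule ccontr)
  assume "\<not> x \<le> 0"
  then have x: "x > 0" by simp
  have "x \<le> C" using assms[of 1] by simp
  then have "x \<le> x / (2 * C) * C" using x by (intro assms) (auto simp: field_simps)
  then show False using x \<open>x \<le> C\<close> by simp
qed

text \<open>Multiplying x and \<eta> by the same s leaves x/\<eta> fixed; keeping x > 0 fixed while \<eta> tends to 0 makes x/\<eta> infinite. The two limits
separate the inner from the outer coefficient.\<close>

locale dac_scaling = dac_domain +
  fixes \<eta>0 :: complex and t0 :: real
  assumes scale: "\<And>x \<eta> s. (x, \<eta>) \<in> \<Omega> \<Longrightarrow> 0 < s \<Longrightarrow> s \<le> 1 \<Longrightarrow> (of_real s * x, of_real s * \<eta>) \<in> \<Omega>"
    and t0: "t0 > 0" "t0 \<le> r"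
    and ray: "\<And>t s. 0 < t \<Longrightarrow> t < t0 \<Longrightarrow> 0 < s \<Longrightarrow> s \<le> 1 \<Longrightarrow> (of_real t, of_real s * \<eta>0) \<in> \<Omega>"
begin

text \<open>For fixed x > 0 and \<eta> tending to 0, both g(x/\<eta>) and the remainder vanish, so a is 0 on an interval and hence everywhere; scaling
x and \<eta> together then leaves g(x/\<eta>) alone.\<close>

lemma dac_head_zero:
  assumes a: "a holomorphic_on ball 0 r" and g: "g \<in> inner_fun V" and K: "\<And>x \<eta>. (x, \<eta>) \<in> \<Omega> \<Longrightarrow> norm (f1 x \<eta>) \<le> K"
    and eq: "\<And>x \<eta>. (x, \<eta>) \<in> \<Omega> \<Longrightarrow> a x + g (x / \<eta>) + \<eta> * f1 x \<eta> = 0"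
  shows "x \<in> ball 0 r \<Longrightarrow> a x = 0" and "(x, \<eta>) \<in> \<Omega> \<Longrightarrow> g (x / \<eta>) = 0"
proof -
  obtain L where L: "L \<ge> 0" "\<And>X. X \<in> V \<Longrightarrow> norm (X * g X) \<le> L" using inner_fun_decay[OF g] by metis
  have at: "a (of_real t) = 0" if t: "0 < t" "t < t0" for t
  proof -
    have "norm (a (of_real t)) \<le> s * (norm \<eta>0 * (L / t + K))" if s: "0 < s" "s \<le> 1" for s
    proof -
      let ?\<eta> = "of_real s * \<eta>0"
      have "(of_real t, ?\<eta>) \<in> \<Omega>" by (rule ray[OF t s])
      note O = this dom[OF this]
      have "norm (complex_of_real t / ?\<eta> * g (of_real t / ?\<eta>)) \<le> L" using O by (intro L) auto
      then have 1: "norm (g (of_real t / ?\<eta>)) \<le> L * norm ?\<eta> / t"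
        using O t by (simp add: norm_mult norm_divide field_simps)
      have "a (of_real t) = - (g (of_real t / ?\<eta>) + ?\<eta> * f1 (of_real t) ?\<eta>)"
        using eq[OF O(1)] unfolding eq_neg_iff_add_eq_0 by (simp only: add.assoc)
      then have "norm (a (of_real t)) \<le> norm (g (of_real t / ?\<eta>)) + norm (?\<eta> * f1 (of_real t) ?\<eta>)"
        by (metis norm_minus_cancel norm_triangle_ineq)
      also have "\<dots> \<le> L * norm ?\<eta> / t + norm ?\<eta> * K"
        unfolding norm_mult[of ?\<eta>] by (intro add_mono 1 mult_left_mono K O) auto
      also have "\<dots> = s * (norm \<eta>0 * (L / t + K))"
        using s by (simp add: norm_mult algebra_simps)
      finally show ?thesis .
    qed
    then have "norm (a (of_real t)) \<le> 0" by (rule le_zero_if_le_scale)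
    then show ?thesis by simp
  qed
  have a0: "a x = 0" if "x \<in> ball 0 r" for x
  proof (rule analytic_continuation[OF a, of "of_real ` {0<..<t0}" 0])
    show "of_real ` {0<..<t0} \<subseteq> ball (0::complex) r" using t0 by auto
    show "(0::complex) islimpt of_real ` {0<..<t0}"
      unfolding islimpt_approachable
    proof (intro allI impI)
      fix e :: real assume "e > 0"
      then have "min e t0 / 2 > 0" "min e t0 / 2 < t0" "min e t0 / 2 < e" using t0 by auto
      then show "\<exists>x'\<in>of_real ` {0<..<t0}. x' \<noteq> (0::complex) \<and> dist x' 0 < e"
        by (intro bexI[of _ "of_real (min e t0 / 2)"]) (auto simp del: of_real_divide)
    qed
  qed (use at t0 that in auto)
  then show "x \<in> ball 0 r \<Longrightarrow> a x = 0" .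
  show "g (x / \<eta>) = 0" if x: "(x, \<eta>) \<in> \<Omega>" for x \<eta>
  proof -
    have "norm (g (x / \<eta>)) \<le> s * (norm \<eta> * K)" if s: "0 < s" "s \<le> 1" for s
    proof -
      have O: "(of_real s * x, of_real s * \<eta>) \<in> \<Omega>" by (rule scale[OF x s])
      have "of_real s * x \<in> ball 0 r" using dom[OF O] Rr by auto
      then have "g (x / \<eta>) + of_real s * \<eta> * f1 (of_real s * x) (of_real s * \<eta>) = 0"
        using eq[OF O] a0 s by simp
      then have "norm (g (x / \<eta>)) = norm (of_real s * \<eta> * f1 (of_real s * x) (of_real s * \<eta>))"
        by (metis add_eq_0_iff norm_minus_cancel)
      also have "\<dots> = s * norm \<eta> * norm (f1 (of_real s * x) (of_real s * \<eta>))"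
        using s by (simp add: norm_mult)
      also have "\<dots> \<le> s * norm \<eta> * K" using s by (intro mult_left_mono K O) auto
      finally show ?thesis by simp
    qed
    then have "norm (g (x / \<eta>)) \<le> 0" by (rule le_zero_if_le_scale)
    then show ?thesis by simp
  qed
qed

lemma dac_head:
  assumes f: "\<And>N. dac r V \<Omega> N f"
  obtains a g f1 where "a holomorphic_on ball 0 r" "g \<in> inner_fun V" "\<And>N. dac r V \<Omega> N f1"
    "\<And>x \<eta>. (x, \<eta>) \<in> \<Omega> \<Longrightarrow> f x \<eta> = a x + g (x / \<eta>) + \<eta> * f1 x \<eta>"
proof -
  obtain a g f1 where 1: "a holomorphic_on ball 0 r" "g \<in> inner_fun V" "dac r V \<Omega> 0 f1"
    "\<And>x \<eta>. (x, \<eta>) \<in> \<Omega> \<Longrightarrow> f x \<eta> = a x + g (x / \<eta>) + \<eta> * f1 x \<eta>"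
    using dac_SucE[OF f[of "Suc 0"]] by metis
  have "dac r V \<Omega> N f1" for N
  proof -
    obtain a' g' f1' where 2: "a' holomorphic_on ball 0 r" "g' \<in> inner_fun V" "dac r V \<Omega> N f1'"
      "\<And>x \<eta>. (x, \<eta>) \<in> \<Omega> \<Longrightarrow> f x \<eta> = a' x + g' (x / \<eta>) + \<eta> * f1' x \<eta>"
      using dac_SucE[OF f[of "Suc N"]] by metis
    have "dac r V \<Omega> 0 (\<lambda>x \<eta>. f1 x \<eta> + (- 1) * f1' x \<eta>)"
      by (intro dac_add 1(3) dac_mult_0 dac_outer dac_le[OF 2(3)]) auto
    then obtain K where K: "\<And>x \<eta>. (x, \<eta>) \<in> \<Omega> \<Longrightarrow> norm (f1 x \<eta> + (- 1) * f1' x \<eta>) \<le> K"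
      by auto
    have eq: "(a x - a' x) + (g (x / \<eta>) + (- 1) * g' (x / \<eta>)) + \<eta> * (f1 x \<eta> + (- 1) * f1' x \<eta>) = 0"
      if "(x, \<eta>) \<in> \<Omega>" for x \<eta>
      using 1(4)[OF that] 2(4)[OF that] by (simp add: algebra_simps)
    note z = dac_head_zero(1)[OF holomorphic_on_diff[OF 1(1) 2(1)] inner_fun_add[OF 1(2) inner_fun_cmult[OF 2(2), of "- 1"]] K eq]
      dac_head_zero(2)[OF holomorphic_on_diff[OF 1(1) 2(1)] inner_fun_add[OF 1(2) inner_fun_cmult[OF 2(2), of "- 1"]] K eq]
    show ?thesis
    proof (rule dac_cong[OF 2(3)])
      fix x \<eta> assume x: "(x, \<eta>) \<in> \<Omega>"
      then have "x \<in> ball 0 r" "\<eta> \<noteq> 0" using dom[OF x] Rr by auto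
      then show "f1 x \<eta> = f1' x \<eta>"
        using z(1)[OF _ _ \<open>x \<in> ball 0 r\<close>] z(2)[OF _ _ x] 1(4)[OF x] 2(4)[OF x] by simp
    qed
  qed
  then show ?thesis using 1 that by blast
qed

text \<open>Since the leading coefficients do not depend on the order, the remainder has expansions of all orders again, and the step can be iterated.\<close>

lemma dac_sequence:
  assumes f: "\<And>N. dac r V \<Omega> N f"
  obtains a g where "\<And>n. a n holomorphic_on ball 0 r" "\<And>n. g n \<in> inner_fun V"
    "\<And>N. \<exists>K. \<forall>x \<eta>. (x, \<eta>) \<in> \<Omega> \<longrightarrow> norm (f x \<eta> - (\<Sum>n<N. (a n x + g n (x / \<eta>)) * \<eta> ^ n)) \<le> K * norm \<eta> ^ N"
proof -
  let ?Q = "\<lambda>f f1 a g. a holomorphic_on ball 0 r \<and> g \<in> inner_fun V \<and>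
      (\<forall>x \<eta>. (x, \<eta>) \<in> \<Omega> \<longrightarrow> f x \<eta> = a x + g (x / \<eta>) + \<eta> * f1 x \<eta>)"
  have "\<exists>F. \<forall>n. ((\<forall>N. dac r V \<Omega> N (F n)) \<and> (n = 0 \<longrightarrow> F n = f)) \<and> (\<exists>a g. ?Q (F n) (F (Suc n)) a g)"
  proof (rule dependent_nat_choice)
    fix h :: "complex \<Rightarrow> complex \<Rightarrow> complex" and n :: nat
    assume h: "(\<forall>N. dac r V \<Omega> N h) \<and> (n = 0 \<longrightarrow> h = f)"
    then obtain a g f1 where "a holomorphic_on ball 0 r" "g \<in> inner_fun V" "\<And>N. dac r V \<Omega> N f1"
        "\<And>x \<eta>. (x, \<eta>) \<in> \<Omega> \<Longrightarrow> h x \<eta> = a x + g (x / \<eta>) + \<eta> * f1 x \<eta>"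
      using dac_head[of h] by metis
    then show "\<exists>y. ((\<forall>N. dac r V \<Omega> N y) \<and> (Suc n = 0 \<longrightarrow> y = f)) \<and> (\<exists>a g. ?Q h y a g)"
      by blast
  qed (use f in blast)
  then obtain F where F: "\<And>n N. dac r V \<Omega> N (F n)" "F 0 = f" "\<And>n. \<exists>a g. ?Q (F n) (F (Suc n)) a g"
    by metis
  then obtain a g where ag: "\<And>n. ?Q (F n) (F (Suc n)) (a n) (g n)" by metis
  have expand: "f x \<eta> = (\<Sum>n<N. (a n x + g n (x / \<eta>)) * \<eta> ^ n) + \<eta> ^ N * F N x \<eta>" if "(x, \<eta>) \<in> \<Omega>" for x \<eta> N
  proof (induction N)
    case 0
    then show ?case by (simp add: F(2))
  next
    case (Suc N)
    have "F N x \<eta> = a N x + g N (x / \<eta>) + \<eta> * F (Suc N) x \<eta>" using ag that by blast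
    then show ?case by (subst Suc.IH) (simp add: algebra_simps)
  qed
  show ?thesis
  proof (rule that[of a g])
    fix N
    obtain K where K: "\<And>x \<eta>. (x, \<eta>) \<in> \<Omega> \<Longrightarrow> norm (F N x \<eta>) \<le> K" using F(1)[of 0 N] by auto
    then show "\<exists>K. \<forall>x \<eta>. (x, \<eta>) \<in> \<Omega> \<longrightarrow> norm (f x \<eta> - (\<Sum>n<N. (a n x + g n (x / \<eta>)) * \<eta> ^ n)) \<le> K * norm \<eta> ^ N"
    proof (intro exI[of _ K] allI impI)
      fix x \<eta> assume x: "(x, \<eta>) \<in> \<Omega>"
      have "norm (\<eta> ^ N * F N x \<eta>) \<le> norm \<eta> ^ N * K"
        unfolding norm_mult norm_power by (rule mult_left_mono) (use K[OF x] in auto)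
      then show "norm (f x \<eta> - (\<Sum>n<N. (a n x + g n (x / \<eta>)) * \<eta> ^ n)) \<le> K * norm \<eta> ^ N"
        unfolding expand[OF x, of N] by (simp add: mult.commute)
    qed
  qed (use ag in blast)+
qed

end

section \<open>Sectors and quasi-sectors\<close>

lemma is_Arg_cis: "is_Arg x \<theta> \<longleftrightarrow> x = of_real (norm x) * cis \<theta>"
  by (simp add: is_Arg_def cis_conv_exp)

lemma is_Arg_polar: "r \<ge> 0 \<Longrightarrow> is_Arg (of_real r * cis \<theta>) \<theta>"
  by (simp add: is_Arg_cis norm_mult)

lemma is_Arg_times:
  assumes "is_Arg x \<theta>" "is_Arg y \<tau>"
  shows "is_Arg (x * y) (\<theta> + \<tau>)"
proof -
  have "x * y = of_real (norm x * norm y) * cis (\<theta> + \<tau>)"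
    using assms unfolding is_Arg_cis cis_mult[symmetric] of_real_mult by (metis mult.assoc mult.left_commute)
  then show ?thesis by (simp add: is_Arg_cis norm_mult)
qed

lemma is_Arg_divide:
  assumes "is_Arg x \<theta>" "is_Arg y \<tau>"
  shows "is_Arg (x / y) (\<theta> - \<tau>)"
proof -
  have "x / y = (of_real (norm x) * cis \<theta>) / (of_real (norm y) * cis \<tau>)"
    using assms unfolding is_Arg_cis by metis
  also have "\<dots> = of_real (norm x / norm y) * cis (\<theta> - \<tau>)"
    by (simp add: cis_divide[symmetric])
  finally show ?thesis
    using is_Arg_polar[of "norm x / norm y" "\<theta> - \<tau>"] by (simp only: divide_nonneg_nonneg norm_ge_zero)
qed

lemma is_Arg_power:
  assumes "is_Arg x \<theta>" shows "is_Arg (x ^ n) (real n * \<theta>)"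
proof -
  have "x ^ n = (of_real (norm x) * cis \<theta>) ^ n"
    using assms unfolding is_Arg_cis by metis
  also have "\<dots> = of_real (norm x ^ n) * cis (real n * \<theta>)"
    by (simp only: power_mult_distrib Complex.DeMoivre of_real_power)
  finally show ?thesis
    using is_Arg_polar[of "norm x ^ n" "real n * \<theta>"] by (simp only: zero_le_power norm_ge_zero)
qed

lemma arg_between_scale: "arg_between a b x \<Longrightarrow> r > 0 \<Longrightarrow> arg_between a b (of_real r * x)"
  using is_Arg_times[OF is_Arg_polar[of r 0]] unfolding arg_between_def by fastforce

lemma arg_between_divide:
  assumes "arg_between a b x" "arg_between (- d) d y"
  shows "arg_between (a - d) (b + d) (x / y)"
proof -
  obtain \<theta> where 1: "x \<noteq> 0" "a < \<theta>" "\<theta> < b" "is_Arg x \<theta>" using assms(1) unfolding arg_between_def by blast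
  obtain \<tau> where 2: "y \<noteq> 0" "- d < \<tau>" "\<tau> < d" "is_Arg y \<tau>" using assms(2) unfolding arg_between_def by blast
  show ?thesis unfolding arg_between_def
    by (intro conjI exI[of _ "\<theta> - \<tau>"] is_Arg_divide 1 2) (use 1 2 in auto)
qed

lemma arg_between_of_real: "a < 0 \<Longrightarrow> 0 < b \<Longrightarrow> t > 0 \<Longrightarrow> arg_between a b (of_real t)"
  using is_Arg_polar[of t 0] unfolding arg_between_def by (auto intro!: exI[of _ 0])

lemma arg_between_croot:
  assumes "p > 0" "u \<notin> \<real>\<^sub>\<le>\<^sub>0" "A \<ge> pi"
  shows "arg_between (- (A / real p)) (A / real p) (croot p u)"
proof -
  have u: "u \<noteq> 0" using assms(2) by auto
  have im: "\<bar>Im (Ln u)\<bar> < pi"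
  proof -
    have "Im (Ln u) \<noteq> pi" using assms(2) u
      by (metis Im_Ln_eq_pi complex_nonpos_Reals_iff less_eq_real_def)
    then show ?thesis using mpi_less_Im_Ln[OF u] Im_Ln_le_pi[OF u] by linarith
  qed
  have "croot p u = exp (Ln u / of_nat p)" using u by (simp add: croot_def powr_def)
  also have "\<dots> = of_real (exp (Re (Ln u / of_nat p))) * cis (Im (Ln u / of_nat p))"
    by (rule exp_eq_polar)
  also have "Im (Ln u / of_nat p) = Im (Ln u) / real p" by simp
  finally have "is_Arg (croot p u) (Im (Ln u) / real p)"
    using is_Arg_polar[of "exp (Re (Ln u / of_nat p))"] by simp
  moreover have "- (A / real p) < Im (Ln u) / real p" "Im (Ln u) / real p < A / real p"
    using im assms(1,3) by (auto simp: field_simps abs_less_iff)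
  ultimately show ?thesis using croot_nonzero[OF u] unfolding arg_between_def by blast
qed

lemma open_arg_between: "open {x. arg_between a b x}"
proof (subst open_subopen, clarsimp)
  fix x assume "arg_between a b x"
  then obtain \<theta> where 1: "x \<noteq> 0" "a < \<theta>" "\<theta> < b" "is_Arg x \<theta>" unfolding arg_between_def by blast
  have "isCont (\<lambda>y. Im (Ln (y / x))) x"
    using 1(1) by (intro continuous_intros isCont_Im) auto
  then have "((\<lambda>y. Im (Ln (y / x))) \<longlongrightarrow> Im (Ln (x / x))) (nhds x)"
    unfolding isCont_def by (rule tendsto_at_iff_tendsto_nhds[THEN iffD1])
  then have lim: "((\<lambda>y. Im (Ln (y / x))) \<longlongrightarrow> 0) (nhds x)"
    using 1(1) by simp
  have "\<forall>\<^sub>F y in nhds x. a - \<theta> < Im (Ln (y / x))" "\<forall>\<^sub>F y in nhds x. Im (Ln (y / x)) < b - \<theta>"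
    using order_tendstoD[OF lim] 1 by auto
  moreover have "\<forall>\<^sub>F y in nhds x. y \<noteq> 0" using 1(1) by (rule t1_space_nhds)
  ultimately have "\<forall>\<^sub>F y in nhds x. arg_between a b y"
  proof eventually_elim
    case (elim y)
    have "is_Arg (y / x) (Im (Ln (y / x)))"
      using is_Arg_Arg[of "y / x"] elim 1(1) by (simp add: Arg_eq_Im_Ln)
    from is_Arg_times[OF 1(4) this] have "is_Arg y (\<theta> + Im (Ln (y / x)))" using 1(1) by simp
    then show ?case unfolding arg_between_def using elim by (intro conjI exI) auto
  qed
  then show "\<exists>T. open T \<and> x \<in> T \<and> T \<subseteq> {x. arg_between a b x}"
    unfolding eventually_nhds by auto
qed

lemma cos_back:
  assumes "0 < \<delta>" "\<delta> \<le> pi / 8" "\<bar>\<tau>\<bar> \<le> \<delta>" "3 * pi / 4 \<le> \<bar>\<psi>\<bar>" "\<bar>\<psi>\<bar> + \<bar>\<tau>\<bar> \<le> 3 * pi / 2 - \<delta>"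
  shows "cos (\<psi> - \<tau>) \<le> - sin \<delta>"
proof -
  define w where "w = \<bar>\<psi> - \<tau>\<bar>"
  have "w \<ge> pi / 2 + \<delta>" "w \<le> 3 * pi / 2 - \<delta>" using assms unfolding w_def by linarith+
  then have "\<bar>w - pi\<bar> \<le> pi / 2 - \<delta>" by linarith
  moreover have "pi / 2 - \<delta> \<le> pi" using assms by linarith
  ultimately have "cos (pi / 2 - \<delta>) \<le> cos \<bar>w - pi\<bar>" by (intro cos_monotone_0_pi_le) auto
  then have "sin \<delta> \<le> cos (w - pi)" unfolding cos_abs_real by (simp add: sin_cos_eq)
  moreover have "cos (w - pi) = - cos w" by (simp add: cos_diff)
  moreover have "cos w = cos (\<psi> - \<tau>)" unfolding w_def by (rule cos_abs_real)
  ultimately show ?thesis by linarith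
qed

text \<open>If p |arg x| exceeds 3 pi/4, then x^p/\<epsilon> has an argument between pi/2 + \<delta> and 3 pi/2 - \<delta> in modulus; this is where
the opening of the quasi-sector and the bound pi/8 for \<delta> enter.\<close>

lemma front_or_back:
  assumes p: "p > 0" and \<delta>: "0 < \<delta>" "\<delta> \<le> pi / 8"
    and x: "arg_between (- (A / real p)) (A / real p) x"
    and \<epsilon>: "is_Arg \<epsilon> \<tau>" "\<bar>\<tau>\<bar> \<le> \<delta>" and A: "A + \<bar>\<tau>\<bar> \<le> 3 * pi / 2 - \<delta>"
  shows "front p x \<or> Re (x ^ p / \<epsilon>) \<le> - sin \<delta> * norm x ^ p / norm \<epsilon>"
proof -
  obtain \<theta> where \<theta>: "x \<noteq> 0" "- (A / real p) < \<theta>" "\<theta> < A / real p" "is_Arg x \<theta>"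
    using x unfolding arg_between_def by blast
  define \<psi> where "\<psi> = real p * \<theta>"
  have \<psi>: "\<bar>\<psi>\<bar> < A" using \<theta>(2,3) p by (auto simp: \<psi>_def abs_less_iff field_simps)
  have xp: "is_Arg (x ^ p) \<psi>" unfolding \<psi>_def by (rule is_Arg_power[OF \<theta>(4)])
  show ?thesis
  proof (cases "\<bar>\<psi>\<bar> \<le> 3 * pi / 4")
    case True
    have nx: "norm x > 0" using \<theta> by simp
    have "x ^ p = exp (of_real (real p * ln (norm x)) + \<i> * of_real \<psi>)"
    proof -
      have "x ^ p = of_real (norm x ^ p) * cis \<psi>" using xp by (simp add: is_Arg_cis norm_power)
      also have "norm x ^ p = exp (real p * ln (norm x))" using nx by (simp add: exp_of_nat_mult)
      finally show ?thesis by (simp only: exp_add cis_conv_exp exp_of_real)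
    qed
    moreover have "\<bar>\<psi>\<bar> < pi" using True pi_gt_zero by linarith
    ultimately have "Ln (x ^ p) = of_real (real p * ln (norm x)) + \<i> * of_real \<psi>"
      by (intro Ln_unique) auto
    then have "croot p (x ^ p) = exp (of_real (ln (norm x)) + \<i> * of_real \<theta>)"
      using \<theta>(1) p by (simp add: croot_def powr_def \<psi>_def add_divide_distrib)
    also have "\<dots> = of_real (norm x) * cis \<theta>" using nx by (simp add: exp_add cis_conv_exp exp_of_real)
    also have "\<dots> = x" using \<theta>(4) by (simp add: is_Arg_cis)
    finally have 1: "x = croot p (x ^ p)" by simp
    have "cos (3 * pi / 4) \<le> cos \<bar>\<psi>\<bar>" using True by (intro cos_monotone_0_pi_le) auto
    moreover have "cos (3 * pi / 4) \<ge> - (3/4)"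
    proof -
      have "cos (3 * pi / 4) = - cos (pi / 4)" using cos_pi_minus[of "pi / 4"] by (simp add: field_simps)
      moreover have "sqrt 2 \<le> 3/2" by (rule real_le_lsqrt) (auto simp: power2_eq_square)
      ultimately show ?thesis by (simp add: cos_45)
    qed
    ultimately have c: "- (3/4) \<le> cos \<psi>" by simp
    have "Re (x ^ p) = norm x ^ p * cos \<psi>"
    proof -
      have "x ^ p = of_real (norm x ^ p) * cis \<psi>" using xp by (simp add: is_Arg_cis norm_power)
      then show ?thesis by (metis Re_of_real_mult cis.sel(1))
    qed
    then have 2: "Re (x ^ p) \<ge> - (3/4) * norm x ^ p"
      using mult_left_mono[OF c, of "norm x ^ p"] by (simp add: mult.commute)
    show ?thesis using 1 2 unfolding front_def by blast
  next
    case False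
    have "is_Arg (x ^ p / \<epsilon>) (\<psi> - \<tau>)" by (rule is_Arg_divide[OF xp \<epsilon>(1)])
    then have "x ^ p / \<epsilon> = of_real (norm x ^ p / norm \<epsilon>) * cis (\<psi> - \<tau>)"
      by (simp only: is_Arg_cis norm_divide norm_power)
    then have "Re (x ^ p / \<epsilon>) = norm x ^ p / norm \<epsilon> * cos (\<psi> - \<tau>)" by (metis Re_of_real_mult cis.sel(1))
    also have "\<dots> \<le> norm x ^ p / norm \<epsilon> * (- sin \<delta>)"
      by (intro mult_left_mono cos_back \<delta> \<epsilon>(2)) (use False A \<psi> in auto)
    finally show ?thesis by (simp add: mult.commute)
  qed
qed

lemma quasi_sector_scale:
  assumes "x \<in> quasi_sector a b R m" "0 \<le> r" "r \<le> 1" "m > 0"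
  shows "of_real r * x \<in> quasi_sector a b R m"
proof (cases "r = 0")
  case True then show ?thesis using assms by (simp add: quasi_sector_def)
next
  case False
  then have r: "r > 0" using assms by simp
  have n: "norm (of_real r * x) \<le> norm x" using assms by (simp add: norm_mult mult_left_le_one_le)
  then have "ereal (norm (of_real r * x)) \<le> ereal (norm x)" by simp
  then show ?thesis using assms(1) n arg_between_scale[OF _ r, of a b x]
    unfolding quasi_sector_def by (auto simp del: ereal_less_eq simp: le_less_trans)
qed

lemma open_quasi_sector: "open (quasi_sector a b R m)"
proof -
  have 1: "quasi_sector a b R m = ({x. ereal (norm x) < R} \<inter> {x. arg_between a b x}) \<union> ball 0 m"
    by (auto simp: quasi_sector_def)
  have "open {x :: complex. ereal (norm x) < R}"
    by (intro open_Collect_less continuous_intros continuous_on_ereal)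
  then show ?thesis unfolding 1 by (intro open_Un open_Int open_arg_between open_ball)
qed

section \<open>The inner equation\<close>

lemma dir_real:
  assumes "n \<ge> Re u + \<bar>Im u\<bar>" "c \<le> 1/2"
  shows "Re (of_real n - u) \<ge> c * norm (of_real n - u)"
proof -
  have "norm (of_real n - u) \<le> \<bar>Re (of_real n - u)\<bar> + \<bar>Im (of_real n - u)\<bar>" by (rule cmod_le)
  also have "\<dots> \<le> 2 * Re (of_real n - u)" using assms(1) by simp
  finally have "norm (of_real n - u) / 2 \<le> Re (of_real n - u)" by simp
  moreover have "c * norm (of_real n - u) \<le> 1/2 * norm (of_real n - u)"
    using assms(2) by (rule mult_right_mono) simp
  ultimately show ?thesis by simp
qed

lemma exp_minus_le_power:
  assumes "(x::real) > 0"
  shows "exp (- x) \<le> fact N / x ^ N"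
proof -
  have "x ^ N / fact N \<le> exp x"
  proof -
    have "x ^ N / fact N = (\<Sum>n\<in>{N}. x ^ n /\<^sub>R fact n)" by (simp add: divide_inverse mult.commute)
    also have "\<dots> \<le> (\<Sum>n. x ^ n /\<^sub>R fact n)"
      using assms by (intro sum_le_suminf summable_exp_generic) auto
    finally show ?thesis by (simp add: exp_def)
  qed
  then show ?thesis using assms by (simp add: exp_minus field_simps)
qed

text \<open>A is p times the half-opening of the quasi-sector in which X = x/\<eta> varies: the half-opening for x, enlarged by the
bound \<delta>/p for |arg \<eta>|.\<close>

locale inner_domain =
  fixes p :: nat and \<delta> \<mu> A :: real and V :: "complex set"
  assumes p: "p \<ge> 2" and \<delta>: "0 < \<delta>" "\<delta> \<le> pi / 8" and \<mu>: "\<mu> > 0"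
  defines "A \<equiv> 3 * pi / 2 - \<delta>"
  defines "V \<equiv> quasi_sector (- (A / real p)) (A / real p) \<infinity> \<mu>"
begin

lemma p0: "p > 0" using p by simp

lemma sin\<delta>: "0 < sin \<delta>" "sin \<delta> \<le> 1/2"
proof -
  show "0 < sin \<delta>" using \<delta> by (intro sin_gt_zero) auto
  have "sin \<delta> \<le> sin (pi / 6)" using \<delta> by (intro sin_monotone_2pi_le) auto
  then show "sin \<delta> \<le> 1/2" by (simp add: sin_30)
qed

lemma A_pos: "A > 0" "A \<ge> pi"
  using \<delta> pi_gt_zero unfolding A_def by linarith+

lemma V_star: "x \<in> V \<Longrightarrow> 0 \<le> r \<Longrightarrow> r \<le> 1 \<Longrightarrow> of_real r * x \<in> V"
  unfolding V_def using quasi_sector_scale \<mu> by blast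

lemma V_open: "open V"
  unfolding V_def by (rule open_quasi_sector)

lemma V_disc: "norm x < \<mu> \<Longrightarrow> x \<in> V"
  by (simp add: V_def quasi_sector_def)

lemma V_real: "t > 0 \<Longrightarrow> of_real t \<in> V"
  using arg_between_of_real[of "- (A / real p)" "A / real p" t] A_pos p0
  by (simp add: V_def quasi_sector_def)

lemma V_croot: "u \<notin> \<real>\<^sub>\<le>\<^sub>0 \<Longrightarrow> croot p u \<in> V"
  using arg_between_croot[OF p0 _ A_pos(2)] by (simp add: V_def quasi_sector_def)

lemma V_front_or_back:
  assumes "x \<in> V" "norm x \<ge> \<mu>"
  shows "front p x \<or> Re (x ^ p / 1) \<le> - sin \<delta> * norm x ^ p / norm (1::complex)"
proof (rule front_or_back[OF p0 \<delta>])
  show "arg_between (- (A / real p)) (A / real p) x" using assms by (simp add: V_def quasi_sector_def)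
  show "is_Arg 1 0" by (simp add: is_Arg_def)
qed (use \<delta> in \<open>auto simp: A_def\<close>)

lemma front_segment_V:
  assumes "front p x" "x \<noteq> 0" "b > 0" "0 \<le> s" "s \<le> 1"
  shows "croot p (x ^ p + of_real s * (of_real b - x ^ p)) \<in> V"
  by (intro V_croot segment_slit) (use assms in \<open>auto simp: front_def norm_power\<close>)

text \<open>The solution is minus the integral of exp (X^p - T^p) g(T) over a path from X to infinity along the positive real axis.\<close>

lemma exists_bounded_solution:
  assumes g: "g holomorphic_on V" and gM: "\<And>X. X \<in> V \<Longrightarrow> norm (g X) \<le> M * (norm X + 1) ^ (p - 1)"
  obtains h C where "lin_sol p 1 g h V" "\<And>X. X \<in> V \<Longrightarrow> norm (h X) \<le> C"
proof -
  have M: "M \<ge> 0" using order_trans[OF norm_ge_zero gM[OF V_disc[of 0]]] \<mu> by simp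
  have gM': "norm (g X) \<le> M * ((norm X + 1) / 1) ^ (p - 1)" if "X \<in> V" for X using gM[OF that] by simp
  have star: "starlike V"
    unfolding starlike_def
  proof (intro bexI[of _ 0] ballI subsetI)
    fix x y assume "x \<in> V" "y \<in> closed_segment 0 x"
    then obtain u where "y = of_real u * x" "0 \<le> u" "u \<le> 1"
      by (auto simp: closed_segment_def scaleR_conv_of_real)
    then show "y \<in> V" using V_star[OF \<open>x \<in> V\<close>] by simp
  qed (use \<mu> V_disc[of 0] in auto)
  have hol: "(\<lambda>X. exp (- (X ^ p)) * g X) holomorphic_on V" using g by (intro holomorphic_intros)
  obtain F where F: "\<And>X. X \<in> V \<Longrightarrow> (F has_field_derivative exp (- (X ^ p)) * g X) (at X)"
    using holomorphic_starlike_primitive[OF holomorphic_on_imp_continuous_on[OF hol] star V_open finite.emptyI]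
      holomorphic_on_imp_differentiable_at[OF hol V_open] by auto
  have sol: "lin_sol p 1 g (\<lambda>X. exp (X ^ p) * (F X - c)) V" for c
    unfolding lin_sol_def
  proof
    fix X assume X: "X \<in> V"
    have "((\<lambda>X. exp (X ^ p)) has_field_derivative exp (X ^ p) * (of_nat p * X ^ (p - 1))) (at X)"
      by (auto intro!: derivative_eq_intros)
    from DERIV_mult[OF this DERIV_diff[OF F[OF X] DERIV_const, of c]]
    show "((\<lambda>X. exp (X ^ p) * (F X - c)) has_field_derivative
            of_nat p * X ^ (p - 1) / 1 * (exp (X ^ p) * (F X - c)) + g X) (at X)"
      by (simp add: exp_minus algebra_simps)
  qed
  define S where "S = step_const p \<mu> (sin \<delta>) * (M * 1)"
  have step: "norm (F (of_real (root p b)) - F x) \<le> S * exp (- Re (x ^ p))"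
    if x: "front p x" "norm x \<ge> \<mu>" and b: "b \<ge> \<mu> ^ p" "b \<ge> Re (x ^ p) + \<bar>Im (x ^ p)\<bar>" for x b
  proof -
    have b0: "b > 0" using b(1) \<mu> by (meson less_le_trans zero_less_power)
    have "norm (exp (- (of_real b / 1)) * (exp (of_real (root p b) ^ p) * (F (of_real (root p b)) - 0))
             - exp (- (x ^ p / 1)) * (exp (x ^ p) * (F x - 0)))
         \<le> step_const p \<mu> (sin \<delta>) * (M * 1) * exp (- Re (x ^ p / 1))"
    proof (rule front_bound_scaled[OF p0 zero_less_one _ sin\<delta>(1) \<mu> x(1) _ _ _ sol[of 0] M gM'])
      show "croot p (x ^ p + of_real s * (of_real b - x ^ p)) \<in> V" if "0 \<le> s" "s \<le> 1" for s
        by (rule front_segment_V[OF x(1) _ b0 that]) (use x(2) \<mu> in auto)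
      show "sin \<delta> * norm (of_real b - x ^ p) / norm (1::complex) \<le> Re ((of_real b - x ^ p) / 1)"
        using dir_real[OF b(2) sin\<delta>(2)] by simp
    qed (use x b in auto)
    moreover have "of_real (root p b) ^ p = complex_of_real b"
      using b0 p0 by (simp flip: of_real_power)
    ultimately show ?thesis by (simp add: exp_minus S_def flip: mult.assoc)
  qed
  have S: "S \<ge> 0" unfolding S_def using step_const_pos[OF p0 \<mu> sin\<delta>(1)] M by simp
  \<comment> \<open>The primitive has a limit along the positive real axis; subtracting it selects the solution
    that stays bounded there.\<close>
  define G where "G = (\<lambda>n. F (of_real (root p (real n))))"
  have "Cauchy G"
  proof (rule CauchyI)
    fix e :: real assume e: "e > 0"
    have "(\<lambda>n. S * exp (- real n)) \<longlonglongrightarrow> 0" by real_asymp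
    then have "\<forall>\<^sub>F n in sequentially. S * exp (- real n) < e" using e by (rule order_tendstoD)
    then obtain n0 where n0: "\<And>n. n \<ge> n0 \<Longrightarrow> S * exp (- real n) < e"
      unfolding eventually_sequentially by blast
    define n1 where "n1 = max n0 (nat \<lceil>\<mu> ^ p\<rceil>)"
    have le: "norm (G n - G m) < e" if "n1 \<le> m" "m \<le> n" for m n
    proof -
      have m: "m \<ge> n0" "real m \<ge> \<mu> ^ p" using that by (auto simp: n1_def)
      have x: "front p (of_real (root p (real m)))" "norm (complex_of_real (root p (real m))) \<ge> \<mu>"
          "complex_of_real (root p (real m)) ^ p = of_real (real m)"
      proof -
        have "\<mu> = root p (\<mu> ^ p)" using \<mu> p0 by (simp add: real_root_power_cancel)
        also have "\<dots> \<le> root p (real m)" using m p0 by simp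
        finally have "\<mu> \<le> root p (real m)" .
        then show "norm (complex_of_real (root p (real m))) \<ge> \<mu>" using \<mu> by simp
        show "front p (of_real (root p (real m)))" by (rule front_of_real[OF p0]) (simp add: real_root_ge_zero)
        show "complex_of_real (root p (real m)) ^ p = of_real (real m)"
          using p0 by (simp flip: of_real_power)
      qed
      have "norm (G n - G m) \<le> S * exp (- Re (complex_of_real (root p (real m)) ^ p))"
        unfolding G_def by (rule step[OF x(1,2)]) (use m that in \<open>simp_all add: x(3)\<close>)
      then have "norm (G n - G m) \<le> S * exp (- real m)" unfolding x(3) by simp
      also have "\<dots> < e" by (rule n0[OF m(1)])
      finally show ?thesis .
    qed
    show "\<exists>M. \<forall>m\<ge>M. \<forall>n\<ge>M. norm (G m - G n) < e"
    proof (intro exI[of _ n1] allI impI)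
      fix m n assume "n1 \<le> m" "n1 \<le> n"
      then show "norm (G m - G n) < e"
        using le[of m n] le[of n m] by (cases "m \<le> n") (simp_all add: norm_minus_commute)
    qed
  qed
  then obtain c where c: "G \<longlonglongrightarrow> c" by (metis Cauchy_convergent_iff convergent_def)
  define h where "h = (\<lambda>X. exp (X ^ p) * (F X - c))"
  have Q: "norm (h x) \<le> S" if "x \<in> V" "norm x \<ge> \<mu> * 1" "front p x" for x
  proof -
    have "\<forall>\<^sub>F n in sequentially. real n \<ge> max (\<mu> ^ p) (Re (x ^ p) + \<bar>Im (x ^ p)\<bar>)"
      by real_asymp
    then have "\<forall>\<^sub>F n in sequentially. norm (G n - F x) \<le> S * exp (- Re (x ^ p))"
      unfolding G_def by (rule eventually_mono) (use that in \<open>auto intro!: step\<close>)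
    moreover have "(\<lambda>n. norm (G n - F x)) \<longlonglongrightarrow> norm (c - F x)" by (intro tendsto_intros c)
    ultimately have "norm (c - F x) \<le> S * exp (- Re (x ^ p))"
      by (intro tendsto_upperbound[where f="\<lambda>n. norm (G n - F x)"]) auto
    then have "norm (h x) \<le> exp (Re (x ^ p)) * (S * exp (- Re (x ^ p)))"
      unfolding h_def norm_mult norm_exp_eq_Re by (intro mult_left_mono) (auto simp: norm_minus_commute)
    also have "\<dots> = S * (exp (Re (x ^ p)) * exp (- Re (x ^ p)))" by simp
    also have "\<dots> = S" unfolding exp_add[symmetric] by simp
    finally show ?thesis .
  qed
  have "norm (h X) \<le> ext_const p \<mu> (sin \<delta>) * (S + M * 1)" if "X \<in> V" for X
    by (rule extend_bound[OF p0 zero_less_one _ sin\<delta>(1) \<mu> _ _ _ _ sol[of c, folded h_def] gM' Q that])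
       (use \<mu> V_star V_disc V_real V_front_or_back in auto)
  then show ?thesis using sol[of c, folded h_def] that by blast
qed

text \<open>Weights |X|^(- N) survive the comparison on segments to infinity, because |T| is at least a multiple of |X| there. Behind the
turning point the comparison is made on the radius from X/2 to X only; the value at X/2 is multiplied by an
exponentially small factor.\<close>

lemma solution_decay:
  assumes d: "lin_sol p 1 r d (V - {0})"
    and C: "\<And>X. X \<in> V \<Longrightarrow> norm X \<ge> 1 \<Longrightarrow> norm (d X) \<le> C"
    and K: "\<And>X. X \<in> V \<Longrightarrow> norm X \<ge> 1 \<Longrightarrow> norm (r X) \<le> K * norm X ^ (p - 1) / norm X ^ N"
  obtains L where "\<And>X. X \<in> V \<Longrightarrow> norm X \<ge> 1 \<Longrightarrow> norm (d X) \<le> L / norm X ^ N"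
proof -
  have C0: "C \<ge> 0" using order_trans[OF norm_ge_zero C[OF V_real[of 1]]] by simp
  have K0: "K \<ge> 0" using order_trans[OF norm_ge_zero K[OF V_real[of 1]]] by simp
  define B where "B = max 4 \<mu>"
  define P where "P = 1 / (real p * sin \<delta>)"
  have P: "P > 0" unfolding P_def using p0 sin\<delta> by simp
  define L1 where "L1 = K * 4 ^ N * P"
  have L1: "L1 \<ge> 0" unfolding L1_def using K0 P by simp
  define L2 where "L2 = C * (fact N * (2 / sin \<delta>) ^ N)"
  have L2: "L2 \<ge> 0" unfolding L2_def using C0 sin\<delta> by simp
  have rb: "norm (r t) \<le> K * 4 ^ N / norm X ^ N * norm t ^ (p - 1)"
    if t: "t \<in> V" "norm t \<ge> norm X / 4" and X: "norm X \<ge> 4" for t X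
  proof -
    have t1: "norm t \<ge> 1" using t X by linarith
    have "(norm X / 4) ^ N \<le> norm t ^ N" using t X by (intro power_mono) auto
    then have "K * norm t ^ (p - 1) / norm t ^ N \<le> K * norm t ^ (p - 1) / (norm X / 4) ^ N"
      using K0 X t1 by (intro divide_left_mono mult_pos_pos zero_less_power mult_nonneg_nonneg) auto
    with K[OF t(1) t1] have "norm (r t) \<le> K * norm t ^ (p - 1) / (norm X / 4) ^ N" by (rule order_trans)
    then show ?thesis by (simp add: power_divide mult_ac)
  qed
  have front: "norm (d X) \<le> L1 / norm X ^ N" if X: "X \<in> V" "norm X \<ge> B" "front p X" for X
  proof -
    have X4: "norm X \<ge> 4" "X \<noteq> 0" using X unfolding B_def by auto
    have ev: "norm (exp (- of_real (real n)) * d (of_real (root p (real n))) - exp (- (X ^ p)) * d X)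
       \<le> L1 / norm X ^ N * exp (- Re (X ^ p))"
      if n: "real n \<ge> norm X ^ p" "real n \<ge> Re (X ^ p) + \<bar>Im (X ^ p)\<bar>" for n
    proof -
      have "0 < norm X ^ p" using X4(2) by simp
      then have n0: "real n > 0" using n(1) by (rule less_le_trans)
      have "norm (exp (- (of_real (real n) / 1)) * d (of_real (root p (real n))) - exp (- (X ^ p / 1)) * d X)
         \<le> (K * 4 ^ N / norm X ^ N) * norm (1::complex) / (of_nat p * sin \<delta>) * exp (- Re (X ^ p / 1))"
      proof (rule front_bound[OF p0 _ sin\<delta>(1) X(3) X4(2) n0 _ d])
        show "croot p (X ^ p + of_real s * (of_real (real n) - X ^ p)) \<in> V - {0}" if s: "0 \<le> s" "s \<le> 1" for s
        proof -
          have "X ^ p + of_real s * (of_real (real n) - X ^ p) \<notin> \<real>\<^sub>\<le>\<^sub>0"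
            by (rule segment_slit) (use X X4 n0 s in \<open>auto simp: front_def norm_power\<close>)
          then have "X ^ p + of_real s * (of_real (real n) - X ^ p) \<noteq> 0" by auto
          from croot_nonzero[OF this] front_segment_V[OF X(3) X4(2) n0 s] show ?thesis by blast
        qed
        show "sin \<delta> * norm (of_real (real n) - X ^ p) / norm (1::complex) \<le> Re ((of_real (real n) - X ^ p) / 1)"
          using dir_real[OF n(2) sin\<delta>(2)] by simp
        fix t assume t: "t \<in> V - {0}" "min (norm X ^ p) (real n) / 4 \<le> norm t ^ p"
        have "(4::real) \<le> 4 ^ p" using p0 by (cases p) auto
        then have "(norm X / 4) ^ p \<le> norm X ^ p / 4"
          unfolding power_divide by (intro divide_left_mono) auto
        also have "\<dots> \<le> norm t ^ p" using t(2) n(1) by simp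
        finally have "norm X / 4 \<le> norm t" 
          by (subst (asm) power_mono_iff) (use p0 in auto)
        then show "norm (r t) \<le> K * 4 ^ N / norm X ^ N * norm t ^ (p - 1)"
          using rb[OF _ _ X4(1)] t(1) by blast
      qed simp
      then show ?thesis by (simp add: L1_def P_def mult_ac)
    qed
    have lim: "(\<lambda>n. exp (- complex_of_real (real n)) * d (of_real (root p (real n)))) \<longlonglongrightarrow> 0"
    proof (rule Lim_null_comparison)
      show "(\<lambda>n. exp (- real n) * C) \<longlonglongrightarrow> 0" by real_asymp
      show "\<forall>\<^sub>F n in sequentially. norm (exp (- complex_of_real (real n)) * d (of_real (root p (real n)))) \<le> exp (- real n) * C"
        using eventually_ge_at_top[of 1]
      proof eventually_elim
        case (elim n)
        have "root p (real n) \<ge> 1" using elim p0 by simp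
        then have "norm (d (of_real (root p (real n)))) \<le> C" by (intro C V_real) auto
        then show ?case unfolding norm_mult norm_exp_eq_Re by (intro mult_mono) auto
      qed
    qed
    have "\<forall>\<^sub>F n in sequentially. real n \<ge> max (norm X ^ p) (Re (X ^ p) + \<bar>Im (X ^ p)\<bar>)"
      by real_asymp
    then have "\<forall>\<^sub>F n in sequentially. norm (exp (- complex_of_real (real n)) * d (of_real (root p (real n))) - exp (- (X ^ p)) * d X)
       \<le> L1 / norm X ^ N * exp (- Re (X ^ p))"
      by (rule eventually_mono) (use ev in auto)
    moreover have "(\<lambda>n. norm (exp (- complex_of_real (real n)) * d (of_real (root p (real n))) - exp (- (X ^ p)) * d X))
        \<longlonglongrightarrow> norm (0 - exp (- (X ^ p)) * d X)"
      by (intro tendsto_intros lim)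
    ultimately have "norm (0 - exp (- (X ^ p)) * d X) \<le> L1 / norm X ^ N * exp (- Re (X ^ p))"
      by (intro tendsto_upperbound) auto
    then have "exp (- Re (X ^ p)) * norm (d X) \<le> exp (- Re (X ^ p)) * (L1 / norm X ^ N)"
      by (simp add: norm_mult mult.commute)
    then show ?thesis by (simp only: mult_le_cancel_left_pos exp_gt_zero)
  qed
  have rad: "norm (d X) \<le> (L1 + L2) / norm X ^ N"
    if X: "X \<in> V" "norm X \<ge> B" and bk: "Re (X ^ p / 1) \<le> - sin \<delta> * norm X ^ p / norm (1::complex)" for X
  proof -
    have X4: "norm X \<ge> 4" "X \<noteq> 0" using X unfolding B_def by auto
    have "norm (exp (- ((of_real (1/2) * X) ^ p / 1)) * d (of_real (1/2) * X) - exp (- (X ^ p / 1)) * d X)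
       \<le> (K * 4 ^ N / norm X ^ N) * norm (1::complex) / (of_nat p * sin \<delta>) * exp (- Re (X ^ p / 1))"
    proof (rule radial_bound[OF p0 _ sin\<delta>(1) X4(2) _ _ _ d _ bk])
      fix s :: real assume s: "1/2 \<le> s" "s \<le> 1"
      show "of_real s * X \<in> V - {0}" using V_star[OF X(1), of s] s X4 by auto
      show "norm (r (of_real s * X)) \<le> K * 4 ^ N / norm X ^ N * norm (of_real s * X) ^ (p - 1)"
      proof (rule rb[OF _ _ X4(1)])
        show "of_real s * X \<in> V" using V_star[OF X(1), of s] s by simp
        have "1/4 * norm X \<le> s * norm X" using s by (intro mult_right_mono) auto
        then show "norm X / 4 \<le> norm (of_real s * X)" using s by (simp add: norm_mult)
      qed
    qed auto
    then have "norm (exp (- ((of_real (1/2) * X) ^ p)) * d (of_real (1/2) * X) - exp (- (X ^ p)) * d X)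
       \<le> L1 / norm X ^ N * exp (- Re (X ^ p))"
      by (simp add: L1_def P_def mult_ac)
    then have 1: "norm (exp (- (X ^ p)) * d X)
       \<le> norm (exp (- ((of_real (1/2) * X) ^ p)) * d (of_real (1/2) * X)) + L1 / norm X ^ N * exp (- Re (X ^ p))"
      by (rule norm_le_of_diff)
    have half: "Re ((of_real (1/2) * X) ^ p) = (1/2) ^ p * Re (X ^ p)"
      unfolding power_mult_distrib of_real_power[symmetric] by (rule Re_of_real_mult)
    have dhalf: "norm (d (of_real (1/2) * X)) \<le> C"
      by (rule C) (use V_star[OF X(1), of "1/2"] X4 in \<open>auto simp: norm_mult\<close>)
    have "norm (exp (- ((of_real (1/2) * X) ^ p)) * d (of_real (1/2) * X)) \<le> exp (- ((1/2) ^ p * Re (X ^ p))) * C"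
      unfolding norm_mult norm_exp_eq_Re uminus_complex.sel half by (rule mult_left_mono[OF dhalf]) simp
    also have "\<dots> \<le> exp (- Re (X ^ p)) * (L2 / norm X ^ N)"
    proof -
      have "norm X \<le> norm X ^ p" using X4 p0 by (intro self_le_power) auto
      then have "sin \<delta> * norm X \<le> sin \<delta> * norm X ^ p"
        using sin\<delta> by (intro mult_left_mono) auto
      moreover have "Re (X ^ p) \<le> - (sin \<delta> * norm X ^ p)" using bk by simp
      ultimately have "sin \<delta> * norm X \<le> - Re (X ^ p)" by linarith
      moreover have "(1/2::real) ^ p \<le> 1/2" using p0 power_decreasing[of 1 p "1/2::real"] by simp
      moreover have "0 \<le> sin \<delta> * norm X" using sin\<delta> by simp
      ultimately have "sin \<delta> * norm X * (1/2) \<le> - Re (X ^ p) * (1 - (1/2) ^ p)"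
        by (intro mult_mono) linarith+
      then have "exp (- ((1/2) ^ p * Re (X ^ p))) \<le> exp (- Re (X ^ p)) * exp (- (sin \<delta> * norm X / 2))"
        unfolding exp_add[symmetric] by (simp add: algebra_simps)
      also have "exp (- (sin \<delta> * norm X / 2)) \<le> fact N / (sin \<delta> * norm X / 2) ^ N"
        using sin\<delta> X4 by (intro exp_minus_le_power) auto
      also have "fact N / (sin \<delta> * norm X / 2) ^ N = fact N * (2 / sin \<delta>) ^ N / norm X ^ N"
        by (simp add: power_mult_distrib power_divide)
      finally have "exp (- ((1/2) ^ p * Re (X ^ p))) \<le> exp (- Re (X ^ p)) * (fact N * (2 / sin \<delta>) ^ N / norm X ^ N)"
        by simp
      from mult_right_mono[OF this C0] show ?thesis by (simp add: L2_def mult_ac)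
    qed
    finally have "exp (- Re (X ^ p)) * norm (d X) \<le> exp (- Re (X ^ p)) * (L2 / norm X ^ N) + L1 / norm X ^ N * exp (- Re (X ^ p))"
      using 1 by (simp add: norm_mult)
    then have "exp (- Re (X ^ p)) * norm (d X) \<le> exp (- Re (X ^ p)) * ((L1 + L2) / norm X ^ N)"
      by (simp add: algebra_simps add_divide_distrib)
    then show ?thesis by (simp only: mult_le_cancel_left_pos exp_gt_zero)
  qed
  define L where "L = L1 + L2 + C * B ^ N"
  have CB: "C * B ^ N \<ge> 0" using C0 by (simp add: B_def)
  have "norm (d X) \<le> L / norm X ^ N" if X: "X \<in> V" "norm X \<ge> 1" for X
  proof (cases "norm X \<ge> B")
    case True
    have le: "(L1 + L2) / norm X ^ N \<le> L / norm X ^ N" "L1 / norm X ^ N \<le> L / norm X ^ N"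
      using CB L1 L2 by (auto simp: L_def intro!: divide_right_mono)
    have "norm X \<ge> \<mu>" using True by (simp add: B_def)
    from V_front_or_back[OF X(1) this] show ?thesis
      using front[OF X(1) True] rad[OF X(1) True] le by (meson order_trans)
  next
    case False
    have "C * norm X ^ N \<le> C * B ^ N" using False C0 by (intro mult_left_mono power_mono) auto
    then have "C * norm X ^ N \<le> L" using L1 L2 by (simp add: L_def)
    moreover have "norm X ^ N > 0" using X(2) by (intro zero_less_power) linarith
    ultimately have "C \<le> L / norm X ^ N" by (simp add: pos_le_divide_eq)
    with C[OF X] show ?thesis by (rule order_trans)
  qed
  then show ?thesis by (rule that)
qed

end

text \<open>The coefficients of the formal solution of h' = p X^(p-1) h + X^(p-2) \<Sum>i. e i / X^i, by comparison of the coefficients of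
X^(p-2-i).\<close>

fun inner_coeff :: "nat \<Rightarrow> (nat \<Rightarrow> complex) \<Rightarrow> nat \<Rightarrow> complex" where
  "inner_coeff p e 0 = 0"
| "inner_coeff p e (Suc i) =
     - (e i + (if 0 < p \<and> p \<le> Suc i then of_nat (Suc i - p) * inner_coeff p e (Suc i - p) else 0)) / of_nat p"

text \<open>By the recursion all terms cancel except the truncated right hand side and the last p terms of the derivative of the truncated formal solution.\<close>

lemma inner_residual:
  fixes X :: complex and e :: "nat \<Rightarrow> complex"
  assumes p: "p \<ge> 2" and X: "X \<noteq> 0"
  defines "d \<equiv> inner_coeff p e"
  shows "(\<Sum>m<N. of_nat m * d m / X ^ Suc m + of_nat p * X ^ (p - 1) * (d m / X ^ m))
       = (\<Sum>k=N-p..<N. of_nat k * d k / X ^ Suc k) - X ^ (p - 2) * (\<Sum>i<N-1. e i / X ^ i)"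
proof (induction N)
  case 0
  then show ?case by simp
next
  case (Suc N)
  show ?case
  proof (cases N)
    case 0
    then show ?thesis using p by (simp add: d_def)
  next
    case N: (Suc i)
    define T where "T = (\<lambda>k. of_nat k * d k / X ^ Suc k)"
    have win: "sum T {Suc N - p..<Suc N} = sum T {N - p..<N} + T N - (if p \<le> N then T (N - p) else 0)"
    proof (cases "p \<le> N")
      case True
      then have "{N - p..<N} = insert (N - p) {Suc N - p..<N}" using p by auto
      then have "sum T {N - p..<N} = T (N - p) + sum T {Suc N - p..<N}" using True by simp
      moreover have "sum T {Suc N - p..<Suc N} = sum T {Suc N - p..<N} + T N"
        using p by (intro sum.atLeastLessThan_Suc) auto
      ultimately show ?thesis using True by simp
    next
      case False
      then have "Suc N - p = N - p" by simp
      then show ?thesis using False sum.atLeastLessThan_Suc[of "N - p" N T] by simp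
    qed
    have pd: "of_nat p * d N = - e i - (if p \<le> N then of_nat (N - p) * d (N - p) else 0)"
      using p unfolding d_def N by simp
    have pow: "X ^ (p - 1) = X ^ (p - 2) * X"
    proof -
      have "p - 1 = Suc (p - 2)" using p by simp
      then show ?thesis by simp
    qed
    have "of_nat p * X ^ (p - 1) * (d N / X ^ N) = X ^ (p - 1) / X ^ N * (of_nat p * d N)" by simp
    also have "\<dots> = - (X ^ (p - 2) * (e i / X ^ i)) - (if p \<le> N then T (N - p) else 0)"
    proof -
      have "X ^ (p - 1) / X ^ N * e i = X ^ (p - 2) * (e i / X ^ i)"
        unfolding pow N using X by simp
      moreover have "X ^ (p - 1) / X ^ N * (of_nat (N - p) * d (N - p)) = T (N - p)" if "p \<le> N"
      proof -
        have "X ^ N = X ^ (p - 1) * X ^ Suc (N - p)"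
          unfolding power_add[symmetric] using that p by simp
        then show ?thesis using X by (simp add: T_def)
      qed
      ultimately show ?thesis unfolding pd by (auto simp: right_diff_distrib)
    qed
    finally have step: "of_nat p * X ^ (p - 1) * (d N / X ^ N)
        = - (X ^ (p - 2) * (e i / X ^ i)) - (if p \<le> N then T (N - p) else 0)" .
    have "(\<Sum>m<Suc N. of_nat m * d m / X ^ Suc m + of_nat p * X ^ (p - 1) * (d m / X ^ m))
        = sum T {N - p..<N} - X ^ (p - 2) * (\<Sum>i<N-1. e i / X ^ i) + (T N + of_nat p * X ^ (p - 1) * (d N / X ^ N))"
      unfolding sum.lessThan_Suc Suc.IH T_def by simp
    also have "\<dots> = sum T {Suc N - p..<Suc N} - X ^ (p - 2) * ((\<Sum>i<N-1. e i / X ^ i) + e i / X ^ i)"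
      unfolding step win by (simp add: algebra_simps)
    also have "(\<Sum>i<N-1. e i / X ^ i) + e i / X ^ i = (\<Sum>i<Suc N-1. e i / X ^ i)"
      by (simp add: N)
    finally show ?thesis unfolding T_def .
  qed
qed

context inner_domain
begin

text \<open>Growth of order X^(p-2) on the right hand side is compensated by the division by p X^(p-1) in the formal solution. It occurs for
the monomials X^j with j < p - 1.\<close>

lemma exists_inner_solution:
  assumes g: "g holomorphic_on V" and gM: "\<And>X. X \<in> V \<Longrightarrow> norm (g X) \<le> M * (norm X + 1) ^ (p - 1)"
    and ge: "\<And>N. \<exists>K. \<forall>X\<in>V. norm X \<ge> 1 \<longrightarrow>
        norm (g X - X ^ (p - 2) * (\<Sum>i<N. e i / X ^ i)) \<le> K * norm X ^ (p - 2) / norm X ^ N"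
  obtains h where "h \<in> inner_fun V" "lin_sol p 1 g h V"
proof -
  obtain h C where h: "lin_sol p 1 g h V" and C: "\<And>X. X \<in> V \<Longrightarrow> norm (h X) \<le> C"
    using exists_bounded_solution[OF g gM] by blast
  define d where "d = inner_coeff p e"
  have hol: "h holomorphic_on V"
    using h by (auto simp: lin_sol_def holomorphic_on_open[OF V_open])
  have inv_expansion: "inv_expansion V d h"
  proof (rule inv_expansionI)
    fix N
    define s where "s = (\<lambda>X. \<Sum>m<N. d m / X ^ m)"
    define res where "res = (\<lambda>X. g X - (\<Sum>m<N. - (of_nat m * d m / X ^ Suc m + of_nat p * X ^ (p - 1) * (d m / X ^ m))))"
    have "lin_sol p 1 (\<lambda>X. - (of_nat m * d m / X ^ Suc m + of_nat p * X ^ (p - 1) * (d m / X ^ m))) (\<lambda>X. d m / X ^ m) (V - {0})" for m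
      unfolding lin_sol_def
    proof
      fix X assume "X \<in> V - {0}"
      then have X: "X \<noteq> 0" by simp
      have "((\<lambda>X. d m / X ^ m) has_field_derivative - (of_nat m * d m / X ^ Suc m)) (at X)"
      proof -
        have D: "((\<lambda>X. d m * inverse X ^ m) has_field_derivative
            d m * (of_nat m * (- (inverse X * 1 * inverse X) * inverse X ^ (m - Suc 0)))) (at X)"
          by (intro DERIV_cmult DERIV_power DERIV_inverse' DERIV_ident X)
        have 1: "d m * (of_nat m * (- (inverse X * 1 * inverse X) * inverse X ^ (m - Suc 0)))
            = - (of_nat m * d m / X ^ Suc m)"
          by (cases m) (simp_all add: divide_inverse power_inverse)
        have 2: "(\<lambda>X. d m * inverse X ^ m) = (\<lambda>X. d m / X ^ m)"
          by (simp add: divide_inverse power_inverse)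
        show ?thesis using D unfolding 1 2 .
      qed
      then show "((\<lambda>X. d m / X ^ m) has_field_derivative of_nat p * X ^ (p - 1) / 1 * (d m / X ^ m)
            + - (of_nat m * d m / X ^ Suc m + of_nat p * X ^ (p - 1) * (d m / X ^ m))) (at X)"
        by simp
    qed
    then have sol: "lin_sol p 1 res (\<lambda>X. h X - s X) (V - {0})"
      unfolding res_def s_def by (intro lin_sol_diff lin_sol_sum lin_sol_subset[OF h]) auto
    have bd: "norm (h X - s X) \<le> C + (\<Sum>m<N. norm (d m))" if X: "X \<in> V" "norm X \<ge> 1" for X
    proof (rule order_trans[OF norm_triangle_ineq4 add_mono[OF C[OF X(1)]]])
      show "norm (s X) \<le> (\<Sum>m<N. norm (d m))" unfolding s_def
      proof (rule sum_norm_le)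
        fix m
        have "norm (d m) / norm X ^ m \<le> norm (d m) / 1"
          using one_le_power[OF X(2), of m] by (intro divide_left_mono) auto
        then show "norm (d m / X ^ m) \<le> norm (d m)" by (simp add: norm_divide norm_power)
      qed
    qed
    obtain K where K: "\<And>X. X \<in> V \<Longrightarrow> norm X \<ge> 1 \<Longrightarrow> norm (res X) \<le> K * norm X ^ (p - 1) / norm X ^ N"
    proof -
      obtain K where K: "\<And>X. X \<in> V \<Longrightarrow> norm X \<ge> 1 \<Longrightarrow>
          norm (g X - X ^ (p - 2) * (\<Sum>i<N-1. e i / X ^ i)) \<le> K * norm X ^ (p - 2) / norm X ^ (N - 1)"
        using ge[of "N - 1"] by blast
      have K0: "K \<ge> 0" using order_trans[OF norm_ge_zero K[OF V_real[of 1]]] by simp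
      define J where "J = (\<Sum>k=N-p..<N. norm (of_nat k * d k))"
      have "norm (res X) \<le> (K + J) * norm X ^ (p - 1) / norm X ^ N" if X: "X \<in> V" "norm X \<ge> 1" for X
      proof -
        have X0: "X \<noteq> 0" "norm X > 0" using X(2) by auto
        have "res X = g X + (\<Sum>m<N. of_nat m * d m / X ^ Suc m + of_nat p * X ^ (p - 1) * (d m / X ^ m))"
          unfolding res_def sum_negf by simp
        also have "\<dots> = (g X - X ^ (p - 2) * (\<Sum>i<N-1. e i / X ^ i)) + (\<Sum>k=N-p..<N. of_nat k * d k / X ^ Suc k)"
          unfolding d_def inner_residual[OF p X0(1)] by simp
        finally have eq: "res X = (g X - X ^ (p - 2) * (\<Sum>i<N-1. e i / X ^ i)) + (\<Sum>k=N-p..<N. of_nat k * d k / X ^ Suc k)" .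
        have "K * norm X ^ (p - 2) / norm X ^ (N - 1) \<le> K * norm X ^ (p - 1) / norm X ^ N"
        proof (cases N)
          case 0
          then show ?thesis using K0 X(2) by (auto intro!: mult_left_mono power_increasing)
        next
          case (Suc M)
          have "p - 1 = Suc (p - 2)" using p by simp
          then show ?thesis using X0 Suc by simp
        qed
        with K[OF X] have 1: "norm (g X - X ^ (p - 2) * (\<Sum>i<N-1. e i / X ^ i)) \<le> K * norm X ^ (p - 1) / norm X ^ N"
          by (rule order_trans)
        have "norm (\<Sum>k=N-p..<N. of_nat k * d k / X ^ Suc k) \<le> (\<Sum>k=N-p..<N. norm (of_nat k * d k) * (norm X ^ (p - 1) / norm X ^ N))"
        proof (rule sum_norm_le)
          fix k assume k: "k \<in> {N - p..<N}"
          have "norm X ^ N \<le> norm X ^ (p - 1 + Suc k)" using k p X(2) by (intro power_increasing) auto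
          then have "1 / norm X ^ Suc k \<le> norm X ^ (p - 1) / norm X ^ N"
            unfolding power_add using X0 by (simp add: divide_le_eq le_divide_eq mult.commute del: power_Suc)
          then have "norm (of_nat k * d k) * (1 / norm X ^ Suc k) \<le> norm (of_nat k * d k) * (norm X ^ (p - 1) / norm X ^ N)"
            by (rule mult_left_mono) simp
          then show "norm (of_nat k * d k / X ^ Suc k) \<le> norm (of_nat k * d k) * (norm X ^ (p - 1) / norm X ^ N)"
            by (simp only: norm_divide norm_power mult_1_right times_divide_eq_right)
        qed
        then have 2: "norm (\<Sum>k=N-p..<N. of_nat k * d k / X ^ Suc k) \<le> J * norm X ^ (p - 1) / norm X ^ N"
          unfolding J_def by (simp only: sum_distrib_right times_divide_eq_right sum_divide_distrib)
        have "(K + J) * norm X ^ (p - 1) / norm X ^ N = K * norm X ^ (p - 1) / norm X ^ N + J * norm X ^ (p - 1) / norm X ^ N"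
          by (simp add: distrib_right add_divide_distrib)
        then show ?thesis unfolding eq using norm_triangle_mono[OF 1 2] by (simp only:)
      qed
      then show ?thesis by (rule that)
    qed
    obtain L where "\<And>X. X \<in> V \<Longrightarrow> norm X \<ge> 1 \<Longrightarrow> norm (h X - s X) \<le> L / norm X ^ N"
      using solution_decay[OF sol bd K] by blast
    then show "\<exists>K. \<forall>X\<in>V. norm X \<ge> 1 \<longrightarrow> norm (h X - (\<Sum>m<N. d m / X ^ m)) \<le> K / norm X ^ N"
      unfolding s_def by blast
  qed
  have "h \<in> inner_fun V"
    by (rule inner_funI[OF hol C _ inv_expansion]) (simp_all add: d_def)
  then show ?thesis using h that by blast
qed

lemma inner_solution:
  assumes "g \<in> inner_fun V"
  obtains h where "h \<in> inner_fun V" "lin_sol p 1 g h V"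
proof -
  obtain B c where B: "\<And>X. X \<in> V \<Longrightarrow> norm (g X) \<le> B" and c: "c 0 = 0" "inv_expansion V c g"
    using inner_funD[OF assms] by metis
  have B0: "B \<ge> 0" using order_trans[OF norm_ge_zero B[OF V_real[of 1]]] by simp
  define e where "e = (\<lambda>i. if i < p - 2 then 0 else c (i - (p - 2)))"
  show ?thesis
  proof (rule exists_inner_solution[OF inner_funD(1)[OF assms], of B e])
    fix X assume X: "X \<in> V"
    have "1 \<le> (norm X + 1) ^ (p - 1)" by (intro one_le_power) auto
    then have "B * 1 \<le> B * (norm X + 1) ^ (p - 1)" using B0 by (intro mult_left_mono)
    then show "norm (g X) \<le> B * (norm X + 1) ^ (p - 1)" using B[OF X] by simp
  next
    fix N
    obtain K where K: "K \<ge> 0" "\<And>X. X \<in> V \<Longrightarrow> norm X \<ge> 1 \<Longrightarrow> norm (g X - (\<Sum>m<N-(p-2). c m / X ^ m)) \<le> K / norm X ^ (N-(p-2))"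
      using inv_expansionE[OF c(2)] by metis
    have "norm (g X - X ^ (p - 2) * (\<Sum>i<N. e i / X ^ i)) \<le> K * norm X ^ (p - 2) / norm X ^ N"
      if X: "X \<in> V" "norm X \<ge> 1" for X
    proof -
      have X0: "X \<noteq> 0" "norm X > 0" using X(2) by auto
      have "X ^ (p - 2) * (\<Sum>i<N. e i / X ^ i) = (\<Sum>m<N-(p-2). c m / X ^ m)"
      proof -
        have "(\<Sum>i<N. e i / X ^ i) = (\<Sum>i\<in>{p-2..<N}. e i / X ^ i)"
          by (rule sum.mono_neutral_right) (auto simp: e_def)
        also have "\<dots> = (\<Sum>m<N-(p-2). e (m + (p - 2)) / X ^ (m + (p - 2)))"
          by (rule sum.reindex_bij_witness[of _ "\<lambda>m. m + (p - 2)" "\<lambda>i. i - (p - 2)"]) auto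
        finally have "X ^ (p - 2) * (\<Sum>i<N. e i / X ^ i) = (\<Sum>m<N-(p-2). X ^ (p - 2) * (e (m + (p - 2)) / X ^ (m + (p - 2))))"
          by (simp add: sum_distrib_left)
        also have "\<dots> = (\<Sum>m<N-(p-2). c m / X ^ m)"
          using X0 by (intro sum.cong) (auto simp: e_def power_add)
        finally show ?thesis .
      qed
      then have "norm (g X - X ^ (p - 2) * (\<Sum>i<N. e i / X ^ i)) \<le> K / norm X ^ (N-(p-2))"
        using K(2)[OF X] by simp
      also have "\<dots> = K * norm X ^ (p - 2) / norm X ^ (N - (p - 2) + (p - 2))"
        using X0 unfolding power_add by simp
      also have "\<dots> \<le> K * norm X ^ (p - 2) / norm X ^ N"
        using K(1) X(2) X0 by (intro divide_left_mono power_increasing mult_nonneg_nonneg mult_pos_pos zero_less_power) auto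
      finally show ?thesis .
    qed
    then show "\<exists>K. \<forall>X\<in>V. norm X \<ge> 1 \<longrightarrow>
        norm (g X - X ^ (p - 2) * (\<Sum>i<N. e i / X ^ i)) \<le> K * norm X ^ (p - 2) / norm X ^ N" by blast
  qed (use that in blast)
qed

lemma monomial_solution:
  assumes "j < p - 1"
  obtains h where "h \<in> inner_fun V" "lin_sol p 1 (\<lambda>X. X ^ j) h V"
proof (rule exists_inner_solution[of "\<lambda>X. X ^ j" 1 "\<lambda>i. if i = p - 2 - j then 1 else 0"])
  show "(\<lambda>X. X ^ j) holomorphic_on V" by (intro holomorphic_intros)
  fix X assume "X \<in> V"
  have "norm X ^ j \<le> (norm X + 1) ^ j" by (rule power_mono) auto
  also have "\<dots> \<le> (norm X + 1) ^ (p - 1)" using assms by (intro power_increasing) auto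
  finally show "norm (X ^ j) \<le> 1 * (norm X + 1) ^ (p - 1)" by (simp add: norm_power)
next
  fix N
  have "norm (X ^ j - X ^ (p - 2) * (\<Sum>i<N. (if i = p - 2 - j then 1 else 0) / X ^ i)) \<le> 1 * norm X ^ (p - 2) / norm X ^ N"
    if X: "norm X \<ge> 1" for X :: complex
  proof -
    have X0: "X \<noteq> 0" "norm X > 0" using X by auto
    have eq: "X ^ (p - 2) = X ^ j * X ^ (p - 2 - j)" unfolding power_add[symmetric] using assms by simp
    have s: "(\<Sum>i<N. (if i = p - 2 - j then 1 else 0) / X ^ i) = (if p - 2 - j < N then 1 / X ^ (p - 2 - j) else 0)"
    proof -
      have "(\<Sum>i<N. (if i = p - 2 - j then 1 else 0) / X ^ i) = (\<Sum>i<N. if i = p - 2 - j then 1 / X ^ i else 0)"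
        by (rule sum.cong) auto
      then show ?thesis by (simp add: sum.delta')
    qed
    show ?thesis
    proof (cases "p - 2 - j < N")
      case True
      then have "X ^ (p - 2) * (\<Sum>i<N. (if i = p - 2 - j then 1 else 0) / X ^ i) = X ^ j"
        unfolding s eq using X0 by simp
      then show ?thesis by simp
    next
      case False
      then have "norm X ^ N \<le> norm X ^ (p - 2 - j)" using X by (intro power_increasing) auto
      then have "norm X ^ j * norm X ^ N \<le> norm X ^ (p - 2)"
        unfolding norm_power[symmetric] eq norm_mult by (simp add: norm_power mult_left_mono)
      then show ?thesis using False X0 unfolding s by (simp add: norm_power le_divide_eq)
    qed
  qed
  then show "\<exists>K. \<forall>X\<in>V. norm X \<ge> 1 \<longrightarrow>
      norm (X ^ j - X ^ (p - 2) * (\<Sum>i<N. (if i = p - 2 - j then 1 else 0) / X ^ i)) \<le> K * norm X ^ (p - 2) / norm X ^ N"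
    by blast
qed (use that in blast)

end

section \<open>Domains around the turning point\<close>

lemma lin_sol_cong:
  "lin_sol p \<epsilon> f z D \<Longrightarrow> (\<And>x. x \<in> D \<Longrightarrow> f x = f' x) \<Longrightarrow> lin_sol p \<epsilon> f' z D"
  by (simp add: lin_sol_def)

lemma holomorphic_split:
  assumes "a holomorphic_on ball 0 r"
  obtains c b where "b holomorphic_on ball 0 r" "\<And>x. (a x :: complex) = (\<Sum>j<n. c j * x ^ j) + x ^ n * b x"
proof -
  have "\<exists>c b. b holomorphic_on ball 0 r \<and> (\<forall>x. a x = (\<Sum>j<n. c j * x ^ j) + x ^ n * b x)"
  proof (induction n)
    case 0
    then show ?case using assms by auto
  next
    case (Suc n)
    then obtain c b where 1: "b holomorphic_on ball 0 r" "\<And>x. a x = (\<Sum>j<n. c j * x ^ j) + x ^ n * b x" by blast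
    obtain b' where 2: "b' holomorphic_on ball 0 r" "\<And>x. b x = b 0 + x * b' x"
      using holomorphic_factor[OF 1(1)] by metis
    have "a x = (\<Sum>j<Suc n. (c(n := b 0)) j * x ^ j) + x ^ Suc n * b' x" for x
    proof -
      have "(\<Sum>j<n. (c(n := b 0)) j * x ^ j) = (\<Sum>j<n. c j * x ^ j)" by (rule sum.cong) auto
      then show ?thesis using 1(2)[of x] 2(2)[of x] by (simp add: algebra_simps)
    qed
    then show ?case using 2(1) by blast
  qed
  then show ?thesis using that by blast
qed

text \<open>Directions that differ from the positive axis by at most pi/2 - 2 \<delta> differ from arg \<epsilon> by at most pi/2 - \<delta>.\<close>

lemma Re_divide_ge:
  fixes w \<epsilon> :: complex
  assumes \<delta>: "0 < \<delta>" "\<delta> \<le> pi / 8" and \<epsilon>: "is_Arg \<epsilon> \<tau>" "\<bar>\<tau>\<bar> \<le> \<delta>" "\<epsilon> \<noteq> 0"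
    and w: "\<bar>Im w\<bar> * sin (2 * \<delta>) \<le> Re w * cos (2 * \<delta>)"
  shows "Re (w / \<epsilon>) \<ge> sin \<delta> * norm w / norm \<epsilon>"
proof -
  have s2: "sin (2 * \<delta>) > 0" using \<delta> by (intro sin_gt_zero) auto
  have c2: "cos (2 * \<delta>) > 0" using \<delta> by (intro cos_gt_zero) auto
  have s1: "sin \<delta> > 0" using \<delta> by (intro sin_gt_zero) auto
  have re0: "Re w \<ge> 0"
  proof -
    have "0 \<le> Re w * cos (2 * \<delta>)" by (rule order_trans[OF _ w]) (use s2 in simp)
    then show ?thesis using c2 by (simp add: zero_le_mult_iff)
  qed
  have n: "norm w * sin (2 * \<delta>) \<le> Re w"
  proof (rule power2_le_imp_le[OF _ re0])
    have "(Im w * sin (2 * \<delta>))\<^sup>2 \<le> (Re w * cos (2 * \<delta>))\<^sup>2"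
      using power_mono[OF w, of 2] s2 by (simp add: power_mult_distrib)
    then have le: "(Im w)\<^sup>2 * (sin (2 * \<delta>))\<^sup>2 \<le> (Re w)\<^sup>2 * (cos (2 * \<delta>))\<^sup>2"
      by (simp only: power_mult_distrib)
    have "(norm w * sin (2 * \<delta>))\<^sup>2 = (Re w)\<^sup>2 * (sin (2 * \<delta>))\<^sup>2 + (Im w)\<^sup>2 * (sin (2 * \<delta>))\<^sup>2"
      by (simp only: power_mult_distrib cmod_power2 distrib_right)
    also have "\<dots> \<le> (Re w)\<^sup>2 * (sin (2 * \<delta>))\<^sup>2 + (Re w)\<^sup>2 * (cos (2 * \<delta>))\<^sup>2"
      using le by (rule add_left_mono)
    also have "\<dots> = (Re w)\<^sup>2" by (simp only: distrib_left[symmetric] sin_cos_squared_add mult_1_right)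
    finally show "(norm w * sin (2 * \<delta>))\<^sup>2 \<le> (Re w)\<^sup>2" .
  qed
  have "cos \<delta> \<le> cos \<bar>\<tau>\<bar>" using \<epsilon>(2) \<delta> by (intro cos_monotone_0_pi_le) auto
  then have ct: "cos \<delta> \<le> cos \<tau>" by simp
  have st: "\<bar>sin \<tau>\<bar> \<le> sin \<delta>"
  proof -
    have "sin (- \<delta>) \<le> sin \<tau>" using \<epsilon>(2) \<delta> by (intro sin_monotone_2pi_le) auto
    moreover have "sin \<tau> \<le> sin \<delta>" using \<epsilon>(2) \<delta> by (intro sin_monotone_2pi_le) auto
    ultimately show ?thesis by simp
  qed
  define n where "n = norm \<epsilon>"
  have e: "\<epsilon> = of_real n * cis \<tau>" using \<epsilon>(1) by (simp only: is_Arg_cis n_def)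
  have "w / \<epsilon> = of_real (1 / n) * (w * cis (- \<tau>))"
    unfolding e divide_inverse inverse_mult_distrib cis_inverse by simp
  then have "Re (w / \<epsilon>) = 1 / n * Re (w * cis (- \<tau>))" by (simp only: Re_of_real_mult)
  also have "Re (w * cis (- \<tau>)) = Re w * cos \<tau> + Im w * sin \<tau>" by simp
  finally have 1: "Re (w / \<epsilon>) = 1 / n * (Re w * cos \<tau> + Im w * sin \<tau>)" .
  have "- (\<bar>Im w\<bar> * sin \<delta>) \<le> Im w * sin \<tau>"
  proof -
    have "\<bar>Im w * sin \<tau>\<bar> \<le> \<bar>Im w\<bar> * sin \<delta>" unfolding abs_mult using st by (rule mult_left_mono) simp
    then show ?thesis by linarith
  qed
  moreover have "Re w * cos \<delta> \<le> Re w * cos \<tau>" using ct re0 by (rule mult_left_mono)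
  ultimately have 2: "Re w * cos \<delta> - \<bar>Im w\<bar> * sin \<delta> \<le> Re w * cos \<tau> + Im w * sin \<tau>" by linarith
  have "sin (2 * \<delta>) * (norm w * sin \<delta>) \<le> Re w * sin \<delta>"
    using mult_right_mono[OF n, of "sin \<delta>"] s1 by (simp add: mult_ac)
  also have "\<dots> = Re w * (sin (2 * \<delta>) * cos \<delta> - cos (2 * \<delta>) * sin \<delta>)"
    using sin_diff[of "2 * \<delta>" \<delta>] by simp
  also have "\<dots> = sin (2 * \<delta>) * (Re w * cos \<delta>) - (Re w * cos (2 * \<delta>)) * sin \<delta>"
    by (simp add: algebra_simps)
  also have "\<dots> \<le> sin (2 * \<delta>) * (Re w * cos \<delta>) - (\<bar>Im w\<bar> * sin (2 * \<delta>)) * sin \<delta>"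
    using w s1 by (intro diff_left_mono mult_right_mono) auto
  also have "\<dots> = sin (2 * \<delta>) * (Re w * cos \<delta> - \<bar>Im w\<bar> * sin \<delta>)"
    by (simp add: algebra_simps)
  finally have "norm w * sin \<delta> \<le> Re w * cos \<delta> - \<bar>Im w\<bar> * sin \<delta>"
    using s2 by (simp only: mult_le_cancel_left_pos)
  with 2 have "norm w * sin \<delta> \<le> Re w * cos \<tau> + Im w * sin \<tau>" by linarith
  then have "1 / n * (norm w * sin \<delta>) \<le> Re (w / \<epsilon>)"
    unfolding 1 by (rule mult_left_mono) (simp add: n_def)
  then show ?thesis by (simp add: mult_ac n_def)
qed

text \<open>Outer coefficients live on |x| < r and solutions on |x| < R. The vertices v of the cones below range from vlo to R^p; the bound
for \<mu> \<eta>1 puts the disc of radius \<mu> |\<eta>| into all of them.\<close>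

locale turning_point = inner_domain +
  fixes r R \<eta>1 vlo :: real and S :: "complex set"
  assumes R: "R > 0" "R < r" and \<eta>1: "\<eta>1 > 0" "\<eta>1 \<le> 1"
    and vlo: "vlo > 0" "vlo < R ^ p" and \<mu>\<eta>1: "(\<mu> * \<eta>1) ^ p \<le> vlo * cos (2 * \<delta>)"
  defines "S \<equiv> sector (- (\<delta> / real p)) (\<delta> / real p) \<eta>1"
begin

definition B :: real where "B = 3 * pi / 2 - 2 * \<delta>"

text \<open>The points x for which x^p lies in the cone with vertex v that opens to the left with half-angle pi/2 - 2 \<delta>. Seen from such
a point, the vertex lies in a direction of increasing Re (u/\<epsilon>).\<close>

definition Om :: "real \<Rightarrow> complex \<Rightarrow> complex set" where
  "Om v \<eta> = {x \<in> quasi_sector (- (B / real p)) (B / real p) (ereal R) (\<mu> * norm \<eta>).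
     \<bar>Im (x ^ p)\<bar> * sin (2 * \<delta>) < (v - Re (x ^ p)) * cos (2 * \<delta>)}"

definition \<Omega> :: "real \<Rightarrow> (complex \<times> complex) set" where
  "\<Omega> v = {(x, \<eta>). \<eta> \<in> S \<and> x \<in> Om v \<eta>}"

lemma trig2: "sin (2 * \<delta>) > 0" "cos (2 * \<delta>) > 0" "cos (2 * \<delta>) \<le> 1"
  using \<delta> by (auto intro: sin_gt_zero cos_gt_zero)

lemma B_pos: "B > 0" "B \<ge> pi"
  using \<delta> pi_gt_zero unfolding B_def by linarith+

lemma S_D:
  assumes "\<eta> \<in> S"
  shows "\<eta> \<noteq> 0" "norm \<eta> > 0" "norm \<eta> < \<eta>1" "norm \<eta> \<le> 1" "norm (\<eta> ^ p) = norm \<eta> ^ p" "\<eta> ^ p \<noteq> 0"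
    "arg_between (- (\<delta> / real p)) (\<delta> / real p) \<eta>"
  using assms \<eta>1 unfolding S_def sector_def by (auto simp: norm_power)

lemma S_arg:
  assumes "\<eta> \<in> S"
  obtains \<tau> where "is_Arg (\<eta> ^ p) \<tau>" "\<bar>\<tau>\<bar> < \<delta>"
proof -
  obtain t where t: "- (\<delta> / real p) < t" "t < \<delta> / real p" "is_Arg \<eta> t"
    using S_D(7)[OF assms] unfolding arg_between_def by blast
  have "\<bar>real p * t\<bar> < \<delta>" using t(1,2) p0 by (auto simp: abs_less_iff field_simps)
  then show ?thesis using is_Arg_power[OF t(3)] that by blast
qed

lemma \<mu>h_le:
  assumes "\<eta> \<in> S" "vlo \<le> v"
  shows "(\<mu> * norm \<eta>) ^ p < v * cos (2 * \<delta>)" "(\<mu> * norm \<eta>) ^ p < v"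
proof -
  have "(\<mu> * norm \<eta>) ^ p < (\<mu> * \<eta>1) ^ p"
    using S_D[OF assms(1)] \<mu> p0 by (intro power_strict_mono) auto
  also have "\<dots> \<le> vlo * cos (2 * \<delta>)" by (rule \<mu>\<eta>1)
  also have "\<dots> \<le> v * cos (2 * \<delta>)" using assms(2) trig2 by simp
  finally show 1: "(\<mu> * norm \<eta>) ^ p < v * cos (2 * \<delta>)" .
  have "v * cos (2 * \<delta>) \<le> v * 1" using trig2 assms vlo by (intro mult_left_mono) auto
  with 1 show "(\<mu> * norm \<eta>) ^ p < v" by simp
qed

text \<open>The boundary of the cone has distance v cos (2 \<delta>) from 0; this explains the bound for the radius r1 in the theorem.\<close>

lemma cone_of_norm:
  assumes "norm u < v * cos (2 * \<delta>)"
  shows "\<bar>Im u\<bar> * sin (2 * \<delta>) < (v - Re u) * cos (2 * \<delta>)"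
proof -
  have id: "(a * s + b * c)\<^sup>2 + (a * c - b * s)\<^sup>2 = (a\<^sup>2 + b\<^sup>2) * (s\<^sup>2 + c\<^sup>2)" for a b s c :: real
    by (simp add: power2_eq_square algebra_simps)
  have "(\<bar>Im u\<bar> * sin (2 * \<delta>) + Re u * cos (2 * \<delta>))\<^sup>2 \<le>
      (\<bar>Im u\<bar> * sin (2 * \<delta>) + Re u * cos (2 * \<delta>))\<^sup>2 + (\<bar>Im u\<bar> * cos (2 * \<delta>) - Re u * sin (2 * \<delta>))\<^sup>2"
    by simp
  also have "\<dots> = (norm u)\<^sup>2" unfolding id by (simp add: cmod_power2 add.commute)
  finally have "(\<bar>Im u\<bar> * sin (2 * \<delta>) + Re u * cos (2 * \<delta>))\<^sup>2 \<le> (norm u)\<^sup>2" .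
  then have "\<bar>Im u\<bar> * sin (2 * \<delta>) + Re u * cos (2 * \<delta>) \<le> norm u"
    by (rule power2_le_imp_le) simp
  with assms show ?thesis by (simp add: algebra_simps)
qed

lemma Om_open: "open (Om v \<eta>)"
proof -
  have "Om v \<eta> = quasi_sector (- (B / real p)) (B / real p) (ereal R) (\<mu> * norm \<eta>) \<inter>
      {x. \<bar>Im (x ^ p)\<bar> * sin (2 * \<delta>) < (v - Re (x ^ p)) * cos (2 * \<delta>)}"
    by (auto simp: Om_def)
  moreover have "open {x :: complex. \<bar>Im (x ^ p)\<bar> * sin (2 * \<delta>) < (v - Re (x ^ p)) * cos (2 * \<delta>)}"
    by (intro open_Collect_less continuous_intros)
  ultimately show ?thesis using open_quasi_sector by (simp add: open_Int)
qed

lemma Om_disc: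
  assumes "\<eta> \<in> S" "vlo \<le> v" "norm x < \<mu> * norm \<eta>"
  shows "x \<in> Om v \<eta>"
proof -
  have "norm (x ^ p) < (\<mu> * norm \<eta>) ^ p" unfolding norm_power
    using assms(3) p0 by (intro power_strict_mono) auto
  also have "\<dots> < v * cos (2 * \<delta>)" by (rule \<mu>h_le[OF assms(1,2)])
  finally show ?thesis using assms(3) cone_of_norm by (simp add: Om_def quasi_sector_def)
qed

lemma Om_real:
  assumes "0 < t" "t ^ p < v" "v \<le> R ^ p"
  shows "of_real t \<in> Om v \<eta>"
proof -
  have "t ^ p < R ^ p" using assms by simp
  then have "t < R" by (rule power_less_imp_less_base) (use R in simp)
  moreover have "arg_between (- (B / real p)) (B / real p) (of_real t)"
    using B_pos p0 assms(1) by (intro arg_between_of_real) auto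
  moreover have "Im (complex_of_real t ^ p) = 0" "Re (complex_of_real t ^ p) = t ^ p"
    by (simp_all flip: of_real_power)
  ultimately show ?thesis using assms(1,2) trig2 by (simp add: Om_def quasi_sector_def)
qed

lemma Om_norm: "x \<in> Om v \<eta> \<Longrightarrow> \<eta> \<in> S \<Longrightarrow> norm x < R"
proof -
  assume x: "x \<in> Om v \<eta>" and \<eta>: "\<eta> \<in> S"
  have "(\<mu> * norm \<eta>) ^ p < R ^ p" using \<mu>h_le(2)[OF \<eta> order_refl] vlo by simp
  then have "\<mu> * norm \<eta> < R" by (rule power_less_imp_less_base) (use R in simp)
  then show ?thesis using x by (auto simp: Om_def quasi_sector_def)
qed

lemma cone_scale:
  assumes "\<bar>Im u\<bar> * sin (2 * \<delta>) < (v - Re u) * cos (2 * \<delta>)" "0 \<le> k" "k \<le> 1" "v > 0"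
  shows "\<bar>Im (of_real k * u)\<bar> * sin (2 * \<delta>) < (v - Re (of_real k * u)) * cos (2 * \<delta>)"
proof (cases "k = 0")
  case True
  then show ?thesis using assms trig2 by simp
next
  case False
  then have k: "k > 0" using assms by simp
  have "\<bar>Im (of_real k * u)\<bar> * sin (2 * \<delta>) = k * (\<bar>Im u\<bar> * sin (2 * \<delta>))"
    using k by (simp add: abs_mult)
  also have "\<dots> < k * ((v - Re u) * cos (2 * \<delta>))" using assms(1) k by (rule mult_strict_left_mono)
  also have "\<dots> = (k * v - k * Re u) * cos (2 * \<delta>)" by (simp add: algebra_simps)
  also have "\<dots> \<le> (v - Re (of_real k * u)) * cos (2 * \<delta>)"
    using assms trig2 by (intro mult_right_mono) (auto simp: mult_left_le_one_le)
  finally show ?thesis .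
qed

lemma Om_star:
  assumes x: "x \<in> Om v \<eta>" and \<eta>: "\<eta> \<in> S" and v: "vlo \<le> v" and k: "0 \<le> k" "k \<le> 1"
  shows "of_real k * x \<in> Om v \<eta>"
proof -
  have "of_real k * x \<in> quasi_sector (- (B / real p)) (B / real p) (ereal R) (\<mu> * norm \<eta>)"
    using x S_D(2)[OF \<eta>] \<mu> by (intro quasi_sector_scale k) (auto simp: Om_def)
  moreover have "(of_real k * x) ^ p = of_real (k ^ p) * x ^ p" by (simp add: power_mult_distrib)
  moreover have "\<bar>Im (of_real (k ^ p) * x ^ p)\<bar> * sin (2 * \<delta>) < (v - Re (of_real (k ^ p) * x ^ p)) * cos (2 * \<delta>)"
    using x v vlo k by (intro cone_scale) (auto simp: Om_def power_le_one)
  ultimately show ?thesis unfolding Om_def by simp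
qed

lemma Om_front_or_back:
  assumes x: "x \<in> Om v \<eta>" and \<eta>: "\<eta> \<in> S" and n: "norm x \<ge> \<mu> * norm \<eta>"
  shows "front p x \<or> Re (x ^ p / \<eta> ^ p) \<le> - sin \<delta> * norm x ^ p / norm (\<eta> ^ p)"
proof -
  obtain \<tau> where "is_Arg (\<eta> ^ p) \<tau>" "\<bar>\<tau>\<bar> < \<delta>" using S_arg[OF \<eta>] by blast
  then show ?thesis
    using x n by (intro front_or_back[OF p0 \<delta>, of B]) (auto simp: Om_def quasi_sector_def B_def)
qed

lemma Om_dir:
  assumes "\<eta> \<in> S" "\<bar>Im u\<bar> * sin (2 * \<delta>) \<le> (b - Re u) * cos (2 * \<delta>)"
  shows "Re ((of_real b - u) / \<eta> ^ p) \<ge> sin \<delta> * norm (of_real b - u) / norm (\<eta> ^ p)"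
proof -
  obtain \<tau> where "is_Arg (\<eta> ^ p) \<tau>" "\<bar>\<tau>\<bar> < \<delta>" using S_arg[OF assms(1)] by blast
  then show ?thesis using assms(2) S_D(6)[OF assms(1)] by (intro Re_divide_ge[OF \<delta>]) auto
qed

lemma Om_segment:
  assumes x: "x \<in> Om v \<eta>" "front p x" "x \<noteq> 0" and \<eta>: "\<eta> \<in> S"
    and b: "0 < b" "b < v" "v \<le> R ^ p" and s: "0 \<le> s" "s \<le> 1"
  shows "croot p (x ^ p + of_real s * (of_real b - x ^ p)) \<in> Om v \<eta>"
proof -
  define u where "u = x ^ p"
  define w where "w = u + of_real s * (of_real b - u)"
  have slit: "w \<notin> \<real>\<^sub>\<le>\<^sub>0" unfolding w_def u_def
    by (rule segment_slit) (use x b s in \<open>auto simp: front_def norm_power\<close>)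
  have "norm u < R ^ p" unfolding u_def norm_power using Om_norm[OF x(1) \<eta>] p0
    by (intro power_strict_mono) auto
  then have "(1 - s) * norm u + s * b < R ^ p"
  proof -
    have "(1 - s) * norm u + s * b \<le> (1 - s) * max (norm u) b + s * max (norm u) b"
      using s by (intro add_mono mult_left_mono) auto
    also have "\<dots> = max (norm u) b" by (simp add: algebra_simps)
    also have "\<dots> < R ^ p" using \<open>norm u < R ^ p\<close> b by simp
    finally show ?thesis .
  qed
  moreover have "norm w \<le> (1 - s) * norm u + s * b"
  proof -
    have "w = of_real (1 - s) * u + of_real (s * b)" by (simp add: w_def algebra_simps)
    then have "norm w \<le> norm (of_real (1 - s) * u) + norm (of_real (s * b) :: complex)"
      using norm_triangle_ineq by metis
    also have "\<dots> = \<bar>1 - s\<bar> * norm u + \<bar>s * b\<bar>" by (simp only: norm_mult norm_of_real)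
    also have "\<dots> = (1 - s) * norm u + s * b" using s b by simp
    finally show ?thesis .
  qed
  ultimately have "norm (croot p w) ^ p < R ^ p" by (simp add: norm_croot_power[OF p0])
  then have nw: "norm (croot p w) < R"
    by (rule power_less_imp_less_base) (use R in simp)
  have "\<bar>Im w\<bar> * sin (2 * \<delta>) < (v - Re w) * cos (2 * \<delta>)"
  proof -
    have cone: "\<bar>Im u\<bar> * sin (2 * \<delta>) < (v - Re u) * cos (2 * \<delta>)" using x(1) by (simp add: Om_def u_def)
    have vb: "0 < (v - b) * cos (2 * \<delta>)" using b trig2 by simp
    have e1: "\<bar>Im w\<bar> * sin (2 * \<delta>) = (1 - s) * (\<bar>Im u\<bar> * sin (2 * \<delta>))"
    proof -
      have "Im w = (1 - s) * Im u" by (simp add: w_def algebra_simps)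
      then show ?thesis using s by (simp add: abs_mult)
    qed
    have e2: "(v - Re w) * cos (2 * \<delta>) = (1 - s) * ((v - Re u) * cos (2 * \<delta>)) + s * ((v - b) * cos (2 * \<delta>))"
      by (simp add: w_def algebra_simps)
    show ?thesis
    proof (cases "s = 1")
      case True then show ?thesis unfolding e1 e2 using vb by simp
    next
      case False
      then have "(1 - s) * (\<bar>Im u\<bar> * sin (2 * \<delta>)) < (1 - s) * ((v - Re u) * cos (2 * \<delta>))"
        using s cone by (intro mult_strict_left_mono) auto
      moreover have "0 \<le> s * ((v - b) * cos (2 * \<delta>))" using s vb by simp
      ultimately show ?thesis unfolding e1 e2 by linarith
    qed
  qed
  then have "croot p w \<in> Om v \<eta>"
    using nw arg_between_croot[OF p0 slit B_pos(2)] by (simp add: Om_def quasi_sector_def croot_power[OF p0])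
  then show ?thesis unfolding w_def u_def .
qed

lemma weight_const:
  assumes "norm (y::complex) \<le> M" "h > 0"
  shows "norm y \<le> M * ((norm (t::complex) + h) / h) ^ n"
proof -
  have "0 \<le> M" using assms(1) norm_ge_zero order_trans by blast
  moreover have "1 \<le> ((norm t + h) / h) ^ n" using assms(2) by (intro one_le_power) simp
  ultimately have "M * 1 \<le> M * ((norm t + h) / h) ^ n" by (intro mult_left_mono)
  with assms(1) show ?thesis by simp
qed

lemma front_step:
  assumes z: "lin_sol p (\<eta> ^ p) f z (Om v \<eta>)" and M: "\<And>t. t \<in> Om v \<eta> \<Longrightarrow> norm (f t) \<le> M"
    and \<eta>: "\<eta> \<in> S" and x: "x \<in> Om v \<eta>" "front p x" "norm x \<ge> \<mu> * norm \<eta>"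
    and b: "(\<mu> * norm \<eta>) ^ p \<le> b" "b < v" "v \<le> R ^ p"
    and cone: "\<bar>Im (x ^ p)\<bar> * sin (2 * \<delta>) \<le> (b - Re (x ^ p)) * cos (2 * \<delta>)"
  shows "norm (exp (- (of_real b / \<eta> ^ p)) * z (of_real (root p b)) - exp (- (x ^ p / \<eta> ^ p)) * z x)
         \<le> step_const p \<mu> (sin \<delta>) * (M * norm \<eta>) * exp (- Re (x ^ p / \<eta> ^ p))"
proof (rule front_bound_scaled[OF p0 S_D(2)[OF \<eta>] S_D(5)[OF \<eta>] sin\<delta>(1) \<mu> x(2,3) b(1) _ z _ weight_const[OF M S_D(2)[OF \<eta>]]])
  have \<mu>h: "0 < \<mu> * norm \<eta>" using \<mu> S_D(2)[OF \<eta>] by simp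
  then have b0: "b > 0" using b(1) by (meson less_le_trans zero_less_power)
  show "croot p (x ^ p + of_real s * (of_real b - x ^ p)) \<in> Om v \<eta>" if "0 \<le> s" "s \<le> 1" for s
    by (rule Om_segment[OF x(1,2) _ \<eta> b0 b(2,3) that]) (use x(3) \<mu>h in auto)
  show "M \<ge> 0" using M[OF x(1)] norm_ge_zero order_trans by blast
  show "sin \<delta> * norm (of_real b - x ^ p) / norm (\<eta> ^ p) \<le> Re ((of_real b - x ^ p) / \<eta> ^ p)"
    by (rule Om_dir[OF \<eta> cone])
qed

lemma extend_Om:
  assumes z: "lin_sol p (\<eta> ^ p) f z (Om v \<eta>)" and M: "\<And>t. t \<in> Om v \<eta> \<Longrightarrow> norm (f t) \<le> M"
    and \<eta>: "\<eta> \<in> S" and v: "vlo \<le> v" "v \<le> R ^ p"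
    and Q: "\<And>x. x \<in> Om v \<eta> \<Longrightarrow> norm x \<ge> \<mu> * norm \<eta> \<Longrightarrow> front p x \<Longrightarrow> norm (z x) \<le> Q"
    and x: "x \<in> Om v \<eta>"
  shows "norm (z x) \<le> ext_const p \<mu> (sin \<delta>) * (Q + M * norm \<eta>)"
proof (rule extend_bound[OF p0 S_D(2)[OF \<eta>] S_D(5)[OF \<eta>] sin\<delta>(1) \<mu> _ _ Om_star[OF _ \<eta> v(1)]
      Om_front_or_back[OF _ \<eta>] z weight_const[OF M S_D(2)[OF \<eta>]] Q x])
  show "ball 0 (\<mu> * norm \<eta>) \<subseteq> Om v \<eta>" using Om_disc[OF \<eta> v(1)] by auto
  show "of_real (\<mu> * norm \<eta>) \<in> Om v \<eta>"
    using \<mu> S_D(2)[OF \<eta>] \<mu>h_le(2)[OF \<eta> v(1)] v(2) by (intro Om_real) auto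
qed

lemma Om_mono: "v' \<le> v \<Longrightarrow> Om v' \<eta> \<subseteq> Om v \<eta>"
proof
  fix x assume v: "v' \<le> v" and x: "x \<in> Om v' \<eta>"
  have "(v' - Re (x ^ p)) * cos (2 * \<delta>) \<le> (v - Re (x ^ p)) * cos (2 * \<delta>)"
    using v trig2 by (intro mult_right_mono) auto
  then show "x \<in> Om v \<eta>" using x by (auto simp: Om_def)
qed

text \<open>The value at a real point close to the vertex v enters multiplied by exp ((x^p - b)/\<epsilon>), which is exponentially small in
the cone with vertex v' < v.\<close>

lemma solution_small:
  assumes v: "vlo \<le> v'" "v' < v" "v \<le> R ^ p"
  obtains C where "C \<ge> 0" "\<And>\<eta> f z Z M x. \<eta> \<in> S \<Longrightarrow> lin_sol p (\<eta> ^ p) f z (Om v \<eta>) \<Longrightarrow>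
      (\<And>t. t \<in> Om v \<eta> \<Longrightarrow> norm (f t) \<le> M) \<Longrightarrow> (\<And>t. t \<in> Om v \<eta> \<Longrightarrow> norm (z t) \<le> Z) \<Longrightarrow>
      x \<in> Om v' \<eta> \<Longrightarrow> norm (z x) \<le> C * norm \<eta> * (Z + M)"
proof -
  define k where "k = sin \<delta> * (v - v') / 2"
  have k: "k > 0" using sin\<delta> v by (simp add: k_def)
  define s where "s = step_const p \<mu> (sin \<delta>)"
  have s: "s > 0" unfolding s_def by (rule step_const_pos[OF p0 \<mu> sin\<delta>(1)])
  define E where "E = ext_const p \<mu> (sin \<delta>)"
  have E: "E \<ge> 1" unfolding E_def by (rule ext_const_ge_1[OF p0 \<mu> sin\<delta>(1)])
  define C where "C = E * (1 / k + s + 1)"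
  show ?thesis
  proof (rule that[of C])
    show "C \<ge> 0" using E k s by (simp add: C_def)
    fix \<eta> f z Z M x
    assume \<eta>: "\<eta> \<in> S" and z: "lin_sol p (\<eta> ^ p) f z (Om v \<eta>)" and M: "\<And>t. t \<in> Om v \<eta> \<Longrightarrow> norm (f t) \<le> M"
      and Z: "\<And>t. t \<in> Om v \<eta> \<Longrightarrow> norm (z t) \<le> Z" and x: "x \<in> Om v' \<eta>"
    define h where "h = norm \<eta>"
    have h: "0 < h" "h \<le> 1" using S_D[OF \<eta>] by (auto simp: h_def)
    have sub: "Om v' \<eta> \<subseteq> Om v \<eta>" using v by (intro Om_mono) auto
    have x0: "0 \<in> Om v \<eta>" by (rule Om_disc[OF \<eta>]) (use v S_D[OF \<eta>] \<mu> in auto)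
    have M0: "M \<ge> 0" using M[OF x0] norm_ge_zero order_trans by blast
    have Z0: "Z \<ge> 0" using Z[OF x0] norm_ge_zero order_trans by blast
    define b where "b = (v' + v) / 2"
    have b: "v' < b" "b < v" "b - v' = (v - v') / 2" using v by (auto simp: b_def field_simps)
    have Q: "norm (z t) \<le> Z * (h / k) + s * (M * h)"
      if t: "t \<in> Om v' \<eta>" "norm t \<ge> \<mu> * norm \<eta>" "front p t" for t
    proof -
      have cone': "\<bar>Im (t ^ p)\<bar> * sin (2 * \<delta>) < (v' - Re (t ^ p)) * cos (2 * \<delta>)" using t(1) by (simp add: Om_def)
      have "0 \<le> \<bar>Im (t ^ p)\<bar> * sin (2 * \<delta>)" using trig2 by simp
      with cone' have "0 < (v' - Re (t ^ p)) * cos (2 * \<delta>)" by linarith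
      then have Ret: "Re (t ^ p) < v'" using trig2 by (simp add: zero_less_mult_iff)
      have "(v' - Re (t ^ p)) * cos (2 * \<delta>) \<le> (b - Re (t ^ p)) * cos (2 * \<delta>)"
        using b trig2 by (intro mult_right_mono) auto
      with cone' have cone: "\<bar>Im (t ^ p)\<bar> * sin (2 * \<delta>) \<le> (b - Re (t ^ p)) * cos (2 * \<delta>)" by linarith
      have "(\<mu> * norm \<eta>) ^ p \<le> b" using \<mu>h_le(2)[OF \<eta> v(1)] b by linarith
      note st = front_step[OF z M \<eta> subsetD[OF sub t(1)] t(3,2) this b(2) v(3) cone, folded s_def h_def]
      have "b > 0" using b v vlo by linarith
      have zb: "norm (z (of_real (root p b))) \<le> Z"
        using \<open>b > 0\<close> b v p0 by (intro Z Om_real) auto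
      have "norm (exp (- (t ^ p / \<eta> ^ p)) * z t) \<le> norm (exp (- (of_real b / \<eta> ^ p)) * z (of_real (root p b)))
          + s * (M * h) * exp (- Re (t ^ p / \<eta> ^ p))"
        by (rule norm_le_of_diff[OF st])
      also have "\<dots> \<le> exp (- Re (of_real b / \<eta> ^ p)) * Z + s * (M * h) * exp (- Re (t ^ p / \<eta> ^ p))"
        unfolding norm_mult norm_exp_eq_Re uminus_complex.sel by (intro add_right_mono mult_left_mono zb) simp
      finally have 1: "exp (- Re (t ^ p / \<eta> ^ p)) * norm (z t)
          \<le> exp (- Re (of_real b / \<eta> ^ p)) * Z + s * (M * h) * exp (- Re (t ^ p / \<eta> ^ p))"
        unfolding norm_mult norm_exp_eq_Re uminus_complex.sel .
      have "norm (of_real b - t ^ p) \<ge> Re (of_real b - t ^ p)" by (rule complex_Re_le_cmod)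
      then have nb: "norm (of_real b - t ^ p) \<ge> (v - v') / 2" using Ret b by simp
      have "k / h \<le> k / h ^ p"
        using h k p0 power_decreasing[of 1 p h] by (intro divide_left_mono) auto
      also have "\<dots> = sin \<delta> * ((v - v') / 2) / norm (\<eta> ^ p)" by (simp add: k_def h_def norm_power)
      also have "\<dots> \<le> sin \<delta> * norm (of_real b - t ^ p) / norm (\<eta> ^ p)"
        using nb sin\<delta> by (intro divide_right_mono mult_left_mono) auto
      also have "\<dots> \<le> Re ((of_real b - t ^ p) / \<eta> ^ p)" by (rule Om_dir[OF \<eta> cone])
      finally have "k / h \<le> Re (of_real b / \<eta> ^ p) - Re (t ^ p / \<eta> ^ p)" by (simp add: diff_divide_distrib)
      then have "exp (- Re (of_real b / \<eta> ^ p)) \<le> exp (- Re (t ^ p / \<eta> ^ p)) * exp (- (k / h))"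
        unfolding exp_add[symmetric] by simp
      also have "\<dots> \<le> exp (- Re (t ^ p / \<eta> ^ p)) * (h / k)"
      proof (rule mult_left_mono)
        have "exp (- (k / h)) \<le> fact 1 / (k / h) ^ 1" using k h by (intro exp_minus_le_power) auto
        then show "exp (- (k / h)) \<le> h / k" by simp
      qed simp
      finally have "exp (- Re (of_real b / \<eta> ^ p)) * Z \<le> exp (- Re (t ^ p / \<eta> ^ p)) * (h / k) * Z"
        using Z0 by (rule mult_right_mono)
      with 1 have "exp (- Re (t ^ p / \<eta> ^ p)) * norm (z t)
          \<le> exp (- Re (t ^ p / \<eta> ^ p)) * (Z * (h / k) + s * (M * h))"
        by (simp add: algebra_simps)
      then show ?thesis by (simp only: mult_le_cancel_left_pos exp_gt_zero)
    qed
    have "v' \<le> R ^ p" using v by simp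
    have "norm (z x) \<le> E * ((Z * (h / k) + s * (M * h)) + M * norm \<eta>)"
      unfolding E_def
      by (rule extend_Om[OF lin_sol_subset[OF z sub] M \<eta> v(1) \<open>v' \<le> R ^ p\<close> Q x]) (use sub in auto)
    also have "\<dots> = E * h * (1 / k * Z + s * M + 1 * M)" by (simp add: h_def algebra_simps)
    also have "\<dots> \<le> E * h * ((1 / k) * (Z + M) + s * (Z + M) + 1 * (Z + M))"
      using E h k s M0 Z0 by (intro mult_left_mono add_mono) auto
    also have "\<dots> = C * norm \<eta> * (Z + M)" by (simp add: C_def h_def algebra_simps)
    finally show "norm (z x) \<le> C * norm \<eta> * (Z + M)" .
  qed
qed

end

section \<open>Composite expansions of solutions of the linear equation\<close>

lemma inner_lin_sol:
  assumes h: "lin_sol p 1 g h V" and \<eta>: "\<eta> \<noteq> 0" and p: "p > 0"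
    and D: "\<And>x. x \<in> D \<Longrightarrow> x / \<eta> \<in> V"
  shows "lin_sol p (\<eta> ^ p) (\<lambda>x. g (x / \<eta>)) (\<lambda>x. \<eta> * h (x / \<eta>)) D"
  unfolding lin_sol_def
proof
  fix x assume "x \<in> D"
  have 1: "((\<lambda>x. x / \<eta>) has_field_derivative 1 / \<eta>) (at x)"
    by (rule DERIV_cdivide[OF DERIV_ident])
  have "((\<lambda>x. h (x / \<eta>)) has_field_derivative
      (of_nat p * (x / \<eta>) ^ (p - 1) / 1 * h (x / \<eta>) + g (x / \<eta>)) * (1 / \<eta>)) (at x)"
    by (rule DERIV_chain2[OF lin_solD[OF h D[OF \<open>x \<in> D\<close>]] 1])
  from DERIV_cmult[OF this, of \<eta>]
  have "((\<lambda>x. \<eta> * h (x / \<eta>)) has_field_derivative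
      \<eta> * ((of_nat p * (x / \<eta>) ^ (p - 1) / 1 * h (x / \<eta>) + g (x / \<eta>)) * (1 / \<eta>))) (at x)" .
  moreover have "\<eta> * ((of_nat p * (x / \<eta>) ^ (p - 1) / 1 * h (x / \<eta>) + g (x / \<eta>)) * (1 / \<eta>))
      = of_nat p * x ^ (p - 1) / \<eta> ^ p * (\<eta> * h (x / \<eta>)) + g (x / \<eta>)"
  proof -
    have "\<eta> ^ p = \<eta> ^ (p - 1) * \<eta>" using p by (metis power_minus_mult)
    then show ?thesis using \<eta> by (simp add: power_divide distrib_left add_divide_distrib)
  qed
  ultimately show "((\<lambda>x. \<eta> * h (x / \<eta>)) has_field_derivative
      of_nat p * x ^ (p - 1) / \<eta> ^ p * (\<eta> * h (x / \<eta>)) + g (x / \<eta>)) (at x)" by (simp only:)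
qed

text \<open>Integration by parts: the term x^(p-1) b is produced by - \<epsilon> b/p, at the cost of the small term \<epsilon> b'/p.\<close>

lemma outer_lin_sol:
  assumes b: "b holomorphic_on ball 0 r" and \<epsilon>: "\<epsilon> \<noteq> 0" and p: "p > 0" and D: "D \<subseteq> ball 0 r"
  shows "lin_sol p \<epsilon> (\<lambda>x. x ^ (p - 1) * b x - \<epsilon> / of_nat p * deriv b x) (\<lambda>x. - (\<epsilon> / of_nat p) * b x) D"
  unfolding lin_sol_def
proof
  fix x assume "x \<in> D"
  then have "(b has_field_derivative deriv b x) (at x)"
    using b D by (intro holomorphic_derivI[of _ "ball 0 r"]) auto
  from DERIV_cmult[OF this, of "- (\<epsilon> / of_nat p)"]
  show "((\<lambda>x. - (\<epsilon> / of_nat p) * b x) has_field_derivative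
      of_nat p * x ^ (p - 1) / \<epsilon> * (- (\<epsilon> / of_nat p) * b x) + (x ^ (p - 1) * b x - \<epsilon> / of_nat p * deriv b x)) (at x)"
    using \<epsilon> p by simp
qed

context turning_point
begin

lemma \<Omega>_iff: "(x, \<eta>) \<in> \<Omega> v \<longleftrightarrow> \<eta> \<in> S \<and> x \<in> Om v \<eta>"
  by (simp add: \<Omega>_def)

lemma \<Omega>_mono: "v' \<le> v \<Longrightarrow> \<Omega> v' \<subseteq> \<Omega> v"
  using Om_mono unfolding \<Omega>_def by fast

lemma Om_V:
  assumes \<eta>: "\<eta> \<in> S" and x: "x \<in> Om v \<eta>"
  shows "x / \<eta> \<in> V"
proof (cases "norm x < \<mu> * norm \<eta>")
  case True
  then have "norm (x / \<eta>) < \<mu>" using S_D(2)[OF \<eta>] by (simp add: norm_divide pos_divide_less_eq)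
  then show ?thesis by (rule V_disc)
next
  case False
  then have "arg_between (- (B / real p)) (B / real p) x" using x by (auto simp: Om_def quasi_sector_def)
  from arg_between_divide[OF this S_D(7)[OF \<eta>]]
  have "arg_between (- (B / real p) - \<delta> / real p) (B / real p + \<delta> / real p) (x / \<eta>)" .
  moreover have "B / real p + \<delta> / real p = A / real p" "- (B / real p) - \<delta> / real p = - (A / real p)"
    unfolding B_def A_def using p0 by (simp_all add: field_simps)
  ultimately show ?thesis unfolding V_def quasi_sector_def by simp
qed

lemma dac_domain_\<Omega>: "dac_domain r R V (\<Omega> v)"
proof
  show "R < r" by (rule R)
  fix x \<eta> assume "(x, \<eta>) \<in> \<Omega> v"
  then have "\<eta> \<in> S" "x \<in> Om v \<eta>" by (simp_all add: \<Omega>_iff)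
  then show "norm x \<le> R \<and> x / \<eta> \<in> V \<and> \<eta> \<noteq> 0 \<and> norm \<eta> \<le> 1"
    using Om_norm[of x v \<eta>] Om_V[of \<eta> x v] S_D(1,4)[of \<eta>] by auto
qed

lemma solution_dac_0:
  assumes v: "vlo \<le> v'" "v' < v" "v \<le> R ^ p"
    and z: "\<And>\<eta>. \<eta> \<in> S \<Longrightarrow> lin_sol p (\<eta> ^ p) (\<lambda>x. f x \<eta>) (\<lambda>x. z x \<eta>) (Om v \<eta>)"
    and z0: "dac r V (\<Omega> v) 0 z" and f0: "dac r V (\<Omega> v) 0 f"
  shows "dac r V (\<Omega> v') 0 (\<lambda>x \<eta>. z x \<eta> / \<eta>)"
proof -
  obtain Z where Z: "\<And>x \<eta>. \<eta> \<in> S \<Longrightarrow> x \<in> Om v \<eta> \<Longrightarrow> norm (z x \<eta>) \<le> Z"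
    using z0 unfolding dac.simps \<Omega>_iff by blast
  obtain M where M: "\<And>x \<eta>. \<eta> \<in> S \<Longrightarrow> x \<in> Om v \<eta> \<Longrightarrow> norm (f x \<eta>) \<le> M"
    using f0 unfolding dac.simps \<Omega>_iff by blast
  show ?thesis
  proof (rule solution_small[OF v])
    fix C :: real
    assume C: "\<And>\<eta> f z Z M x. \<eta> \<in> S \<Longrightarrow> lin_sol p (\<eta> ^ p) f z (Om v \<eta>) \<Longrightarrow>
      (\<And>t. t \<in> Om v \<eta> \<Longrightarrow> norm (f t) \<le> M) \<Longrightarrow> (\<And>t. t \<in> Om v \<eta> \<Longrightarrow> norm (z t) \<le> Z) \<Longrightarrow>
      x \<in> Om v' \<eta> \<Longrightarrow> norm (z x) \<le> C * norm \<eta> * (Z + M)"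
    show ?thesis
    proof (rule dac_0I)
      fix x \<eta> assume "(x, \<eta>) \<in> \<Omega> v'"
      then have \<eta>: "\<eta> \<in> S" and x: "x \<in> Om v' \<eta>" by (simp_all add: \<Omega>_iff)
      have "norm (z x \<eta>) \<le> C * norm \<eta> * (Z + M)"
        by (rule C[OF \<eta> z[OF \<eta>] M[OF \<eta>] Z[OF \<eta>] x])
      then show "norm (z x \<eta> / \<eta>) \<le> C * (Z + M)"
        using S_D(2)[OF \<eta>] by (simp add: norm_divide pos_divide_le_eq mult_ac)
    qed
  qed
qed

text \<open>The leading coefficients a and g of the right hand side, with a = \<Sum>j<p-1. c j x^j + x^(p-1) b, are matched by the explicit function
\<eta> q. The difference z - \<eta> q solves an equation whose right hand side has a factor \<eta>; divided by \<eta>, it is covered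
by the induction hypothesis.\<close>

lemma solution_dac:
  assumes v: "vlo \<le> v'" "v' < v" "v \<le> R ^ p"
    and z: "\<And>\<eta>. \<eta> \<in> S \<Longrightarrow> lin_sol p (\<eta> ^ p) (\<lambda>x. f x \<eta>) (\<lambda>x. z x \<eta>) (Om v \<eta>)"
    and z0: "dac r V (\<Omega> v) 0 z" and f: "dac r V (\<Omega> v) N f"
  shows "dac r V (\<Omega> v') N (\<lambda>x \<eta>. z x \<eta> / \<eta>)"
  using v z z0 f
proof (induction N arbitrary: v z f)
  case 0
  show ?case by (rule solution_dac_0[OF 0])
next
  case (Suc N)
  interpret dac_domain r R V "\<Omega> v" by (rule dac_domain_\<Omega>)
  obtain a g f1 where 1: "a holomorphic_on ball 0 r" "g \<in> inner_fun V" "dac r V (\<Omega> v) N f1"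
    "\<And>x \<eta>. (x, \<eta>) \<in> \<Omega> v \<Longrightarrow> f x \<eta> = a x + g (x / \<eta>) + \<eta> * f1 x \<eta>"
    using dac_SucE[OF Suc.prems(6)] by metis
  obtain h where h: "h \<in> inner_fun V" "lin_sol p 1 g h V" using inner_solution[OF 1(2)] by metis
  obtain c b where b: "b holomorphic_on ball 0 r" "\<And>x. a x = (\<Sum>j<p-1. c j * x ^ j) + x ^ (p - 1) * b x"
    using holomorphic_split[OF 1(1)] by metis
  have "\<exists>k. k \<in> inner_fun V \<and> lin_sol p 1 (\<lambda>X. X ^ j) k V" if "j < p - 1" for j
    using monomial_solution[OF that] by blast
  then obtain k where k: "\<And>j. j < p - 1 \<Longrightarrow> k j \<in> inner_fun V" "\<And>j. j < p - 1 \<Longrightarrow> lin_sol p 1 (\<lambda>X. X ^ j) (k j) V"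
    by metis
  have b': "deriv b holomorphic_on ball 0 r" by (rule holomorphic_deriv[OF b(1) open_ball])
  define q where "q = (\<lambda>x \<eta>. h (x / \<eta>) + (\<Sum>j<p-1. \<eta> ^ j * (c j * k j (x / \<eta>))) + \<eta> ^ (p - 1) * (- 1 / of_nat p * b x))"
  have qN: "dac r V (\<Omega> v) M q" for M
    unfolding q_def using k(1) h(1) b(1)
    by (intro dac_add dac_sum dac_eta_power dac_inner dac_outer holomorphic_on_mult holomorphic_on_const
        dac_inner[where g = "\<lambda>X. c _ * k _ X"] inner_fun_cmult) auto
  define z1 where "z1 = (\<lambda>x \<eta>. z x \<eta> / \<eta> - q x \<eta>)"
  define F where "F = (\<lambda>x \<eta>. f1 x \<eta> + \<eta> ^ (p - 1) * (1 / of_nat p * deriv b x))"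
  have FN: "dac r V (\<Omega> v) N F"
    unfolding F_def by (intro dac_add 1 dac_eta_power dac_outer holomorphic_on_mult holomorphic_on_const b')
  \<comment> \<open>The part of the right hand side that is not O(eta) is removed by explicit solutions.\<close>
  have sol: "lin_sol p (\<eta> ^ p) (\<lambda>x. \<eta> * F x \<eta>) (\<lambda>x. \<eta> * z1 x \<eta>) (Om v \<eta>)" if \<eta>: "\<eta> \<in> S" for \<eta>
  proof -
    note V = Om_V[OF \<eta>]
    have "Om v \<eta> \<subseteq> ball 0 r"
    proof
      fix x assume "x \<in> Om v \<eta>"
      from Om_norm[OF this \<eta>] show "x \<in> ball 0 r" using R by simp
    qed
    note s1 = inner_lin_sol[OF h(2) S_D(1)[OF \<eta>] p0 V]
    have s2: "lin_sol p (\<eta> ^ p) (\<lambda>x. \<Sum>j<p-1. (c j * \<eta> ^ j) * (x / \<eta>) ^ j) (\<lambda>x. \<Sum>j<p-1. (c j * \<eta> ^ j) * (\<eta> * k j (x / \<eta>))) (Om v \<eta>)"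
      by (intro lin_sol_sum lin_sol_cmult inner_lin_sol[OF k(2) S_D(1)[OF \<eta>] p0 V]) auto
    note s3 = outer_lin_sol[OF b(1) S_D(6)[OF \<eta>] p0 \<open>Om v \<eta> \<subseteq> ball 0 r\<close>]
    have all: "lin_sol p (\<eta> ^ p)
       (\<lambda>x. f x \<eta> - (g (x / \<eta>) + (\<Sum>j<p-1. (c j * \<eta> ^ j) * (x / \<eta>) ^ j) + (x ^ (p - 1) * b x - \<eta> ^ p / of_nat p * deriv b x)))
       (\<lambda>x. z x \<eta> - (\<eta> * h (x / \<eta>) + (\<Sum>j<p-1. (c j * \<eta> ^ j) * (\<eta> * k j (x / \<eta>))) + - (\<eta> ^ p / of_nat p) * b x)) (Om v \<eta>)"
      by (rule lin_sol_diff[OF Suc.prems(4)[OF \<eta>] lin_sol_add[OF lin_sol_add[OF s1 s2] s3]])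
    have ep: "\<eta> ^ p = \<eta> * \<eta> ^ (p - 1)" using p0 by (metis power_eq_if not_gr_zero)
    have zeq: "z x \<eta> - (\<eta> * h (x / \<eta>) + (\<Sum>j<p-1. (c j * \<eta> ^ j) * (\<eta> * k j (x / \<eta>))) + - (\<eta> ^ p / of_nat p) * b x)
        = \<eta> * z1 x \<eta>" for x
    proof -
      have "(\<Sum>j<p-1. (c j * \<eta> ^ j) * (\<eta> * k j (x / \<eta>))) = \<eta> * (\<Sum>j<p-1. \<eta> ^ j * (c j * k j (x / \<eta>)))"
        unfolding sum_distrib_left by (rule sum.cong) auto
      then show ?thesis
        unfolding z1_def q_def ep using S_D(1)[OF \<eta>] by (simp add: right_diff_distrib distrib_left)
    qed
    show ?thesis
    proof (rule lin_sol_cong[OF all[unfolded zeq]])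
      fix x assume x: "x \<in> Om v \<eta>"
      have "(\<Sum>j<p-1. (c j * \<eta> ^ j) * (x / \<eta>) ^ j) = (\<Sum>j<p-1. c j * x ^ j)"
        using S_D(1)[OF \<eta>] by (intro sum.cong) (auto simp: power_divide)
      moreover have "f x \<eta> = (\<Sum>j<p-1. c j * x ^ j) + x ^ (p - 1) * b x + g (x / \<eta>) + \<eta> * f1 x \<eta>"
        using 1(4)[of x \<eta>] x \<eta> b(2)[of x] by (simp add: \<Omega>_iff)
      ultimately show "f x \<eta> - (g (x / \<eta>) + (\<Sum>j<p-1. (c j * \<eta> ^ j) * (x / \<eta>) ^ j) + (x ^ (p - 1) * b x - \<eta> ^ p / of_nat p * deriv b x))
          = \<eta> * F x \<eta>"
        by (simp add: F_def ep distrib_left)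
    qed
  qed
  have sol1: "lin_sol p (\<eta> ^ p) (\<lambda>x. F x \<eta>) (\<lambda>x. z1 x \<eta>) (Om v \<eta>)" if \<eta>: "\<eta> \<in> S" for \<eta>
    using lin_sol_cmult[OF sol[OF \<eta>], of "1 / \<eta>"] S_D(1)[OF \<eta>] by simp
  have m1: "dac r V (\<Omega> v) 0 (\<lambda>x \<eta>. - 1 * q x \<eta>)"
    by (rule dac_mult_0[OF dac_outer[OF holomorphic_on_const] qN])
  define w where "w = (v' + v) / 2"
  have w: "v' < w" "w < v" "vlo \<le> w" "w \<le> R ^ p" using Suc.prems(1-3) by (auto simp: w_def)
  \<comment> \<open>Passing to a smaller cone gains the factor eta, so that the new solution is bounded.\<close>
  have bz: "dac r V (\<Omega> w) 0 z1"
  proof -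
    have "dac r V (\<Omega> w) 0 (\<lambda>x \<eta>. \<eta> * z1 x \<eta> / \<eta>)"
    proof (rule solution_dac_0[OF w(3,2) Suc.prems(3) sol])
      show "dac r V (\<Omega> v) 0 (\<lambda>x \<eta>. \<eta> * F x \<eta>)" by (rule dac_eta'[OF dac_le[OF FN]]) simp
      have "dac r V (\<Omega> v) 0 (\<lambda>x \<eta>. z x \<eta> + \<eta> * (- 1 * q x \<eta>))"
        by (intro dac_add Suc.prems(5) dac_eta' m1)
      then show "dac r V (\<Omega> v) 0 (\<lambda>x \<eta>. \<eta> * z1 x \<eta>)"
        by (rule dac_cong) (use dom in \<open>auto simp: z1_def right_diff_distrib\<close>)
    qed
    then show ?thesis by (rule dac_cong) (use S_D(1) in \<open>auto simp: \<Omega>_iff\<close>)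
  qed
  have "dac r V (\<Omega> v') N (\<lambda>x \<eta>. z1 x \<eta> / \<eta>)"
  proof (rule Suc.IH[OF Suc.prems(1) w(1,4) _ bz])
    show "lin_sol p (\<eta> ^ p) (\<lambda>x. F x \<eta>) (\<lambda>x. z1 x \<eta>) (Om w \<eta>)" if "\<eta> \<in> S" for \<eta>
      by (rule lin_sol_subset[OF sol1[OF that] Om_mono]) (use w in simp)
    show "dac r V (\<Omega> w) N F" by (rule dac_subset[OF FN \<Omega>_mono]) (use w in simp)
  qed
  moreover have "dac r V (\<Omega> v') (Suc N) q" by (rule dac_subset[OF qN \<Omega>_mono]) (use Suc.prems in simp)
  ultimately have "dac r V (\<Omega> v') (Suc N) (\<lambda>x \<eta>. \<eta> * (z1 x \<eta> / \<eta>) + q x \<eta>)"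
    by (intro dac_add dac_eta)
  then show ?case by (rule dac_cong) (use S_D(1) in \<open>auto simp: \<Omega>_iff z1_def\<close>)
qed

end

section \<open>Existence of a solution\<close>

definition picard_const :: "nat \<Rightarrow> real \<Rightarrow> real \<Rightarrow> real" where
  "picard_const p \<mu> c = ext_const p \<mu> c * (step_const p \<mu> c * (exp 1 + 1) + 1)"

lemma picard_const_pos: "p > 0 \<Longrightarrow> \<mu> > 0 \<Longrightarrow> c > 0 \<Longrightarrow> picard_const p \<mu> c > 0"
  using ext_const_ge_1[of p \<mu> c] step_const_pos[of p \<mu> c] unfolding picard_const_def
  by (intro mult_pos_pos add_pos_pos) (auto intro: less_le_trans[OF zero_less_one])

text \<open>Cauchy's estimate on discs of radius \<rho>/4 around the points of the smaller disc.\<close>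

lemma lipschitz_of_bounded:
  assumes hol: "f holomorphic_on ball 0 \<rho>" and \<rho>: "\<rho> > 0" and M: "\<And>y. y \<in> ball 0 \<rho> \<Longrightarrow> norm (f y) \<le> M"
    and y: "norm y \<le> \<rho> / 2" "norm y' \<le> \<rho> / 2"
  shows "norm (f y - f y') \<le> 4 * M / \<rho> * norm (y - y')"
proof (rule field_differentiable_bound[of "cball 0 (\<rho> / 2)"])
  fix t assume t: "t \<in> cball (0::complex) (\<rho> / 2)"
  then have "t \<in> ball 0 \<rho>" using \<rho> by simp
  then show "(f has_field_derivative deriv f t) (at t within cball 0 (\<rho> / 2))"
    by (intro has_field_derivative_at_within[OF holomorphic_derivI[OF hol open_ball]])
  have sub: "cball t (\<rho> / 4) \<subseteq> ball 0 \<rho>"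
  proof
    fix w assume "w \<in> cball t (\<rho> / 4)"
    then have "norm (t - w) \<le> \<rho> / 4" "norm t \<le> \<rho> / 2" using t by (auto simp: dist_norm)
    then have "norm w \<le> \<rho> / 2 + \<rho> / 4" using norm_triangle_ineq3[of w t] norm_minus_commute[of t w] by linarith
    then show "w \<in> ball 0 \<rho>" using \<rho> by simp
  qed
  have "norm ((deriv ^^ 1) f t) \<le> fact 1 * M / (\<rho> / 4) ^ 1"
  proof (rule Cauchy_inequality)
    show "f holomorphic_on ball t (\<rho> / 4)" using holomorphic_on_subset[OF hol] sub ball_subset_cball by blast
    show "continuous_on (cball t (\<rho> / 4)) f"
      by (rule holomorphic_on_imp_continuous_on[OF holomorphic_on_subset[OF hol sub]])
    fix w assume "norm (t - w) = \<rho> / 4"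
    then have "w \<in> cball t (\<rho> / 4)" by (simp add: dist_norm)
    then show "norm (f w) \<le> M" using sub M by blast
  qed (use \<rho> in simp)
  then show "norm (deriv f t) \<le> 4 * M / \<rho>" using \<rho> by (simp add: field_simps)
qed (use y in auto)

lemma open_sector: "open (sector a b \<rho>)"
proof -
  have "sector a b \<rho> = {x. 0 < norm x} \<inter> {x. norm x < \<rho>} \<inter> {x. arg_between a b x}"
    by (auto simp: sector_def)
  moreover have "open {x::complex. 0 < norm x}" "open {x::complex. norm x < \<rho>}"
    by (intro open_Collect_less continuous_intros)+
  ultimately show ?thesis using open_arg_between by (simp add: open_Int)
qed

context turning_point
begin

text \<open>The vertex u + |\<epsilon>| makes the base point, where x^p = u, an interior point of the domain for each \<eta>.\<close>

definition W :: "real \<Rightarrow> (complex \<times> complex) set" where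
  "W u = {(x, \<eta>). \<eta> \<in> S \<and> x \<in> Om (u + norm \<eta> ^ p) \<eta>}"

lemma W_iff: "(x, \<eta>) \<in> W u \<longleftrightarrow> \<eta> \<in> S \<and> x \<in> Om (u + norm \<eta> ^ p) \<eta>"
  by (simp add: W_def)

lemma open_W: "open (W u)"
proof -
  have "W u = (UNIV \<times> S) \<inter>
     (({w. norm (fst w) < R} \<inter> ({x. arg_between (- (B / real p)) (B / real p) x} \<times> UNIV)) \<union> {w. norm (fst w) < \<mu> * norm (snd w)}) \<inter>
     {w. \<bar>Im (fst w ^ p)\<bar> * sin (2 * \<delta>) < (u + norm (snd w) ^ p - Re (fst w ^ p)) * cos (2 * \<delta>)}"
    by (auto simp: W_def Om_def quasi_sector_def)
  moreover have "open ({x. arg_between (- (B / real p)) (B / real p) x} \<times> (UNIV :: complex set))"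
    by (intro open_Times open_arg_between open_UNIV)
  moreover have "open ((UNIV :: complex set) \<times> S)" unfolding S_def by (intro open_Times open_sector open_UNIV)
  moreover have "open {w :: complex \<times> complex. norm (fst w) < R}" "open {w :: complex \<times> complex. norm (fst w) < \<mu> * norm (snd w)}"
    "open {w :: complex \<times> complex. \<bar>Im (fst w ^ p)\<bar> * sin (2 * \<delta>) < (u + norm (snd w) ^ p - Re (fst w ^ p)) * cos (2 * \<delta>)}"
    by (intro open_Collect_less continuous_intros)+
  ultimately show ?thesis by (simp add: open_Int open_Un)
qed

lemma \<eta>_power_le:
  assumes "\<eta> \<in> S" shows "norm \<eta> ^ p \<le> \<eta>1 ^ p"
  using S_D[OF assms] by (intro power_mono) auto

text \<open>On the real axis beyond the base point, Re (x^p/\<epsilon>) exceeds its value at the base point by at most 1, which costs a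
factor exp 1. All other points see some real point below the vertex in an admissible direction.\<close>

lemma solution_bound:
  assumes u: "vlo \<le> u" "u + \<eta>1 ^ p \<le> R ^ p" and \<eta>: "\<eta> \<in> S"
    and z: "lin_sol p (\<eta> ^ p) f z (Om (u + norm \<eta> ^ p) \<eta>)" and z0: "z (of_real (root p u)) = 0"
    and M: "\<And>t. t \<in> Om (u + norm \<eta> ^ p) \<eta> \<Longrightarrow> norm (f t) \<le> M" and x: "x \<in> Om (u + norm \<eta> ^ p) \<eta>"
  shows "norm (z x) \<le> picard_const p \<mu> (sin \<delta>) * (M * norm \<eta>)"
proof -
  define h where "h = norm \<eta>"
  define v where "v = u + h ^ p"
  define s where "s = step_const p \<mu> (sin \<delta>)"
  have h: "h > 0" using S_D[OF \<eta>] by (simp add: h_def)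
  have v: "u < v" "vlo \<le> v" "v \<le> R ^ p" "v - u = h ^ p"
    using u \<eta>_power_le[OF \<eta>] zero_less_power[OF h, of p] unfolding v_def h_def by linarith+
  have u0: "u > 0" using u vlo by linarith
  note z = z[folded h_def, folded v_def] and M = M[folded h_def, folded v_def] and x = x[folded h_def, folded v_def]
  have s0: "s > 0" unfolding s_def by (rule step_const_pos[OF p0 \<mu> sin\<delta>(1)])
  have M0: "M \<ge> 0" using M[OF x] norm_ge_zero order_trans by blast
  define x0 where "x0 = complex_of_real (root p u)"
  have x0p: "x0 ^ p = of_real u" using u0 p0 by (simp add: x0_def flip: of_real_power)
  have x0: "x0 \<in> Om v \<eta>" unfolding x0_def using u0 v p0 by (intro Om_real) auto
  have \<mu>u: "(\<mu> * norm \<eta>) ^ p < u" by (rule \<mu>h_le(2)[OF \<eta> u(1)])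
  have nx0: "norm x0 \<ge> \<mu> * norm \<eta>"
  proof -
    have "(\<mu> * norm \<eta>) ^ p < (root p u) ^ p" using \<mu>u u0 p0 by simp
    then have "\<mu> * norm \<eta> < root p u" by (rule power_less_imp_less_base) (use u0 in \<open>simp add: real_root_ge_zero\<close>)
    then show ?thesis by (simp add: x0_def)
  qed
  have zreal: "norm (z (of_real (root p b))) \<le> s * (M * h) * exp 1" if b: "u \<le> b" "b < v" for b
  proof -
    have "front p x0" unfolding x0_def by (rule front_of_real[OF p0]) (use u0 in \<open>simp add: real_root_ge_zero\<close>)
    moreover have "(\<mu> * norm \<eta>) ^ p \<le> b" using \<mu>u b by linarith
    moreover have "\<bar>Im (x0 ^ p)\<bar> * sin (2 * \<delta>) \<le> (b - Re (x0 ^ p)) * cos (2 * \<delta>)"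
      unfolding x0p using b trig2 by simp
    ultimately have "norm (exp (- (of_real b / \<eta> ^ p)) * z (of_real (root p b)) - exp (- (x0 ^ p / \<eta> ^ p)) * z x0)
         \<le> s * (M * norm \<eta>) * exp (- Re (x0 ^ p / \<eta> ^ p))"
      unfolding s_def by (intro front_step[OF z M \<eta> x0 _ nx0 _ b(2) v(3)]) auto
    moreover have "z x0 = 0" using z0 by (simp add: x0_def)
    ultimately have 1: "exp (- Re (of_real b / \<eta> ^ p)) * norm (z (of_real (root p b))) \<le> s * (M * h) * exp (- Re (of_real u / \<eta> ^ p))"
      unfolding x0p h_def by (simp add: norm_mult)
    have "Re (of_real b / \<eta> ^ p) - Re (of_real u / \<eta> ^ p) \<le> 1"
    proof -
      have "Re (of_real b / \<eta> ^ p) - Re (of_real u / \<eta> ^ p) = Re (of_real (b - u) / \<eta> ^ p)"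
        by (simp only: of_real_diff diff_divide_distrib minus_complex.sel)
      also have "\<dots> \<le> norm (of_real (b - u) / \<eta> ^ p)" by (rule complex_Re_le_cmod)
      also have "\<dots> = (b - u) / h ^ p" unfolding norm_divide norm_of_real h_def norm_power using b by simp
      also have "\<dots> \<le> 1" using b v h by (simp add: pos_divide_le_eq)
      finally show ?thesis .
    qed
    then have "exp (- Re (of_real u / \<eta> ^ p)) \<le> exp (- Re (of_real b / \<eta> ^ p)) * exp 1"
      unfolding exp_add[symmetric] by simp
    then have "s * (M * h) * exp (- Re (of_real u / \<eta> ^ p)) \<le> s * (M * h) * (exp (- Re (of_real b / \<eta> ^ p)) * exp 1)"
      using s0 M0 h by (intro mult_left_mono) auto
    from order_trans[OF 1 this]
    have "exp (- Re (of_real b / \<eta> ^ p)) * norm (z (of_real (root p b)))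
        \<le> exp (- Re (of_real b / \<eta> ^ p)) * (s * (M * h) * exp 1)"
      by (simp only: mult_ac)
    then show ?thesis by (simp only: mult_le_cancel_left_pos exp_gt_zero)
  qed
  have Q: "norm (z t) \<le> s * (M * h) * exp 1 + s * (M * h)"
    if t: "t \<in> Om v \<eta>" "norm t \<ge> \<mu> * norm \<eta>" "front p t" for t
  proof -
    have cone: "\<bar>Im (t ^ p)\<bar> * sin (2 * \<delta>) < (v - Re (t ^ p)) * cos (2 * \<delta>)" using t(1) by (simp add: Om_def)
    \<comment> \<open>The real point whose left cone just contains the point in question, but not before the base point.\<close>
    define b where "b = max u (Re (t ^ p) + \<bar>Im (t ^ p)\<bar> * sin (2 * \<delta>) / cos (2 * \<delta>))"
    have "\<bar>Im (t ^ p)\<bar> * sin (2 * \<delta>) / cos (2 * \<delta>) < v - Re (t ^ p)"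
      using cone trig2(2) by (simp add: pos_divide_less_eq)
    then have b: "u \<le> b" "b < v" using v by (auto simp: b_def)
    have "\<bar>Im (t ^ p)\<bar> * sin (2 * \<delta>) / cos (2 * \<delta>) \<le> b - Re (t ^ p)" by (simp add: b_def)
    then have cb: "\<bar>Im (t ^ p)\<bar> * sin (2 * \<delta>) \<le> (b - Re (t ^ p)) * cos (2 * \<delta>)"
      using trig2(2) by (simp add: pos_divide_le_eq)
    have "(\<mu> * norm \<eta>) ^ p \<le> b" using \<mu>u b by linarith
    from front_step[OF z M \<eta> t(1,3,2) this b(2) v(3) cb, folded s_def h_def]
    have "norm (exp (- (t ^ p / \<eta> ^ p)) * z t) \<le> norm (exp (- (of_real b / \<eta> ^ p)) * z (of_real (root p b)))
        + s * (M * h) * exp (- Re (t ^ p / \<eta> ^ p))"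
      by (rule norm_le_of_diff)
    then have 1: "exp (- Re (t ^ p / \<eta> ^ p)) * norm (z t) \<le> exp (- Re (of_real b / \<eta> ^ p)) * norm (z (of_real (root p b)))
        + s * (M * h) * exp (- Re (t ^ p / \<eta> ^ p))"
      by (simp add: norm_mult)
    have "0 \<le> Re ((of_real b - t ^ p) / \<eta> ^ p)"
      by (rule order_trans[OF _ Om_dir[OF \<eta> cb]]) (use sin\<delta> in simp)
    then have "exp (- Re (of_real b / \<eta> ^ p)) \<le> exp (- Re (t ^ p / \<eta> ^ p))" by (simp add: diff_divide_distrib)
    then have "exp (- Re (of_real b / \<eta> ^ p)) * norm (z (of_real (root p b))) \<le> exp (- Re (t ^ p / \<eta> ^ p)) * (s * (M * h) * exp 1)"
      using zreal[OF b] by (intro mult_mono) auto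
    with 1 have "exp (- Re (t ^ p / \<eta> ^ p)) * norm (z t) \<le> exp (- Re (t ^ p / \<eta> ^ p)) * (s * (M * h) * exp 1 + s * (M * h))"
      by (simp add: algebra_simps)
    then show ?thesis by (simp only: mult_le_cancel_left_pos exp_gt_zero)
  qed
  have "norm (z x) \<le> ext_const p \<mu> (sin \<delta>) * ((s * (M * h) * exp 1 + s * (M * h)) + M * norm \<eta>)"
    by (rule extend_Om[OF z M \<eta> v(2,3) Q x])
  also have "\<dots> = picard_const p \<mu> (sin \<delta>) * (M * norm \<eta>)"
    by (simp add: picard_const_def s_def h_def algebra_simps)
  finally show ?thesis .
qed

text \<open>Variation of constants with initial value 0 at the base point.\<close>

definition T :: "real \<Rightarrow> (complex \<Rightarrow> complex \<Rightarrow> complex) \<Rightarrow> complex \<Rightarrow> complex \<Rightarrow> complex" where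
  "T u f x \<eta> = exp (1 * (x ^ p / \<eta> ^ p)) *
     (primitive0 (\<lambda>x \<eta>. exp (- 1 * (x ^ p / \<eta> ^ p)) * f x \<eta>) x \<eta>
      - primitive0 (\<lambda>x \<eta>. exp (- 1 * (x ^ p / \<eta> ^ p)) * f x \<eta>) (of_real (root p u)) \<eta>)"

lemma T_base: "T u f (of_real (root p u)) \<eta> = 0"
  by (simp add: T_def)

lemma T_solution:
  assumes u: "vlo \<le> u" "u + \<eta>1 ^ p \<le> R ^ p" and f: "sep_holomorphic (W u) f"
  shows "sep_holomorphic (W u) (T u f)"
    and "\<eta> \<in> S \<Longrightarrow> lin_sol p (\<eta> ^ p) (\<lambda>x. f x \<eta>) (\<lambda>x. T u f x \<eta>) (Om (u + norm \<eta> ^ p) \<eta>)"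
proof -
  define k where "k = (\<lambda>x \<eta>. exp (- 1 * (x ^ p / \<eta> ^ p)) * f x \<eta>)"
  have nz: "\<eta> \<noteq> 0" if "(x, \<eta>) \<in> W u" for x \<eta> using that S_D(1) by (auto simp: W_iff)
  have v: "vlo \<le> u + norm \<eta> ^ p" "u + norm \<eta> ^ p \<le> R ^ p" if "\<eta> \<in> S" for \<eta>
    using u \<eta>_power_le[OF that] zero_le_power[OF norm_ge_zero[of \<eta>], of p] by linarith+
  have star: "(of_real s * x, \<eta>) \<in> W u" if "(x, \<eta>) \<in> W u" "0 \<le> s" "s \<le> 1" for x \<eta> s
    using that v by (auto simp: W_iff intro!: Om_star)
  have base: "(of_real (root p u), \<eta>) \<in> W u" if "(x, \<eta>) \<in> W u" for x \<eta>
  proof -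
    have \<eta>: "\<eta> \<in> S" using that by (simp add: W_iff)
    have "u > 0" using u vlo by linarith
    then have "of_real (root p u) \<in> Om (u + norm \<eta> ^ p) \<eta>"
      using v[OF \<eta>] p0 S_D(2)[OF \<eta>] by (intro Om_real) auto
    then show ?thesis using \<eta> by (simp add: W_iff)
  qed
  have k: "sep_holomorphic (W u) k"
    unfolding k_def by (intro sep_holomorphic_mult sep_holomorphic_exp_power f) (rule nz)
  have F: "sep_holomorphic (W u) (primitive0 k)"
    by (rule sep_holomorphic_primitive0[OF open_W star k])
  show "sep_holomorphic (W u) (T u f)"
    unfolding T_def[abs_def] k_def[symmetric]
    by (intro sep_holomorphic_mult sep_holomorphic_diff F sep_holomorphic_exp_power
        sep_holomorphic_at[OF F]) (use nz base in blast)+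
  show "lin_sol p (\<eta> ^ p) (\<lambda>x. f x \<eta>) (\<lambda>x. T u f x \<eta>) (Om (u + norm \<eta> ^ p) \<eta>)" if \<eta>: "\<eta> \<in> S"
    unfolding lin_sol_def
  proof
    fix x assume "x \<in> Om (u + norm \<eta> ^ p) \<eta>"
    then have x: "(x, \<eta>) \<in> W u" using \<eta> by (simp add: W_iff)
    have F': "((\<lambda>x. primitive0 k x \<eta> - primitive0 k (of_real (root p u)) \<eta>) has_field_derivative k x \<eta> - 0) (at x)"
      by (rule DERIV_diff[OF primitive0_deriv[OF open_W star k x] DERIV_const])
    have "((\<lambda>x. x ^ p / \<eta> ^ p) has_field_derivative of_nat p * (1 * x ^ (p - Suc 0)) / \<eta> ^ p) (at x)"
      by (rule DERIV_cdivide[OF DERIV_power[OF DERIV_ident]])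
    from DERIV_mult[OF DERIV_chain2[OF DERIV_exp this] F']
    have "((\<lambda>x. exp (x ^ p / \<eta> ^ p) * (primitive0 k x \<eta> - primitive0 k (of_real (root p u)) \<eta>)) has_field_derivative
        of_nat p * x ^ (p - 1) / \<eta> ^ p * (exp (x ^ p / \<eta> ^ p) * (primitive0 k x \<eta> - primitive0 k (of_real (root p u)) \<eta>)) + exp (x ^ p / \<eta> ^ p) * k x \<eta>) (at x)"
      by (simp add: mult_ac)
    moreover have "exp (x ^ p / \<eta> ^ p) * k x \<eta> = f x \<eta>"
      by (simp add: k_def exp_minus)
    ultimately show "((\<lambda>x. T u f x \<eta>) has_field_derivative of_nat p * x ^ (p - 1) / \<eta> ^ p * T u f x \<eta> + f x \<eta>) (at x)"
      unfolding T_def k_def[symmetric] mult_1_left by (simp only:)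
  qed
qed

primrec picard :: "real \<Rightarrow> (complex \<Rightarrow> complex \<Rightarrow> complex \<Rightarrow> complex) \<Rightarrow> nat \<Rightarrow> complex \<Rightarrow> complex \<Rightarrow> complex" where
  "picard u P 0 = (\<lambda>x \<eta>. 0)"
| "picard u P (Suc n) = T u (\<lambda>x \<eta>. P x (picard u P n x \<eta>) (\<eta> ^ p))"

text \<open>The Lipschitz constant of P in y is 4 M/\<rho> on the disc of radius \<rho>/2, so the bound \<rho>/8 makes the iteration a contraction with
factor 1/2 that stays in this disc.\<close>

theorem picard_solution:
  fixes P :: "complex \<Rightarrow> complex \<Rightarrow> complex \<Rightarrow> complex"
  assumes u: "vlo \<le> u" "u + \<eta>1 ^ p \<le> R ^ p"
    and P: "holomorphic3_on (\<lambda>(x, y, \<epsilon>). P x y \<epsilon>) (ball 0 r \<times> ball 0 \<rho> \<times> \<Sigma>)"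
    and M: "\<And>x y \<epsilon>. x \<in> ball 0 r \<Longrightarrow> y \<in> ball 0 \<rho> \<Longrightarrow> \<epsilon> \<in> \<Sigma> \<Longrightarrow> norm (P x y \<epsilon>) \<le> M"
    and Py: "\<And>x \<epsilon>. x \<in> ball 0 r \<Longrightarrow> \<epsilon> \<in> \<Sigma> \<Longrightarrow> (\<lambda>y. P x y \<epsilon>) holomorphic_on ball 0 \<rho>"
    and \<Sigma>: "\<And>\<eta>. \<eta> \<in> S \<Longrightarrow> \<eta> ^ p \<in> \<Sigma>" and \<rho>: "\<rho> > 0"
    and small: "picard_const p \<mu> (sin \<delta>) * M * \<eta>1 \<le> \<rho> / 8"
  obtains y where "sep_holomorphic (W u) y"
    "\<And>\<eta>. \<eta> \<in> S \<Longrightarrow> lin_sol p (\<eta> ^ p) (\<lambda>x. P x (y x \<eta>) (\<eta> ^ p)) (\<lambda>x. y x \<eta>) (Om (u + norm \<eta> ^ p) \<eta>)"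
    "\<And>x \<eta>. (x, \<eta>) \<in> W u \<Longrightarrow> norm (y x \<eta>) \<le> \<rho> / 2"
    "\<And>x \<eta>. (x, \<eta>) \<in> W u \<Longrightarrow> norm (y x \<eta>) \<le> picard_const p \<mu> (sin \<delta>) * M * norm \<eta>"
proof -
  define C where "C = picard_const p \<mu> (sin \<delta>)"
  have C: "C > 0" unfolding C_def by (rule picard_const_pos[OF p0 \<mu> sin\<delta>(1)])
  have inball: "x \<in> ball 0 r" if "(x, \<eta>) \<in> W u" for x \<eta>
    using that Om_norm[of x "u + norm \<eta> ^ p" \<eta>] R by (auto simp: W_iff)
  have S: "\<eta> \<in> S" if "(x, \<eta>) \<in> W u" for x \<eta> using that by (simp add: W_iff)
  define G where "G = (\<lambda>y x \<eta>. P x (y x \<eta>) (\<eta> ^ p))"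
  define adm where "adm = (\<lambda>y. sep_holomorphic (W u) y \<and> (\<forall>x \<eta>. (x, \<eta>) \<in> W u \<longrightarrow> norm (y x \<eta>) \<le> \<rho> / 2))"
  have half: "y \<in> ball (0::complex) \<rho>" if "norm y \<le> \<rho> / 2" for y using that \<rho> by simp
  have G: "sep_holomorphic (W u) (G y)" if "adm y" for y
    unfolding G_def by (rule sep_holomorphic_compose3[OF P _ open_W])
      (use that inball S \<Sigma> half in \<open>auto simp: adm_def\<close>)
  have GM: "norm (G y x \<eta>) \<le> M" if "adm y" "(x, \<eta>) \<in> W u" for y x \<eta>
    unfolding G_def by (rule M) (use that inball S \<Sigma> half in \<open>auto simp: adm_def\<close>)
  have Wx: "(x, \<eta>) \<in> W u" if "x \<in> Om (u + norm \<eta> ^ p) \<eta>" "\<eta> \<in> S" for x \<eta>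
    using that by (simp add: W_iff)
  have TG: "norm (T u (G y) x \<eta>) \<le> C * M * norm \<eta>" if y: "adm y" and x: "(x, \<eta>) \<in> W u" for y x \<eta>
  proof -
    have \<eta>: "\<eta> \<in> S" and xO: "x \<in> Om (u + norm \<eta> ^ p) \<eta>" using x by (simp_all add: W_iff)
    have "norm (T u (G y) x \<eta>) \<le> C * (M * norm \<eta>)"
      unfolding C_def by (rule solution_bound[OF u \<eta> T_solution(2)[OF u G[OF y] \<eta>] T_base GM[OF y Wx[OF _ \<eta>]] xO])
    then show ?thesis by simp
  qed
  have small': "C * M * norm \<eta> \<le> \<rho> / 8" if "\<eta> \<in> S" for \<eta>
  proof (cases "M \<ge> 0")
    case True
    then have "C * M * norm \<eta> \<le> C * M * \<eta>1" using S_D(3)[OF that] C by (intro mult_left_mono) auto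
    then show ?thesis using small by (simp add: C_def)
  next
    case False
    then have "C * M * norm \<eta> \<le> 0" using C by (intro mult_nonpos_nonneg mult_nonneg_nonpos) auto
    then show ?thesis using \<rho> by simp
  qed
  have TGadm: "adm (T u (G y))" if y: "adm y" for y
    unfolding adm_def
  proof (intro conjI allI impI)
    show "sep_holomorphic (W u) (T u (G y))" by (rule T_solution(1)[OF u G[OF y]])
    fix x \<eta> assume x: "(x, \<eta>) \<in> W u"
    have "\<rho> / 8 \<le> \<rho> / 2" using \<rho> by simp
    with TG[OF y x] small'[OF S[OF x]] show "norm (T u (G y) x \<eta>) \<le> \<rho> / 2" by linarith
  qed
  have contr: "norm (T u (G y) x \<eta> - T u (G y') x \<eta>) \<le> d / 2"
    if y: "adm y" "adm y'" and d: "\<And>x \<eta>. (x, \<eta>) \<in> W u \<Longrightarrow> norm (y x \<eta> - y' x \<eta>) \<le> d" and x: "(x, \<eta>) \<in> W u" for y y' d x \<eta>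
  proof -
    have \<eta>: "\<eta> \<in> S" and xO: "x \<in> Om (u + norm \<eta> ^ p) \<eta>" using x by (simp_all add: W_iff)
    have d0: "d \<ge> 0" using d[OF x] norm_ge_zero order_trans by blast
    have M0: "M \<ge> 0" using GM[OF y(1) x] norm_ge_zero order_trans by blast
    have lip: "norm (G y t \<eta> - G y' t \<eta>) \<le> 4 * M / \<rho> * d" if t: "t \<in> Om (u + norm \<eta> ^ p) \<eta>" for t
    proof -
      have tW: "(t, \<eta>) \<in> W u" using t \<eta> by (simp add: W_iff)
      have "norm (G y t \<eta> - G y' t \<eta>) \<le> 4 * M / \<rho> * norm (y t \<eta> - y' t \<eta>)"
        unfolding G_def
        by (rule lipschitz_of_bounded[OF Py[OF inball[OF tW] \<Sigma>[OF \<eta>]] \<rho> M[OF inball[OF tW] _ \<Sigma>[OF \<eta>]]])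
           (use y tW in \<open>auto simp: adm_def\<close>)
      also have "\<dots> \<le> 4 * M / \<rho> * d" using M0 \<rho> d[OF tW] by (intro mult_left_mono) auto
      finally show ?thesis .
    qed
    have "norm (T u (G y) x \<eta> - T u (G y') x \<eta>) \<le> C * (4 * M / \<rho> * d * norm \<eta>)"
      unfolding C_def
      by (rule solution_bound[OF u \<eta> lin_sol_diff[OF T_solution(2)[OF u G[OF y(1)] \<eta>] T_solution(2)[OF u G[OF y(2)] \<eta>]] _ lip xO])
         (simp add: T_base)
    also have "\<dots> = (C * M * norm \<eta>) * (4 / \<rho> * d)" by simp
    also have "\<dots> \<le> (\<rho> / 8) * (4 / \<rho> * d)" using \<rho> d0 small'[OF \<eta>] by (intro mult_right_mono) auto
    also have "\<dots> = d / 2" using \<rho> by simp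
    finally show ?thesis .
  qed
  define Y where "Y = picard u P"
  have Y0: "Y 0 = (\<lambda>x \<eta>. 0)" and YS: "Y (Suc n) = T u (G (Y n))" for n
    by (simp_all add: Y_def G_def)
  have adm: "adm (Y n)" for n
  proof (induction n)
    case 0
    then show ?case using \<rho> by (simp add: adm_def sep_holomorphic_def Y0 case_prod_beta)
  next
    case (Suc n)
    then show ?case unfolding YS by (rule TGadm)
  qed
  have diff: "norm (Y (Suc n) x \<eta> - Y n x \<eta>) \<le> \<rho> * (1 / 2) ^ n" if "(x, \<eta>) \<in> W u" for n x \<eta>
    using that
  proof (induction n arbitrary: x \<eta>)
    case 0
    have "norm (Y (Suc 0) x \<eta>) \<le> \<rho> / 2" using adm[of "Suc 0"] 0 unfolding adm_def by blast
    then show ?case using \<rho> by (simp add: Y0)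
  next
    case (Suc n)
    have "norm (Y (Suc (Suc n)) x \<eta> - Y (Suc n) x \<eta>) \<le> (\<rho> * (1 / 2) ^ n) / 2"
      unfolding YS[of "Suc n"] YS[of n, symmetric] using contr[OF adm[of "Suc n"] adm[of n] Suc.IH Suc.prems]
      by (simp only: YS[of n, symmetric])
    then show ?case by simp
  qed
  \<comment> \<open>The iterates are partial sums of a series with geometric majorant.\<close>
  define y where "y = (\<lambda>x \<eta>. suminf (\<lambda>i. Y (Suc i) x \<eta> - Y i x \<eta>))"
  have lim: "uniform_limit (W u) (\<lambda>n (x, \<eta>). Y n x \<eta>) (\<lambda>(x, \<eta>). y x \<eta>) sequentially"
  proof -
    have "uniform_limit (W u) (\<lambda>n w. \<Sum>i<n. (\<lambda>(x, \<eta>). Y (Suc i) x \<eta> - Y i x \<eta>) w)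
        (\<lambda>w. suminf (\<lambda>i. (\<lambda>(x, \<eta>). Y (Suc i) x \<eta> - Y i x \<eta>) w)) sequentially"
    proof (rule Weierstrass_m_test)
      show "norm ((\<lambda>(x, \<eta>). Y (Suc n) x \<eta> - Y n x \<eta>) w) \<le> \<rho> * (1 / 2) ^ n" if "w \<in> W u" for n w
        using diff[of "fst w" "snd w" n] that by (simp add: case_prod_beta)
      show "summable (\<lambda>n. \<rho> * (1 / 2) ^ n :: real)" by (intro summable_mult summable_geometric) simp
    qed
    moreover have "(\<Sum>i<n. (\<lambda>(x, \<eta>). Y (Suc i) x \<eta> - Y i x \<eta>) w) = (\<lambda>(x, \<eta>). Y n x \<eta>) w" for n w
      using sum_lessThan_telescope[of "\<lambda>i. Y i (fst w) (snd w)" n] by (simp add: case_prod_beta Y0)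
    ultimately show ?thesis by (simp add: case_prod_beta' y_def)
  qed
  have ptlim: "(\<lambda>n. Y n x \<eta>) \<longlonglongrightarrow> y x \<eta>" if "(x, \<eta>) \<in> W u" for x \<eta>
    using tendsto_uniform_limitI[OF lim that] by simp
  have sep: "sep_holomorphic (W u) y"
    by (rule sep_holomorphic_uniform_limit[OF open_W _ lim]) (use adm in \<open>auto simp: adm_def\<close>)
  have bnd: "norm (y x \<eta>) \<le> \<rho> / 2" if "(x, \<eta>) \<in> W u" for x \<eta>
    by (rule tendsto_upperbound[OF tendsto_norm[OF ptlim[OF that]]])
       (use adm that in \<open>auto simp: adm_def\<close>)
  have y: "adm y" using sep bnd by (simp add: adm_def)
  have fix_point: "T u (G y) x \<eta> = y x \<eta>" if x: "(x, \<eta>) \<in> W u" for x \<eta>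
  proof (rule LIMSEQ_unique)
    show "(\<lambda>n. Y (Suc n) x \<eta>) \<longlonglongrightarrow> y x \<eta>" by (rule LIMSEQ_Suc[OF ptlim[OF x]])
    show "(\<lambda>n. Y (Suc n) x \<eta>) \<longlonglongrightarrow> T u (G y) x \<eta>"
    proof (rule LIMSEQ_I)
      fix e :: real assume e: "e > 0"
      have "\<forall>\<^sub>F n in sequentially. \<forall>w\<in>W u. dist ((\<lambda>(x, \<eta>). Y n x \<eta>) w) ((\<lambda>(x, \<eta>). y x \<eta>) w) < e"
        using lim e by (rule uniform_limitD)
      then obtain N where N: "\<And>n. n \<ge> N \<Longrightarrow> \<forall>w\<in>W u. dist ((\<lambda>(x, \<eta>). Y n x \<eta>) w) ((\<lambda>(x, \<eta>). y x \<eta>) w) < e"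
        unfolding eventually_sequentially by blast
      show "\<exists>N. \<forall>n\<ge>N. norm (Y (Suc n) x \<eta> - T u (G y) x \<eta>) < e"
      proof (intro exI[of _ N] allI impI)
        fix n assume "n \<ge> N"
        then have "norm (Y n t \<tau> - y t \<tau>) \<le> e" if "(t, \<tau>) \<in> W u" for t \<tau>
          using N that by (force simp: dist_norm)
        then have "norm (Y (Suc n) x \<eta> - T u (G y) x \<eta>) \<le> e / 2"
          unfolding YS by (rule contr[OF adm y _ x])
        also have "\<dots> < e" using e by simp
        finally show "norm (Y (Suc n) x \<eta> - T u (G y) x \<eta>) < e" .
      qed
    qed
  qed
  show ?thesis
  proof (rule that[OF sep _ bnd])
    fix \<eta> assume \<eta>: "\<eta> \<in> S"
    show "lin_sol p (\<eta> ^ p) (\<lambda>x. P x (y x \<eta>) (\<eta> ^ p)) (\<lambda>x. y x \<eta>) (Om (u + norm \<eta> ^ p) \<eta>)"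
      unfolding lin_sol_def
    proof
      fix x assume x: "x \<in> Om (u + norm \<eta> ^ p) \<eta>"
      have "((\<lambda>x. T u (G y) x \<eta>) has_field_derivative of_nat p * x ^ (p - 1) / \<eta> ^ p * T u (G y) x \<eta> + G y x \<eta>) (at x)"
        by (rule lin_solD[OF T_solution(2)[OF u G[OF y] \<eta>] x])
      then have "((\<lambda>x. y x \<eta>) has_field_derivative of_nat p * x ^ (p - 1) / \<eta> ^ p * T u (G y) x \<eta> + G y x \<eta>) (at x)"
        by (rule has_field_derivative_transform_within_open[OF _ Om_open x])
           (rule fix_point[OF Wx[OF _ \<eta>]])
      then show "((\<lambda>x. y x \<eta>) has_field_derivative of_nat p * x ^ (p - 1) / \<eta> ^ p * y x \<eta> + P x (y x \<eta>) (\<eta> ^ p)) (at x)"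
        unfolding fix_point[OF Wx[OF x \<eta>]] by (simp only: G_def)
    qed
  next
    fix x \<eta> assume x: "(x, \<eta>) \<in> W u"
    show "norm (y x \<eta>) \<le> picard_const p \<mu> (sin \<delta>) * M * norm \<eta>"
      using TG[OF y x] unfolding fix_point[OF x] C_def .
  qed
qed

end

section \<open>The expansion of the solution\<close>

text \<open>Uniform limits inherit boundedness and holomorphy. Since everything is bounded, estimates for small \<epsilon> extend
to all of \<Sigma> with larger constants.\<close>

lemma uniform_expansion_coefficients:
  fixes P :: "complex \<Rightarrow> complex \<Rightarrow> complex \<Rightarrow> complex"
  assumes r: "r > 0" and \<rho>: "\<rho> > 0" and \<delta>: "\<delta> > 0" and \<epsilon>0: "\<epsilon>0 > 0"
    and \<Sigma>: "\<Sigma> = sector (- \<delta>) \<delta> \<epsilon>0"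
    and M: "\<And>x y \<epsilon>. x \<in> ball 0 r \<Longrightarrow> y \<in> ball 0 \<rho> \<Longrightarrow> \<epsilon> \<in> \<Sigma> \<Longrightarrow> norm (P x y \<epsilon>) \<le> M"
    and Px: "\<And>y \<epsilon>. y \<in> ball 0 \<rho> \<Longrightarrow> \<epsilon> \<in> \<Sigma> \<Longrightarrow> (\<lambda>x. P x y \<epsilon>) holomorphic_on ball 0 r"
    and Py: "\<And>x \<epsilon>. x \<in> ball 0 r \<Longrightarrow> \<epsilon> \<in> \<Sigma> \<Longrightarrow> (\<lambda>y. P x y \<epsilon>) holomorphic_on ball 0 \<rho>"
    and exp: "has_uniform_expansion P (ball 0 r) (ball 0 \<rho>) \<Sigma>"
  obtains c where "\<And>n. sep_hol r \<rho> (c n)"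
    "\<And>N. \<exists>K\<ge>0. \<forall>x\<in>ball 0 r. \<forall>y\<in>ball 0 \<rho>. \<forall>\<epsilon>\<in>\<Sigma>. norm (P x y \<epsilon> - (\<Sum>n<N. c n x y * \<epsilon> ^ n)) \<le> K * norm \<epsilon> ^ N"
proof -
  obtain c where c: "\<And>N. \<exists>K. \<forall>\<^sub>F \<epsilon> in at 0 within \<Sigma>.
        \<forall>x\<in>ball 0 r. \<forall>y\<in>ball 0 \<rho>. norm (P x y \<epsilon> - (\<Sum>n<N. c n x y * \<epsilon> ^ n)) \<le> K * norm \<epsilon> ^ N"
    using exp unfolding has_uniform_expansion_def by blast
  have nz: "\<epsilon> \<noteq> 0" "norm \<epsilon> < \<epsilon>0" if "\<epsilon> \<in> \<Sigma>" for \<epsilon> using that by (auto simp: \<Sigma> sector_def)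
  have "\<exists>K d. d > 0 \<and> (\<forall>\<epsilon>\<in>\<Sigma>. norm \<epsilon> < d \<longrightarrow> (\<forall>x\<in>ball 0 r. \<forall>y\<in>ball 0 \<rho>.
          norm (P x y \<epsilon> - (\<Sum>n<N. c n x y * \<epsilon> ^ n)) \<le> K * norm \<epsilon> ^ N))" for N
    using c[of N] nz(1) unfolding eventually_at by (auto simp: dist_norm)
  then obtain K d where d: "\<And>N. d N > 0"
    and K: "\<And>N \<epsilon> x y. \<epsilon> \<in> \<Sigma> \<Longrightarrow> norm \<epsilon> < d N \<Longrightarrow> x \<in> ball 0 r \<Longrightarrow> y \<in> ball 0 \<rho> \<Longrightarrow>
          norm (P x y \<epsilon> - (\<Sum>n<N. c n x y * \<epsilon> ^ n)) \<le> K N * norm \<epsilon> ^ N"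
    by metis
  have real_in: "of_real t \<in> \<Sigma>" if "0 < t" "t < \<epsilon>0" for t
    using that arg_between_of_real[of "- \<delta>" \<delta> t] \<delta> by (simp add: \<Sigma> sector_def)
  have sep: "sep_hol r \<rho> (c n)" for n
  proof (induction n rule: less_induct)
    case (less n)
    \<comment> \<open>The n-th coefficient is the uniform limit of the normalised remainders of order n.\<close>
    define q where "q = (\<lambda>\<epsilon> x y. (P x y \<epsilon> - (\<Sum>m<n. c m x y * \<epsilon> ^ m)) / \<epsilon> ^ n)"
    have q: "norm (q \<epsilon> x y - c n x y) \<le> K (Suc n) * norm \<epsilon>"
      if "\<epsilon> \<in> \<Sigma>" "norm \<epsilon> < d (Suc n)" "x \<in> ball 0 r" "y \<in> ball 0 \<rho>" for \<epsilon> x y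
    proof -
      have "q \<epsilon> x y - c n x y = (P x y \<epsilon> - (\<Sum>m<Suc n. c m x y * \<epsilon> ^ m)) / \<epsilon> ^ n"
        using nz(1)[OF that(1)] by (simp add: q_def field_simps)
      then have "norm (q \<epsilon> x y - c n x y) = norm (P x y \<epsilon> - (\<Sum>m<Suc n. c m x y * \<epsilon> ^ m)) / norm \<epsilon> ^ n"
        by (simp only: norm_divide norm_power)
      also have "\<dots> \<le> K (Suc n) * norm \<epsilon> ^ Suc n / norm \<epsilon> ^ n"
        by (intro divide_right_mono K that) simp
      also have "\<dots> = K (Suc n) * norm \<epsilon>" using nz(1)[OF that(1)] by simp
      finally show ?thesis .
    qed
    define t where "t = (\<lambda>k::nat. complex_of_real (min (min (d n) (d (Suc n))) \<epsilon>0 / (real k + 2)))"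
    define e where "e = min (min (d n) (d (Suc n))) \<epsilon>0"
    have e: "e > 0" using d \<epsilon>0 by (simp add: e_def)
    have nt: "norm (t k) = e / (real k + 2)" for k
      unfolding t_def norm_of_real using e by (simp add: e_def)
    have ek: "0 < e / (real k + 2)" "e / (real k + 2) < e" for k
      using e by (simp_all add: pos_divide_less_eq)
    have t: "t k \<in> \<Sigma>" "norm (t k) < d n" "norm (t k) < d (Suc n)" for k
    proof -
      show "t k \<in> \<Sigma>" unfolding t_def e_def[symmetric]
        by (rule real_in) (use ek[of k] in \<open>auto simp: e_def\<close>)
      show "norm (t k) < d n" "norm (t k) < d (Suc n)" using ek[of k] unfolding nt by (auto simp: e_def)
    qed
    have lim0: "(\<lambda>k. K (Suc n) * norm (t k)) \<longlonglongrightarrow> 0"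
      unfolding nt by real_asymp
    have bound: "norm (c n x y) \<le> K n + K (Suc n) * norm (t 0)" if "x \<in> ball 0 r" "y \<in> ball 0 \<rho>" for x y
    proof -
      have "norm (q (t 0) x y) = norm (P x y (t 0) - (\<Sum>m<n. c m x y * t 0 ^ m)) / norm (t 0) ^ n"
        by (simp only: q_def norm_divide norm_power)
      also have "\<dots> \<le> K n * norm (t 0) ^ n / norm (t 0) ^ n"
        by (intro divide_right_mono K that t) simp
      also have "\<dots> = K n" using nz(1)[OF t(1)[of 0]] by simp
      finally have "norm (q (t 0) x y) \<le> K n" .
      moreover have "norm (c n x y) \<le> norm (q (t 0) x y) + K (Suc n) * norm (t 0)"
        by (rule norm_le_of_diff[OF q[OF t(1,3) that]])
      ultimately show ?thesis by linarith
    qed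
    have ul: "uniform_limit A (\<lambda>k a. q (t k) (f a) (g a)) (\<lambda>a. c n (f a) (g a)) sequentially"
      if A: "\<And>a. a \<in> A \<Longrightarrow> f a \<in> ball 0 r \<and> g a \<in> ball 0 \<rho>" for f g :: "complex \<Rightarrow> complex" and A
    proof (rule uniform_limitI)
      fix e' :: real assume "e' > 0"
      with lim0 have "\<forall>\<^sub>F k in sequentially. K (Suc n) * norm (t k) < e'" by (rule order_tendstoD)
      then show "\<forall>\<^sub>F k in sequentially. \<forall>a\<in>A. dist (q (t k) (f a) (g a)) (c n (f a) (g a)) < e'"
      proof (rule eventually_mono, intro ballI)
        fix k a assume k: "K (Suc n) * norm (t k) < e'" and a: "a \<in> A"
        have "dist (q (t k) (f a) (g a)) (c n (f a) (g a)) \<le> K (Suc n) * norm (t k)"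
          unfolding dist_norm using A[OF a] by (intro q t) auto
        then show "dist (q (t k) (f a) (g a)) (c n (f a) (g a)) < e'" using k by (rule le_less_trans)
      qed
    qed
    have "(\<lambda>x. c n x y) holomorphic_on ball 0 r" if y: "y \<in> ball 0 \<rho>" for y
    proof (rule holomorphic_uniform_sequence[OF open_ball])
      show "(\<lambda>x. q (t k) x y) holomorphic_on ball 0 r" for k
      proof -
        have "(\<lambda>x. c m x y) holomorphic_on ball 0 r" if "m < n" for m
          using less[OF that] y unfolding sep_hol_def by blast
        then show ?thesis unfolding q_def
          using nz(1)[OF t(1)[of k]] by (intro holomorphic_on_divide holomorphic_on_diff Px y t holomorphic_on_sum
              holomorphic_on_mult holomorphic_on_const) auto
      qed
      fix x :: complex assume "x \<in> ball 0 r"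
      then obtain s where s: "s > 0" "cball x s \<subseteq> ball 0 r" using open_contains_cball open_ball by blast
      have "uniform_limit (cball x s) (\<lambda>k a. q (t k) a y) (\<lambda>a. c n a y) sequentially"
        by (rule ul[of _ "\<lambda>a. a" "\<lambda>a. y"]) (use s y in auto)
      then show "\<exists>d>0. cball x d \<subseteq> ball 0 r \<and> uniform_limit (cball x d) (\<lambda>k x. q (t k) x y) (\<lambda>x. c n x y) sequentially"
        using s by blast
    qed
    moreover have "c n x holomorphic_on ball 0 \<rho>" if x: "x \<in> ball 0 r" for x
    proof (rule holomorphic_uniform_sequence[OF open_ball])
      show "(\<lambda>y. q (t k) x y) holomorphic_on ball 0 \<rho>" for k
      proof -
        have "c m x holomorphic_on ball 0 \<rho>" if "m < n" for m
          using less[OF that] x unfolding sep_hol_def by blast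
        then show ?thesis unfolding q_def
          using nz(1)[OF t(1)[of k]] by (intro holomorphic_on_divide holomorphic_on_diff Py x t holomorphic_on_sum
              holomorphic_on_mult holomorphic_on_const) auto
      qed
      fix y :: complex assume "y \<in> ball 0 \<rho>"
      then obtain s where s: "s > 0" "cball y s \<subseteq> ball 0 \<rho>" using open_contains_cball open_ball by blast
      have "uniform_limit (cball y s) (\<lambda>k a. q (t k) x a) (\<lambda>a. c n x a) sequentially"
        by (rule ul[of _ "\<lambda>a. x" "\<lambda>a. a"]) (use s x in auto)
      then show "\<exists>d>0. cball y d \<subseteq> ball 0 \<rho> \<and> uniform_limit (cball y d) (\<lambda>k y. q (t k) x y) (c n x) sequentially"
        using s by blast
    qed
    ultimately show ?case unfolding sep_hol_def using bound by blast
  qed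
  have "\<exists>L\<ge>0. \<forall>x\<in>ball 0 r. \<forall>y\<in>ball 0 \<rho>. \<forall>\<epsilon>\<in>\<Sigma>. norm (P x y \<epsilon> - (\<Sum>n<N. c n x y * \<epsilon> ^ n)) \<le> L * norm \<epsilon> ^ N" for N
  proof -
    have "\<exists>b. \<forall>x\<in>ball 0 r. \<forall>y\<in>ball 0 \<rho>. norm (c n x y) \<le> b" for n
      using sep[of n] unfolding sep_hol_def by blast
    then obtain b where b: "\<And>n x y. x \<in> ball 0 r \<Longrightarrow> y \<in> ball 0 \<rho> \<Longrightarrow> norm (c n x y) \<le> b n" by metis
    have b0: "b n \<ge> 0" for n using order_trans[OF norm_ge_zero b[of 0 0]] r \<rho> by simp
    define H where "H = \<bar>M\<bar> + (\<Sum>n<N. b n * \<epsilon>0 ^ n)"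
    have H: "H \<ge> 0" unfolding H_def using b0 \<epsilon>0 by (intro add_nonneg_nonneg sum_nonneg) auto
    define L where "L = \<bar>K N\<bar> + H / d N ^ N"
    have L0: "L \<ge> 0" unfolding L_def using H d[of N] by simp
    have "norm (P x y \<epsilon> - (\<Sum>n<N. c n x y * \<epsilon> ^ n)) \<le> L * norm \<epsilon> ^ N"
      if xy: "x \<in> ball 0 r" "y \<in> ball 0 \<rho>" and \<epsilon>: "\<epsilon> \<in> \<Sigma>" for x y \<epsilon>
    proof (cases "norm \<epsilon> < d N")
      case True
      have "K N * norm \<epsilon> ^ N \<le> L * norm \<epsilon> ^ N"
      proof (rule mult_right_mono)
        have "0 \<le> H / d N ^ N" using H d[of N] by (intro divide_nonneg_pos zero_less_power)
        then show "K N \<le> L" unfolding L_def by linarith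
      qed simp
      with K[OF \<epsilon> True xy] show ?thesis by (rule order_trans)
    next
      case False
      have "norm (\<Sum>n<N. c n x y * \<epsilon> ^ n) \<le> (\<Sum>n<N. b n * \<epsilon>0 ^ n)"
      proof (rule sum_norm_le)
        fix n
        show "norm (c n x y * \<epsilon> ^ n) \<le> b n * \<epsilon>0 ^ n"
          unfolding norm_mult norm_power using nz(2)[OF \<epsilon>] b0 b[OF xy]
          by (intro mult_mono power_mono) auto
      qed
      then have "norm (P x y \<epsilon> - (\<Sum>n<N. c n x y * \<epsilon> ^ n)) \<le> H"
        unfolding H_def using M[OF xy \<epsilon>] by (intro order_trans[OF norm_triangle_ineq4] add_mono) auto
      also have "H = H / d N ^ N * d N ^ N" using d[of N] by simp
      also have "\<dots> \<le> L * norm \<epsilon> ^ N"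
        unfolding L_def using False H d[of N] by (intro mult_mono power_mono) (auto intro: less_imp_le)
      finally show ?thesis .
    qed
    with L0 show ?thesis by blast
  qed
  with sep show ?thesis by (rule that)
qed

context turning_point
begin

lemma \<Omega>_scale:
  assumes "(x, \<eta>) \<in> \<Omega> v" "vlo \<le> v" "0 < s" "s \<le> 1"
  shows "(of_real s * x, of_real s * \<eta>) \<in> \<Omega> v"
proof -
  have \<eta>: "\<eta> \<in> S" and x: "x \<in> Om v \<eta>" using assms(1) by (simp_all add: \<Omega>_iff)
  have n: "norm (of_real s * x) \<le> norm x" "norm (of_real s * \<eta>) \<le> norm \<eta>"
    using assms by (simp_all add: norm_mult mult_left_le_one_le)
  have sS: "of_real s * \<eta> \<in> S"
    using \<eta> n(2) arg_between_scale[OF S_D(7)[OF \<eta>] assms(3)] assms(3) S_D(1)[OF \<eta>]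
    unfolding S_def sector_def by auto
  have "of_real s * x \<in> Om v \<eta>" by (rule Om_star[OF x \<eta> assms(2)]) (use assms in auto)
  moreover have "norm (of_real s * x) < R \<and> arg_between (- (B / real p)) (B / real p) (of_real s * x)
      \<or> norm (of_real s * x) < \<mu> * norm (of_real s * \<eta>)"
  proof (cases "norm x < \<mu> * norm \<eta>")
    case True
    then have "s * norm x < s * (\<mu> * norm \<eta>)" using assms(3) by (rule mult_strict_left_mono)
    then show ?thesis using assms(3) by (simp add: norm_mult mult_ac)
  next
    case False
    then have "arg_between (- (B / real p)) (B / real p) x" "norm x < R"
      using x by (auto simp: Om_def quasi_sector_def)
    then show ?thesis using arg_between_scale assms(3) n(1) by auto
  qed
  ultimately show ?thesis using sS unfolding \<Omega>_iff Om_def quasi_sector_def by auto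
qed

text \<open>The right hand side is expanded in powers of \<epsilon> first; each coefficient is then a function of x and y = \<eta> y1.\<close>

lemma nonlinearity_dac:
  assumes \<rho>: "\<rho> > 0" and c: "\<And>n. sep_hol r \<rho> (c n)"
    and K: "\<And>N. \<exists>K\<ge>0. \<forall>x\<in>ball 0 r. \<forall>y\<in>ball 0 \<rho>. \<forall>\<epsilon>\<in>\<Sigma>. norm (P x y \<epsilon> - (\<Sum>n<N. c n x y * \<epsilon> ^ n)) \<le> K * norm \<epsilon> ^ N"
    and \<Sigma>: "\<And>\<eta>. \<eta> \<in> S \<Longrightarrow> \<eta> ^ p \<in> \<Sigma>"
    and small: "\<And>x \<eta>. (x, \<eta>) \<in> \<Omega> v \<Longrightarrow> norm (\<eta> * y1 x \<eta>) < \<rho>"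
    and y1: "dac r V (\<Omega> v) N y1"
  shows "dac r V (\<Omega> v) (Suc N) (\<lambda>x \<eta>. P x (\<eta> * y1 x \<eta>) (\<eta> ^ p))"
proof -
  interpret dac_domain r R V "\<Omega> v" by (rule dac_domain_\<Omega>)
  have r: "r > 0" using R by simp
  define F where "F = (\<lambda>x \<eta>. \<Sum>n<Suc N. \<eta> ^ (p * n) * c n x (\<eta> * y1 x \<eta>))"
  have "dac r V (\<Omega> v) (Suc N) F"
    unfolding F_def by (intro dac_sum dac_eta_power dac_compose[OF \<rho> r small y1 c]) auto
  moreover obtain L where L: "L \<ge> 0" "\<And>x y \<epsilon>. x \<in> ball 0 r \<Longrightarrow> y \<in> ball 0 \<rho> \<Longrightarrow> \<epsilon> \<in> \<Sigma> \<Longrightarrow>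
      norm (P x y \<epsilon> - (\<Sum>n<Suc N. c n x y * \<epsilon> ^ n)) \<le> L * norm \<epsilon> ^ Suc N"
    using K[of "Suc N"] by blast
  have "dac r V (\<Omega> v) (Suc N) (\<lambda>x \<eta>. P x (\<eta> * y1 x \<eta>) (\<eta> ^ p) - F x \<eta>)"
  proof (rule dac_of_bound)
    fix x \<eta> assume x: "(x, \<eta>) \<in> \<Omega> v"
    then have \<eta>: "\<eta> \<in> S" by (simp add: \<Omega>_iff)
    have "x \<in> ball 0 r" using dom[OF x] R by simp
    moreover have "\<eta> * y1 x \<eta> \<in> ball 0 \<rho>" using small[OF x] by simp
    ultimately have "norm (P x (\<eta> * y1 x \<eta>) (\<eta> ^ p) - (\<Sum>n<Suc N. c n x (\<eta> * y1 x \<eta>) * (\<eta> ^ p) ^ n)) \<le> L * norm (\<eta> ^ p) ^ Suc N"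
      by (intro L \<Sigma> \<eta>)
    moreover have "(\<Sum>n<Suc N. c n x (\<eta> * y1 x \<eta>) * (\<eta> ^ p) ^ n) = F x \<eta>"
      unfolding F_def by (rule sum.cong[OF refl]) (simp only: power_mult mult.commute[of "c _ _ _"])
    moreover have "norm (\<eta> ^ p) ^ Suc N \<le> norm \<eta> ^ Suc N"
    proof (rule power_mono)
      show "norm (\<eta> ^ p) \<le> norm \<eta>"
        unfolding norm_power using power_decreasing[of 1 p "norm \<eta>"] p0 S_D(4)[OF \<eta>] by simp
    qed simp
    ultimately show "norm (P x (\<eta> * y1 x \<eta>) (\<eta> ^ p) - F x \<eta>) \<le> L * norm \<eta> ^ Suc N"
      using L(1) by (metis mult_left_mono order_trans)
  qed
  ultimately have "dac r V (\<Omega> v) (Suc N) (\<lambda>x \<eta>. F x \<eta> + (P x (\<eta> * y1 x \<eta>) (\<eta> ^ p) - F x \<eta>))"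
    by (rule dac_add)
  then show ?thesis by simp
qed

text \<open>Every step of the induction loses some of the cone; proving the claim for all vertices below u at once leaves room for
arbitrarily many steps.\<close>

theorem solution_has_expansion:
  fixes P :: "complex \<Rightarrow> complex \<Rightarrow> complex \<Rightarrow> complex"
  assumes u: "vlo < u" "u \<le> R ^ p" and \<rho>: "\<rho> > 0"
    and c: "\<And>n. sep_hol r \<rho> (c n)"
    and K: "\<And>N. \<exists>K\<ge>0. \<forall>x\<in>ball 0 r. \<forall>y\<in>ball 0 \<rho>. \<forall>\<epsilon>\<in>\<Sigma>. norm (P x y \<epsilon> - (\<Sum>n<N. c n x y * \<epsilon> ^ n)) \<le> K * norm \<epsilon> ^ N"
    and \<Sigma>: "\<And>\<eta>. \<eta> \<in> S \<Longrightarrow> \<eta> ^ p \<in> \<Sigma>"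
    and y: "\<And>\<eta>. \<eta> \<in> S \<Longrightarrow> lin_sol p (\<eta> ^ p) (\<lambda>x. P x (y x \<eta>) (\<eta> ^ p)) (\<lambda>x. y x \<eta>) (Om u \<eta>)"
    and y\<rho>: "\<And>x \<eta>. (x, \<eta>) \<in> \<Omega> u \<Longrightarrow> norm (y x \<eta>) < \<rho>"
    and yC: "\<And>x \<eta>. (x, \<eta>) \<in> \<Omega> u \<Longrightarrow> norm (y x \<eta>) \<le> C * norm \<eta>"
  obtains a g where "\<And>n. a n holomorphic_on ball 0 r" "\<And>n. g n \<in> inner_fun V"
    "\<And>N. \<exists>K. \<forall>x \<eta>. (x, \<eta>) \<in> \<Omega> vlo \<longrightarrow> norm (y x \<eta> - (\<Sum>n<N. (a n x + g n (x / \<eta>)) * \<eta> ^ n)) \<le> K * norm \<eta> ^ N"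
proof -
  define y1 where "y1 = (\<lambda>x \<eta>. y x \<eta> / \<eta>)"
  have yy1: "\<eta> * y1 x \<eta> = y x \<eta>" if "\<eta> \<in> S" for x \<eta> using S_D(1)[OF that] by (simp add: y1_def)
  have main: "dac r V (\<Omega> v) N y1" if "vlo \<le> v" "v < u" for v N
    using that
  proof (induction N arbitrary: v)
    case 0
    show ?case
    proof (rule dac_0I)
      fix x \<eta> assume x: "(x, \<eta>) \<in> \<Omega> v"
      then have \<eta>: "\<eta> \<in> S" by (simp add: \<Omega>_iff)
      have "(x, \<eta>) \<in> \<Omega> u" using x \<Omega>_mono[of v u] 0 by auto
      then show "norm (y1 x \<eta>) \<le> C"
        using yC S_D(2)[OF \<eta>] by (simp add: y1_def norm_divide pos_divide_le_eq)
    qed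
  next
    case (Suc N)
    define w where "w = (v + u) / 2"
    have w: "v < w" "w < u" "vlo \<le> w" "w \<le> R ^ p" using Suc.prems u by (auto simp: w_def)
    have sub: "\<Omega> w \<subseteq> \<Omega> u" "Om w \<eta> \<subseteq> Om u \<eta>" for \<eta> using w \<Omega>_mono Om_mono by auto
    show ?case unfolding y1_def
    proof (rule solution_dac[OF Suc.prems(1) w(1,4)])
      show "lin_sol p (\<eta> ^ p) (\<lambda>x. P x (y x \<eta>) (\<eta> ^ p)) (\<lambda>x. y x \<eta>) (Om w \<eta>)" if "\<eta> \<in> S" for \<eta>
        by (rule lin_sol_subset[OF y[OF that] sub(2)])
      show "dac r V (\<Omega> w) 0 y"
        by (rule dac_0I[where K = \<rho>]) (use y\<rho> sub(1) in \<open>auto intro: less_imp_le\<close>)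
      have "dac r V (\<Omega> w) (Suc N) (\<lambda>x \<eta>. P x (\<eta> * y1 x \<eta>) (\<eta> ^ p))"
      proof (rule nonlinearity_dac[OF \<rho> c K \<Sigma> _ Suc.IH[OF w(3,2)]])
        fix x \<eta> assume x: "(x, \<eta>) \<in> \<Omega> w"
        then have "\<eta> \<in> S" by (simp add: \<Omega>_iff)
        then show "norm (\<eta> * y1 x \<eta>) < \<rho>" using y\<rho> sub(1) x yy1 by auto
      qed
      then show "dac r V (\<Omega> w) (Suc N) (\<lambda>x \<eta>. P x (y x \<eta>) (\<eta> ^ p))"
        by (rule dac_cong) (simp add: \<Omega>_iff yy1)
    qed
  qed
  define t0 where "t0 = min (root p vlo) r"
  have dd: "dac_domain r R V (\<Omega> vlo)" by (rule dac_domain_\<Omega>)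
  interpret dac_scaling r R V "\<Omega> vlo" "of_real (\<eta>1 / 2)" t0
  proof (rule dac_scaling.intro[OF dd], unfold_locales)
    show "(of_real s * x, of_real s * \<eta>) \<in> \<Omega> vlo" if "(x, \<eta>) \<in> \<Omega> vlo" "0 < s" "s \<le> 1" for x \<eta> s
      by (rule \<Omega>_scale[OF that(1) order_refl that(2,3)])
    show "0 < t0" "t0 \<le> r" using vlo R p0 by (auto simp: t0_def)
    show "(of_real t, of_real s * of_real (\<eta>1 / 2)) \<in> \<Omega> vlo" if t: "0 < t" "t < t0" and s: "0 < s" "s \<le> 1" for t s
    proof -
      have "t < root p vlo" using t by (simp add: t0_def)
      then have "t ^ p < (root p vlo) ^ p" using t p0 by (intro power_strict_mono) auto
      then have "t ^ p < vlo" using p0 vlo by simp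
      then have 1: "of_real t \<in> Om vlo (of_real (s * (\<eta>1 / 2)))" using t vlo by (intro Om_real) auto
      have "s * (\<eta>1 / 2) > 0" "s * (\<eta>1 / 2) < \<eta>1"
        using s \<eta>1 mult_left_le_one_le[of "\<eta>1 / 2" s] by auto
      then have "of_real (s * (\<eta>1 / 2)) \<in> S"
        unfolding S_def sector_def using arg_between_of_real[of "- (\<delta> / real p)" "\<delta> / real p" "s * (\<eta>1 / 2)"] \<delta> p0
        by (auto simp del: of_real_mult of_real_divide simp: norm_of_real)
      with 1 show ?thesis unfolding \<Omega>_iff by simp
    qed
  qed
  have "dac r V (\<Omega> vlo) N y" for N
    by (rule dac_cong[OF dac_eta'[OF main[OF order_refl u(1)]]]) (simp add: \<Omega>_iff yy1)
  then show ?thesis using dac_sequence that by blast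
qed

end

section \<open>Existence and composite expansion\<close>

lemma holomorphic2_on_subset: "holomorphic2_on f U \<Longrightarrow> U' \<subseteq> U \<Longrightarrow> holomorphic2_on f U'"
  unfolding holomorphic2_on_def by blast

theorem mainTheorem3:
  fixes p :: nat
  assumes "p \<ge> 2"
  shows "\<exists>\<delta>\<^sub>0 > 0. \<forall>(\<delta>::real) (r\<^sub>0::real) (r\<^sub>2::real) (\<epsilon>\<^sub>0::real) (r\<^sub>1::real)
      (P :: complex \<Rightarrow> complex \<Rightarrow> complex \<Rightarrow> complex) D\<^sub>1 D\<^sub>2 \<Sigma> \<alpha> \<beta>.
    0 < \<delta> \<and> \<delta> < \<delta>\<^sub>0 \<and> 0 < r\<^sub>0 \<and> 0 < r\<^sub>2 \<and> 0 < \<epsilon>\<^sub>0 \<and>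
    D\<^sub>1 = ball 0 r\<^sub>0 \<and> D\<^sub>2 = ball 0 r\<^sub>2 \<and> \<Sigma> = sector (- \<delta>) \<delta> \<epsilon>\<^sub>0 \<and>
    \<alpha> = - (3 * pi / (2 * real p)) + 2 * \<delta> / real p \<and>
    \<beta> = 3 * pi / (2 * real p) - 2 * \<delta> / real p \<and>
    0 < r\<^sub>1 \<and> r\<^sub>1 < r\<^sub>0 * (cos (2 * \<delta>)) powr (1 / real p) \<and>
    holomorphic3_on (\<lambda>(x, y, \<epsilon>). P x y \<epsilon>) (D\<^sub>1 \<times> D\<^sub>2 \<times> \<Sigma>) \<and>
    bounded ((\<lambda>(x, y, \<epsilon>). P x y \<epsilon>) ` (D\<^sub>1 \<times> D\<^sub>2 \<times> \<Sigma>)) \<and>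
    has_uniform_expansion P D\<^sub>1 D\<^sub>2 \<Sigma>
    \<longrightarrow> (\<forall>\<mu> > 0. \<exists>\<eta>\<^sub>1 > 0. \<exists>y :: complex \<Rightarrow> complex \<Rightarrow> complex.
          (\<forall>\<eta>\<in>sector (- (\<delta> / real p)) (\<delta> / real p) \<eta>\<^sub>1.
             solves_on p P D\<^sub>1 D\<^sub>2 \<Sigma> (\<eta> ^ p) (\<lambda>x. y x \<eta>) (quasi_sector \<alpha> \<beta> r\<^sub>1 (\<mu> * cmod \<eta>))) \<and>
          has_DAC y \<alpha> \<beta> r\<^sub>1 \<mu> (- (\<delta> / real p)) (\<delta> / real p) \<eta>\<^sub>1)"
proof (rule exI[of _ "pi / 8"], intro conjI allI impI, goal_cases)
  case 1
  show ?case by simp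
next
  case (2 \<delta> r0 \<rho> \<epsilon>0 r1 P D1 D2 \<Sigma> \<alpha> \<beta> \<mu>)
  have p0: "p > 0" using assms by simp
  from 2 have \<delta>: "0 < \<delta>" "\<delta> \<le> pi / 8" and r0: "r0 > 0" and \<rho>: "\<rho> > 0" and \<epsilon>0: "\<epsilon>0 > 0"
    and D: "D1 = ball 0 r0" "D2 = ball 0 \<rho>" and \<Sigma>: "\<Sigma> = sector (- \<delta>) \<delta> \<epsilon>0"
    and \<alpha>: "\<alpha> = - (3 * pi / (2 * real p)) + 2 * \<delta> / real p" and \<beta>: "\<beta> = 3 * pi / (2 * real p) - 2 * \<delta> / real p"
    and r1: "0 < r1" "r1 < r0 * (cos (2 * \<delta>)) powr (1 / real p)"
    and P: "holomorphic3_on (\<lambda>(x, y, \<epsilon>). P x y \<epsilon>) (ball 0 r0 \<times> ball 0 \<rho> \<times> \<Sigma>)"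
    and Pb: "bounded ((\<lambda>(x, y, \<epsilon>). P x y \<epsilon>) ` (ball 0 r0 \<times> ball 0 \<rho> \<times> \<Sigma>))"
    and Pe: "has_uniform_expansion P (ball 0 r0) (ball 0 \<rho>) \<Sigma>" and \<mu>: "\<mu> > 0"
    by auto
  have c2: "cos (2 * \<delta>) > 0" "cos (2 * \<delta>) \<le> 1" using \<delta> by (auto intro!: cos_gt_zero)
  have s1: "sin \<delta> > 0" using \<delta> by (intro sin_gt_zero) auto
  obtain M where M: "\<And>x y \<epsilon>. x \<in> ball 0 r0 \<Longrightarrow> y \<in> ball 0 \<rho> \<Longrightarrow> \<epsilon> \<in> \<Sigma> \<Longrightarrow> norm (P x y \<epsilon>) \<le> M" and M0: "M > 0"
  proof -
    obtain b where b: "b > 0" "\<forall>t \<in> (\<lambda>(x, y, \<epsilon>). P x y \<epsilon>) ` (ball 0 r0 \<times> ball 0 \<rho> \<times> \<Sigma>). norm t \<le> b"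
      using Pb unfolding bounded_pos by blast
    show ?thesis by (rule that[OF _ b(1)]) (use b(2) in force)
  qed
  have Px: "(\<lambda>x. P x y \<epsilon>) holomorphic_on ball 0 r0" if "y \<in> ball 0 \<rho>" "\<epsilon> \<in> \<Sigma>" for y \<epsilon>
    unfolding holomorphic_on_open[OF open_ball]
  proof
    fix x :: complex assume "x \<in> ball 0 r0"
    with that show "\<exists>f'. ((\<lambda>x. P x y \<epsilon>) has_field_derivative f') (at x)"
      by (intro holomorphic3_chain[OF P _ DERIV_ident DERIV_const DERIV_const]) auto
  qed
  have Py: "(\<lambda>y. P x y \<epsilon>) holomorphic_on ball 0 \<rho>" if "x \<in> ball 0 r0" "\<epsilon> \<in> \<Sigma>" for x \<epsilon>
    unfolding holomorphic_on_open[OF open_ball]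
  proof
    fix y :: complex assume "y \<in> ball 0 \<rho>"
    with that show "\<exists>f'. ((\<lambda>y. P x y \<epsilon>) has_field_derivative f') (at y)"
      by (intro holomorphic3_chain[OF P _ DERIV_const DERIV_ident DERIV_const]) auto
  qed
  define q where "q = r1 ^ p / cos (2 * \<delta>)"
  have q0: "q > 0" unfolding q_def using r1(1) c2 by simp
  have qr: "q < r0 ^ p"
  proof -
    have "r1 ^ p < (r0 * (cos (2 * \<delta>)) powr (1 / real p)) ^ p"
      using r1 p0 by (intro power_strict_mono) auto
    also have "\<dots> = r0 ^ p * cos (2 * \<delta>)"
      using c2 p0 by (simp add: power_mult_distrib powr_powr flip: powr_realpow)
    finally show ?thesis unfolding q_def using c2 by (simp add: pos_divide_less_eq)
  qed
  \<comment> \<open>q is the limiting vertex for the disc of radius r1. Four equal gaps separate q < vlo < u < w = R^p < r0^p: the final expansion holds for vertex vlo, the base point is u, and w leaves room for the moving vertex.\<close>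
  define d where "d = (r0 ^ p - q) / 4"
  have d: "d > 0" using qr by (simp add: d_def)
  define vlo where "vlo = q + d"
  define u where "u = q + 2 * d"
  define w where "w = q + 3 * d"
  define R where "R = root p w"
  have w0: "w > 0" using q0 d by (simp add: w_def)
  have Rp: "R ^ p = w" using w0 p0 by (simp add: R_def)
  have R0: "R > 0" using w0 p0 by (simp add: R_def)
  have "R ^ p < r0 ^ p" unfolding Rp w_def d_def using qr by (simp add: field_simps)
  then have Rr: "R < r0" by (rule power_less_imp_less_base) (use r0 in simp)
  have qlo: "vlo < w" "vlo < u" "u < w" "q < vlo" "w - u = d" using d by (auto simp: vlo_def w_def u_def)
  have r1p: "r1 ^ p = q * cos (2 * \<delta>)" using c2 by (simp add: q_def)
  have r1R: "r1 < R"
  proof (rule power_less_imp_less_base)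
    have "q * cos (2 * \<delta>) \<le> q * 1" using q0 c2 by (intro mult_left_mono) auto
    then show "r1 ^ p < R ^ p" unfolding r1p Rp using qlo by simp
  qed (use R0 in simp)
  define C where "C = picard_const p \<mu> (sin \<delta>)"
  have C: "C > 0" unfolding C_def by (rule picard_const_pos[OF p0 \<mu> s1])
  define \<eta>1 where "\<eta>1 = Min {1, r1 / \<mu>, \<epsilon>0, d, \<rho> / 8 / (C * M)}"
  have e1: "\<eta>1 > 0" "\<eta>1 \<le> 1" "\<eta>1 \<le> r1 / \<mu>" "\<eta>1 \<le> \<epsilon>0" "\<eta>1 \<le> d" "\<eta>1 \<le> \<rho> / 8 / (C * M)"
    using r1(1) \<mu> \<epsilon>0 d \<rho> C M0 unfolding \<eta>1_def by auto
  have \<mu>r1: "\<mu> * \<eta>1 \<le> r1" using e1(3) \<mu> by (simp add: pos_le_divide_eq mult.commute)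
  have \<eta>1p: "\<eta>1 ^ p \<le> \<eta>1" using e1 p0 power_decreasing[of 1 p \<eta>1] by simp
  have small: "C * M * \<eta>1 \<le> \<rho> / 8" using e1(6) C M0 by (simp add: pos_le_divide_eq mult_ac)
  interpret turning_point p \<delta> \<mu> "3 * pi / 2 - \<delta>"
    "quasi_sector (- ((3 * pi / 2 - \<delta>) / real p)) ((3 * pi / 2 - \<delta>) / real p) \<infinity> \<mu>"
    r0 R \<eta>1 vlo "sector (- (\<delta> / real p)) (\<delta> / real p) \<eta>1"
  proof (unfold_locales, simp_all only: )
    show "2 \<le> p" by (rule assms)
    show "(\<mu> * \<eta>1) ^ p \<le> vlo * cos (2 * \<delta>)"
    proof -
      have "(\<mu> * \<eta>1) ^ p \<le> r1 ^ p" using \<mu>r1 \<mu> e1(1) by (intro power_mono) auto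
      also have "\<dots> \<le> vlo * cos (2 * \<delta>)" unfolding r1p using qlo c2 by (intro mult_right_mono) auto
      finally show ?thesis .
    qed
  qed (use \<delta> \<mu> R0 Rr e1 q0 qlo Rp in auto)
  let ?S = "sector (- (\<delta> / real p)) (\<delta> / real p) \<eta>1"
  have \<Sigma>S: "\<eta> ^ p \<in> \<Sigma>" if \<eta>: "\<eta> \<in> ?S" for \<eta>
  proof -
    have "norm \<eta> ^ p \<le> norm \<eta> ^ 1" using S_D(4)[OF \<eta>] p0 by (intro power_decreasing) auto
    then have 1: "norm (\<eta> ^ p) < \<epsilon>0" using S_D(3)[OF \<eta>] e1(4) by (simp add: norm_power)
    obtain \<tau> where "is_Arg (\<eta> ^ p) \<tau>" "\<bar>\<tau>\<bar> < \<delta>" using S_arg[OF \<eta>] by blast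
    then have "arg_between (- \<delta>) \<delta> (\<eta> ^ p)"
      unfolding arg_between_def using S_D(6)[OF \<eta>] by (auto simp: abs_less_iff intro!: exI[of _ \<tau>])
    then show ?thesis using 1 S_D(6)[OF \<eta>] by (simp add: \<Sigma> sector_def)
  qed
  have uR: "u + \<eta>1 ^ p \<le> R ^ p" unfolding Rp using \<eta>1p e1(5) qlo by linarith
  have ule: "vlo \<le> u" "u \<le> R ^ p" using qlo Rp by auto
  obtain y where ysep: "sep_holomorphic (W u) y"
    and ysol: "\<And>\<eta>. \<eta> \<in> ?S \<Longrightarrow> lin_sol p (\<eta> ^ p) (\<lambda>x. P x (y x \<eta>) (\<eta> ^ p)) (\<lambda>x. y x \<eta>) (Om (u + norm \<eta> ^ p) \<eta>)"
    and y\<rho>: "\<And>x \<eta>. (x, \<eta>) \<in> W u \<Longrightarrow> norm (y x \<eta>) \<le> \<rho> / 2"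
    and yC: "\<And>x \<eta>. (x, \<eta>) \<in> W u \<Longrightarrow> norm (y x \<eta>) \<le> picard_const p \<mu> (sin \<delta>) * M * norm \<eta>"
  proof (rule picard_solution[OF ule(1) uR P _ _ _ \<rho> small[unfolded C_def]], goal_cases)
    case (1 x y \<epsilon>) show ?case by (rule M[OF 1(2-4)])
  next
    case (2 x \<epsilon>) show ?case by (rule Py[OF 2(2,3)])
  next
    case (3 \<eta>) show ?case by (rule \<Sigma>S[OF 3(2)])
  next
    case (4 y) show ?case by (rule 4(1)[OF 4(2-5)])
  qed
  have OmW: "(x, \<eta>) \<in> W u" if "(x, \<eta>) \<in> \<Omega> v" "v \<le> u" for x \<eta> v
  proof -
    have "v \<le> u + norm \<eta> ^ p" using that(2) zero_le_power[OF norm_ge_zero[of \<eta>], of p] by linarith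
    then show ?thesis using that(1) Om_mono[of v "u + norm \<eta> ^ p" \<eta>] by (auto simp: W_iff \<Omega>_iff)
  qed
  obtain c where c: "\<And>n. sep_hol r0 \<rho> (c n)"
    and cK: "\<And>N. \<exists>K\<ge>0. \<forall>x\<in>ball 0 r0. \<forall>y\<in>ball 0 \<rho>. \<forall>\<epsilon>\<in>\<Sigma>. norm (P x y \<epsilon> - (\<Sum>n<N. c n x y * \<epsilon> ^ n)) \<le> K * norm \<epsilon> ^ N"
  proof (rule uniform_expansion_coefficients[OF r0 \<rho> \<delta>(1) \<epsilon>0 \<Sigma> _ _ _ Pe, where M = M], goal_cases)
    case (1 x y \<epsilon>) show ?case by (rule M[OF 1(2-4)])
  next
    case (2 y \<epsilon>) show ?case by (rule Px[OF 2(2,3)])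
  next
    case (3 x \<epsilon>) show ?case by (rule Py[OF 3(2,3)])
  next
    case (4 c) show ?case by (rule 4(1)[OF 4(2,3)])
  qed
  obtain a g where a: "\<And>n. a n holomorphic_on ball 0 r0"
    and g: "\<And>n. g n \<in> inner_fun (quasi_sector (- ((3 * pi / 2 - \<delta>) / real p)) ((3 * pi / 2 - \<delta>) / real p) \<infinity> \<mu>)"
    and rem: "\<And>N. \<exists>K. \<forall>x \<eta>. (x, \<eta>) \<in> \<Omega> vlo \<longrightarrow> norm (y x \<eta> - (\<Sum>n<N. (a n x + g n (x / \<eta>)) * \<eta> ^ n)) \<le> K * norm \<eta> ^ N"
  proof (rule solution_has_expansion[OF qlo(2) ule(2) \<rho> c cK, where y = y and C = "picard_const p \<mu> (sin \<delta>) * M"], goal_cases)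
    case (1 \<eta>) show ?case by (rule \<Sigma>S[OF 1(2)])
  next
    case (2 \<eta>)
    show ?case by (rule lin_sol_subset[OF ysol[OF 2(2)] Om_mono]) simp
  next
    case (3 x \<eta>)
    show ?case using y\<rho>[OF OmW[OF 3(2) order_refl]] \<rho> by simp
  next
    case (4 x \<eta>)
    show ?case by (rule yC[OF OmW[OF 4(2) order_refl]])
  next
    case (5 a g) show ?case by (rule 5(1)[OF 5(2-4)])
  qed
  have \<alpha>B: "\<alpha> = - (B / real p)" and \<beta>B: "\<beta> = B / real p"
    unfolding \<alpha> \<beta> B_def using p0 by (simp_all add: field_simps)
  have Vr1: "norm x < r1" if "\<eta> \<in> ?S" "x \<in> quasi_sector \<alpha> \<beta> (ereal r1) (\<mu> * norm \<eta>)" for x \<eta>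
  proof -
    have "\<mu> * norm \<eta> \<le> \<mu> * \<eta>1" using S_D(3)[OF that(1)] \<mu> by (intro mult_left_mono) auto
    then show ?thesis using that(2) \<mu>r1 by (auto simp: quasi_sector_def)
  qed
  have VOm: "x \<in> Om vlo \<eta>" if "\<eta> \<in> ?S" "x \<in> quasi_sector \<alpha> \<beta> (ereal r1) (\<mu> * norm \<eta>)" for x \<eta>
  proof -
    note n = Vr1[OF that]
    have "norm (x ^ p) < r1 ^ p" unfolding norm_power using n p0 by (intro power_strict_mono) auto
    also have "\<dots> < vlo * cos (2 * \<delta>)" unfolding r1p using qlo c2 by (intro mult_strict_right_mono) auto
    finally have "\<bar>Im (x ^ p)\<bar> * sin (2 * \<delta>) < (vlo - Re (x ^ p)) * cos (2 * \<delta>)" by (rule cone_of_norm)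
    then show ?thesis using that(2) n r1R unfolding Om_def \<alpha>B \<beta>B quasi_sector_def by auto
  qed
  have V\<Omega>: "(x, \<eta>) \<in> \<Omega> vlo" if "\<eta> \<in> ?S" "x \<in> quasi_sector \<alpha> \<beta> (ereal r1) (\<mu> * norm \<eta>)" for x \<eta>
    using VOm[OF that] that(1) by (simp add: \<Omega>_iff)
  have VW: "(x, \<eta>) \<in> W u" if "\<eta> \<in> ?S" "x \<in> quasi_sector \<alpha> \<beta> (ereal r1) (\<mu> * norm \<eta>)" for x \<eta>
    by (rule OmW[OF V\<Omega>[OF that] ule(1)])
  show ?case
  proof (intro exI[of _ \<eta>1] exI[of _ y] conjI ballI)
    show "\<eta>1 > 0" by (rule e1)
    show "solves_on p P D1 D2 \<Sigma> (\<eta> ^ p) (\<lambda>x. y x \<eta>) (quasi_sector \<alpha> \<beta> r1 (\<mu> * cmod \<eta>))" if \<eta>: "\<eta> \<in> ?S" for \<eta>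
      unfolding solves_on_def D
    proof (intro conjI ballI subsetI)
      let ?V = "quasi_sector \<alpha> \<beta> (ereal r1) (\<mu> * cmod \<eta>)"
      show "\<eta> ^ p \<in> \<Sigma>" by (rule \<Sigma>S[OF \<eta>])
      show "x \<in> ball 0 r0" if "x \<in> ?V" for x using Vr1[OF \<eta> that] r1R Rr by simp
      show "t \<in> ball 0 \<rho>" if t: "t \<in> (\<lambda>x. y x \<eta>) ` ?V" for t
      proof -
        obtain x where x: "x \<in> ?V" "t = y x \<eta>" using t by blast
        show ?thesis using y\<rho>[OF VW[OF \<eta> x(1)]] \<rho> x(2) by simp
      qed
      have deriv: "((\<lambda>x. y x \<eta>) has_field_derivative of_nat p * x ^ (p - 1) / \<eta> ^ p * y x \<eta> + P x (y x \<eta>) (\<eta> ^ p)) (at x)"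
        if "x \<in> ?V" for x
        by (rule lin_solD[OF ysol[OF \<eta>]]) (use VW[OF \<eta> that] in \<open>simp add: W_iff\<close>)
      then show "(\<lambda>x. y x \<eta>) holomorphic_on ?V"
        unfolding holomorphic_on_open[OF open_quasi_sector] by blast
      show "\<eta> ^ p * deriv (\<lambda>x. y x \<eta>) x = of_nat p * x ^ (p - 1) * y x \<eta> + \<eta> ^ p * P x (y x \<eta>) (\<eta> ^ p)"
        if "x \<in> ?V" for x
        unfolding DERIV_imp_deriv[OF deriv[OF that]] using S_D(1)[OF \<eta>] by (simp add: distrib_left)
    qed
    show "has_DAC y \<alpha> \<beta> r1 \<mu> (- (\<delta> / real p)) (\<delta> / real p) \<eta>1"
      unfolding has_DAC_def
    proof (intro conjI ballI)
      show "\<alpha> < \<beta>" unfolding \<alpha>B \<beta>B using B_pos p0 by simp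
      show "quasi_sector \<alpha> \<beta> (ereal r1) (\<mu> * cmod \<eta>) \<subseteq> ball 0 r1" if "\<eta> \<in> ?S" for \<eta>
        using Vr1[OF that] by auto
      show "holomorphic2_on (\<lambda>(x, \<eta>). y x \<eta>) {(x, \<eta>). \<eta> \<in> ?S \<and> x \<in> quasi_sector \<alpha> \<beta> (ereal r1) (\<mu> * cmod \<eta>)}"
        by (rule holomorphic2_on_subset[OF sep_holomorphic_imp_holomorphic2[OF open_W ysep]]) (use VW in auto)
      have "a n \<in> bounded_holomorphic r1" for n
      proof -
        have sub: "cball 0 r1 \<subseteq> ball 0 r0" using r1R Rr by auto
        have "bounded (a n ` cball 0 r1)"
          by (intro compact_imp_bounded compact_continuous_image compact_cball
              holomorphic_on_imp_continuous_on holomorphic_on_subset[OF a sub])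
        then have "bounded (a n ` ball 0 r1)" by (rule bounded_subset) auto
        moreover have "a n holomorphic_on ball 0 r1" by (rule holomorphic_on_subset[OF a]) (use sub in auto)
        ultimately show ?thesis by (simp add: bounded_holomorphic_def)
      qed
      moreover have "g n \<in> bounded_asymptotic (quasi_sector (- ((3 * pi / 2 - \<delta>) / real p)) ((3 * pi / 2 - \<delta>) / real p) \<infinity> \<mu>)" for n
        by (rule inner_fun_imp_bounded_asymptotic[OF g])
      moreover have "\<exists>K. \<forall>\<eta>\<in>?S. \<forall>x\<in>quasi_sector \<alpha> \<beta> (ereal r1) (\<mu> * cmod \<eta>).
           cmod (y x \<eta> - (\<Sum>n<N. (a n x + g n (x / \<eta>)) * \<eta> ^ n)) \<le> K * cmod \<eta> ^ N" for N
        using rem[of N] V\<Omega> by blast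
      moreover have "\<alpha> - \<delta> / real p = - ((3 * pi / 2 - \<delta>) / real p)" "\<beta> - - (\<delta> / real p) = (3 * pi / 2 - \<delta>) / real p"
        unfolding \<alpha> \<beta> using p0 by (simp_all add: field_simps)
      moreover have "- ((3 * pi / 2 - \<delta>) / real p) < (3 * pi / 2 - \<delta>) / real p" using A_pos p0 by simp
      ultimately show "\<exists>\<alpha>' \<beta>'. \<exists>a g :: nat \<Rightarrow> complex \<Rightarrow> complex.
        \<alpha>' \<le> \<alpha> - \<delta> / real p \<and> \<alpha> - \<delta> / real p < \<beta> - - (\<delta> / real p) \<and> \<beta> - - (\<delta> / real p) \<le> \<beta>' \<and>
        (\<forall>n. a n \<in> bounded_holomorphic r1) \<and>
        (\<forall>n. g n \<in> bounded_asymptotic (quasi_sector \<alpha>' \<beta>' \<infinity> \<mu>)) \<and>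
        (\<forall>N. \<exists>K. \<forall>\<eta>\<in>?S. \<forall>x\<in>quasi_sector \<alpha> \<beta> (ereal r1) (\<mu> * cmod \<eta>).
           cmod (y x \<eta> - (\<Sum>n<N. (a n x + g n (x / \<eta>)) * \<eta> ^ n)) \<le> K * cmod \<eta> ^ N)"
        by - (rule exI[of _ "- ((3 * pi / 2 - \<delta>) / real p)"], rule exI[of _ "(3 * pi / 2 - \<delta>) / real p"],
            rule exI[of _ a], rule exI[of _ g], simp)
    qed
  qed
qed

end
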